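(* Let $X$ be a weakly chained uniform space whose uniform structure is metrizable. Then $\phi:\widetilde{X}\rightarrow X$ is a UU-cover (uniform universal covering map) of $X$ with deck group $\pi_{U}(X)$. That is, $\phi$ is a generalized regular covering map with deck group $\pi_U(X)$, and $\widetilde{X}$ is uniformly simply connected.
   Context: Uniform spaces are Hausdorff and have a basepoint $\ast$; entourages are symmetric. For an entourage $E$ of $X$, an $E$-chain is a finite sequence $\{x_0,\dots,x_n\}$ with $(x_i,x_{i+1})\in E$ for all $i$. An $E$-homotopy between $E$-chains with the same endpoints is a finite sequence of $E$-chains, each obtained from the previous one by adding or removing a single point, never an endpoint; $[\alpha]_E$ denotes the $E$-homotopy class, $[x,y]_E$ the class of $\{x,y\}$. $X$ is chain connected if for every entourage $D$ any two points are joined by a $D$-chain. An entourage $E$ is weakly $F$-chained, for an entourage $F\subset E$, if for every $(x,y)\in F$ and every entourage $D\subset E$ there is a $D$-chain $\alpha$ from $x$ to $y$ with $[\alpha]_E=[x,y]_E$; $E$ is weakly chained if it is weakly $F$-chained for some $F$. $X$ is weakly chained if it is chain connected and its uniform structure has a basis of weakly chained entourages. $X_E$ is the set of all $[\alpha]_E$ with $\alpha$ an $E$-chain starting at $\ast$; $\phi_E:X_E\to X$ sends $[\alpha]_E$ to the endpoint of $\alpha$. A basis for the uniform structure of $X_E$ consists of the sets $F^\ast$, $F\subset E$ an entourage, where $([\alpha]_E,[\beta]_E)\in F^\ast$ iff, with $a,b$ the endpoints of $\alpha,\beta$, $(a,b)\in F$ and the reversal of $\alpha$ followed by $\beta$ is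 $E$-homotopic to $\{a,b\}$. The basepoint of $X_E$ is $[\ast]_E$. $\pi_E(X)$ is the group of $E$-homotopy classes of $E$-loops at $\ast$ under concatenation, acting on $X_E$ by pre-concatenation. For $F\subset E$, $\phi_{EF}:X_F\to X_E$ is $\phi_{EF}([\alpha]_F)=[\alpha]_E$, restricting to a homomorphism $\pi_F(X)\to\pi_E(X)$. $\widetilde{X}:=\varprojlim X_E$ as a uniform space with basepoint $([\ast]_E)_E$, $\pi_U(X):=\varprojlim\pi_E(X)$ (the uniform fundamental group), acting coordinatewise on $\widetilde X$, and $\phi:\widetilde{X}\to X$ is the endpoint projection. A uniform space $Y$ is uniformly simply connected if it is weakly chained and $\pi_U(Y)$ is trivial. A map $f:Y\to X$ is a UU-cover of $X$ if $f$ is a generalized regular covering map and $Y$ is uniformly simply connected. Discrete cover: a surjection $f:Y\to X$ of uniform spaces that is bi-uniformly continuous (uniformly continuous, and images of entourages are entourages) and whose fibres are exactly the orbits of a group $G$ of uniform homeomorphisms of $Y$ such that $Y$ has a basis of $G$-invariant entourages and there is an entourage $E$ of $Y$ with: $(y,g(y))\in E$ for some $y$ implies $g=1$. Generalized regular covering map $f:Y\to X$ with deck group $G$ (characterized as inverse limits of discrete covers): there is an inverse system of uniform spaces $Y_\alpha$ with surjective uniformly continuous bonding maps, and discrete covers $f_\alpha:Y_\alpha\to X$ with groups $G_\alpha$, the $f_\alpha$ commuting with the bonding maps and the $G_\alpha$ forming an inverse system of groups with surjective homomorphisms for which the bonding maps are equivariant, such that $Y=\varprojlim Y_\alpha$ with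 surjective projections, $f$ is the map induced by the $f_\alpha$, $G=\varprojlim G_\alpha$ acts coordinatewise on $Y$, and $f$ is a surjection whose fibres are exactly the $G$-orbits. *)

theory Defs
  imports "HOL-Analysis.Abstract_Metric_Spaces" "HOL-Algebra.Group_Action"
begin

section \<open>Uniform spaces with explicit carrier\<close>

text \<open>
  The type class \<open>uniform_space\<close> is tied to a whole type, whereas the spaces \<open>X\<^sub>E\<close> below depend on
  a set \<open>E\<close>. A uniform structure is therefore a filter on pairs that is concentrated on the square
  of an explicit carrier. As in the class, the filter is the usual (not necessarily symmetric)
  uniformity; by convention an \<^emph>\<open>entourage\<close> is a symmetric member of it.
\<close>

record 'a uspace =
  points :: "'a set"
  unif :: "('a \<times> 'a) filter"

definition hausdorff_uniform :: "'a uspace \<Rightarrow> bool" where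
  "hausdorff_uniform X \<longleftrightarrow>
     (\<forall>\<^sub>F p in unif X. p \<in> points X \<times> points X) \<and>
     (\<forall>P. (\<forall>\<^sub>F p in unif X. P p) \<longrightarrow> (\<forall>x\<in>points X. P (x, x))) \<and>
     (\<forall>P. (\<forall>\<^sub>F p in unif X. P p) \<longrightarrow> (\<forall>\<^sub>F (x, y) in unif X. P (y, x))) \<and>
     (\<forall>P. (\<forall>\<^sub>F p in unif X. P p) \<longrightarrow>
        (\<exists>D. (\<forall>\<^sub>F p in unif X. D p) \<and> (\<forall>x y z. D (x, y) \<longrightarrow> D (y, z) \<longrightarrow> P (x, z)))) \<and>
     (\<forall>x\<in>points X. \<forall>y\<in>points X. x \<noteq> y \<longrightarrow> (\<exists>P. (\<forall>\<^sub>F p in unif X. P p) \<and> \<not> P (x, y)))"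

definition entourage :: "'a uspace \<Rightarrow> ('a \<times> 'a) set \<Rightarrow> bool" where
  "entourage X E \<longleftrightarrow>
     E \<subseteq> points X \<times> points X \<and> sym E \<and> (\<forall>\<^sub>F p in unif X. p \<in> E)"

definition uniform_basis :: "'a uspace \<Rightarrow> ('a \<times> 'a) set set \<Rightarrow> bool" where
  "uniform_basis X \<B> \<longleftrightarrow>
     (\<forall>E\<in>\<B>. entourage X E) \<and> (\<forall>D. entourage X D \<longrightarrow> (\<exists>E\<in>\<B>. E \<subseteq> D))"

definition metrizable_uniform :: "'a uspace \<Rightarrow> bool" where
  "metrizable_uniform X \<longleftrightarrow>
     (\<exists>d. Metric_space (points X) d \<and>
          unif X = (INF e\<in>{0<..}. principal {(x, y) \<in> points X \<times> points X. d x y < e}))"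

definition uniformly_cont :: "'a uspace \<Rightarrow> 'b uspace \<Rightarrow> ('a \<Rightarrow> 'b) \<Rightarrow> bool" where
  "uniformly_cont X Y f \<longleftrightarrow>
     f \<in> points X \<rightarrow> points Y \<and> filterlim (\<lambda>(x, y). (f x, f y)) (unif Y) (unif X)"

definition bi_uniformly_cont :: "'a uspace \<Rightarrow> 'b uspace \<Rightarrow> ('a \<Rightarrow> 'b) \<Rightarrow> bool" where
  "bi_uniformly_cont X Y f \<longleftrightarrow>
     uniformly_cont X Y f \<and> (\<forall>E. entourage X E \<longrightarrow> entourage Y ((\<lambda>(x, y). (f x, f y)) ` E))"

definition uniform_homeo :: "'a uspace \<Rightarrow> 'b uspace \<Rightarrow> ('a \<Rightarrow> 'b) \<Rightarrow> bool" where
  "uniform_homeo X Y f \<longleftrightarrow>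
     bij_betw f (points X) (points Y) \<and> uniformly_cont X Y f \<and>
     uniformly_cont Y X (inv_into (points X) f)"


section \<open>Chains and their homotopies\<close>

definition is_chain :: "'a uspace \<Rightarrow> ('a \<times> 'a) set \<Rightarrow> 'a list \<Rightarrow> bool" where
  "is_chain X E \<alpha> \<longleftrightarrow>
     \<alpha> \<noteq> [] \<and> set \<alpha> \<subseteq> points X \<and> successively (\<lambda>x y. (x, y) \<in> E) \<alpha>"

text \<open>
  \<open>add_point \<alpha> \<beta>\<close>: the list \<open>\<beta>\<close> arises from \<open>\<alpha>\<close> by inserting one point. A basic move inserts or
  deletes one point and keeps the first and the last point. For chains with at least two entries
  this is the same as never touching an endpoint, since inserting a copy of an endpoint next to it
  is an interior insertion. The formulation in terms of preserved endpoints also makes \<open>{x}\<close> and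
  \<open>{x, x}\<close> homotopic, without which chain classes at a point would not form a group.
\<close>

definition add_point :: "'a list \<Rightarrow> 'a list \<Rightarrow> bool" where
  "add_point \<alpha> \<beta> \<longleftrightarrow> (\<exists>u x v. \<alpha> = u @ v \<and> \<beta> = u @ [x] @ v)"

definition basic_move :: "'a uspace \<Rightarrow> ('a \<times> 'a) set \<Rightarrow> 'a list \<Rightarrow> 'a list \<Rightarrow> bool" where
  "basic_move X E \<alpha> \<beta> \<longleftrightarrow>
     is_chain X E \<alpha> \<and> is_chain X E \<beta> \<and> hd \<alpha> = hd \<beta> \<and> last \<alpha> = last \<beta> \<and>
     (add_point \<alpha> \<beta> \<or> add_point \<beta> \<alpha>)"

definition chain_homotopic :: "'a uspace \<Rightarrow> ('a \<times> 'a) set \<Rightarrow> 'a list \<Rightarrow> 'a list \<Rightarrow> bool" where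
  "chain_homotopic X E = rtranclp (basic_move X E)"

definition chain_class :: "'a uspace \<Rightarrow> ('a \<times> 'a) set \<Rightarrow> 'a list \<Rightarrow> 'a list set" where
  "chain_class X E \<alpha> = {\<beta>. chain_homotopic X E \<alpha> \<beta>}"

definition chain_connected :: "'a uspace \<Rightarrow> bool" where
  "chain_connected X \<longleftrightarrow>
     (\<forall>D. entourage X D \<longrightarrow>
        (\<forall>x\<in>points X. \<forall>y\<in>points X. \<exists>\<alpha>. is_chain X D \<alpha> \<and> hd \<alpha> = x \<and> last \<alpha> = y))"

definition weakly_F_chained :: "'a uspace \<Rightarrow> ('a \<times> 'a) set \<Rightarrow> ('a \<times> 'a) set \<Rightarrow> bool" where
  "weakly_F_chained X F E \<longleftrightarrow>
     entourage X E \<and> entourage X F \<and> F \<subseteq> E \<and>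
     (\<forall>x y D. (x, y) \<in> F \<and> entourage X D \<and> D \<subseteq> E \<longrightarrow>
        (\<exists>\<alpha>. is_chain X D \<alpha> \<and> hd \<alpha> = x \<and> last \<alpha> = y \<and>
             chain_class X E \<alpha> = chain_class X E [x, y]))"

definition weakly_chained_entourage :: "'a uspace \<Rightarrow> ('a \<times> 'a) set \<Rightarrow> bool" where
  "weakly_chained_entourage X E \<longleftrightarrow> (\<exists>F. weakly_F_chained X F E)"

definition weakly_chained :: "'a uspace \<Rightarrow> bool" where
  "weakly_chained X \<longleftrightarrow>
     chain_connected X \<and>
     (\<exists>\<B>. uniform_basis X \<B> \<and> (\<forall>E\<in>\<B>. weakly_chained_entourage X E))"


section \<open>The spaces \<open>X\<^sub>E\<close> and the groups \<open>\<pi>\<^sub>E(X)\<close>\<close>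

definition XE_star ::
    "'a uspace \<Rightarrow> 'a \<Rightarrow> ('a \<times> 'a) set \<Rightarrow> ('a \<times> 'a) set \<Rightarrow> ('a list set \<times> 'a list set) set" where
  "XE_star X b E F =
     {(chain_class X E \<alpha>, chain_class X E \<beta>) |\<alpha> \<beta>.
        is_chain X E \<alpha> \<and> hd \<alpha> = b \<and> is_chain X E \<beta> \<and> hd \<beta> = b \<and>
        (last \<alpha>, last \<beta>) \<in> F \<and>
        chain_homotopic X E (rev \<alpha> @ tl \<beta>) [last \<alpha>, last \<beta>]}"

definition XE :: "'a uspace \<Rightarrow> 'a \<Rightarrow> ('a \<times> 'a) set \<Rightarrow> 'a list set uspace" where
  "XE X b E =
     \<lparr>points = {chain_class X E \<alpha> |\<alpha>. is_chain X E \<alpha> \<and> hd \<alpha> = b},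
      unif = (INF F\<in>{F. entourage X F \<and> F \<subseteq> E}. principal (XE_star X b E F))\<rparr>"

definition class_end :: "'a list set \<Rightarrow> 'a" where
  "class_end c = (THE x. \<exists>\<alpha>\<in>c. x = last \<alpha>)"

text \<open>
  Operations on classes are lifted from chains by the usual union over representatives:
  \<open>c\<close> is mapped to the class of any of its members. Concatenated chains share their common point.
\<close>

definition bond_XE :: "'a uspace \<Rightarrow> ('a \<times> 'a) set \<Rightarrow> 'a list set \<Rightarrow> 'a list set" where
  "bond_XE X E c = (\<Union>\<alpha>\<in>c. chain_class X E \<alpha>)"

definition class_concat ::
    "'a uspace \<Rightarrow> ('a \<times> 'a) set \<Rightarrow> 'a list set \<Rightarrow> 'a list set \<Rightarrow> 'a list set" where
  "class_concat X E c d = (\<Union>\<alpha>\<in>c. \<Union>\<beta>\<in>d. chain_class X E (\<alpha> @ tl \<beta>))"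

definition pi_E :: "'a uspace \<Rightarrow> 'a \<Rightarrow> ('a \<times> 'a) set \<Rightarrow> 'a list set monoid" where
  "pi_E X b E =
     \<lparr>carrier = {chain_class X E \<alpha> |\<alpha>. is_chain X E \<alpha> \<and> hd \<alpha> = b \<and> last \<alpha> = b},
      mult = class_concat X E,
      one = chain_class X E [b]\<rparr>"

definition pi_E_action ::
    "'a uspace \<Rightarrow> 'a \<Rightarrow> ('a \<times> 'a) set \<Rightarrow> 'a list set \<Rightarrow> 'a list set \<Rightarrow> 'a list set" where
  "pi_E_action X b E g = (\<lambda>c\<in>points (XE X b E). class_concat X E g c)"


section \<open>Inverse limits\<close>

definition directed_index :: "'i set \<Rightarrow> 'i rel \<Rightarrow> bool" where
  "directed_index I r \<longleftrightarrow>
     partial_order_on I r \<and> I \<noteq> {} \<and>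
     (\<forall>i\<in>I. \<forall>j\<in>I. \<exists>k\<in>I. (i, k) \<in> r \<and> (j, k) \<in> r)"

text \<open>
  For \<open>(i, j) \<in> r\<close> (that is, \<open>i \<le> j\<close>) the bonding map \<open>p i j\<close> goes from stage \<open>j\<close> to stage \<open>i\<close>.
\<close>

definition uniform_inverse_system ::
    "'i set \<Rightarrow> 'i rel \<Rightarrow> ('i \<Rightarrow> 'a uspace) \<Rightarrow> ('i \<Rightarrow> 'i \<Rightarrow> 'a \<Rightarrow> 'a) \<Rightarrow> bool" where
  "uniform_inverse_system I r Y p \<longleftrightarrow>
     directed_index I r \<and>
     (\<forall>i\<in>I. hausdorff_uniform (Y i)) \<and>
     (\<forall>(i, j)\<in>r. uniformly_cont (Y j) (Y i) (p i j)) \<and>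
     (\<forall>i\<in>I. \<forall>y\<in>points (Y i). p i i y = y) \<and>
     (\<forall>i j k. (i, j) \<in> r \<and> (j, k) \<in> r \<longrightarrow> (\<forall>y\<in>points (Y k). p i k y = p i j (p j k y)))"

definition inv_limit_points ::
    "'i set \<Rightarrow> 'i rel \<Rightarrow> ('i \<Rightarrow> 'a set) \<Rightarrow> ('i \<Rightarrow> 'i \<Rightarrow> 'a \<Rightarrow> 'a) \<Rightarrow> ('i \<Rightarrow> 'a) set" where
  "inv_limit_points I r S p = {y \<in> Pi\<^sub>E I S. \<forall>(i, j)\<in>r. p i j (y j) = y i}"

text \<open>The uniformity is the one induced from the product, the coarsest making all projections
  uniformly continuous.\<close>

definition inv_limit_uspace ::
    "'i set \<Rightarrow> 'i rel \<Rightarrow> ('i \<Rightarrow> 'a uspace) \<Rightarrow> ('i \<Rightarrow> 'i \<Rightarrow> 'a \<Rightarrow> 'a) \<Rightarrow> ('i \<Rightarrow> 'a) uspace" where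
  "inv_limit_uspace I r Y p =
     (let L = inv_limit_points I r (\<lambda>i. points (Y i)) p in
      \<lparr>points = L,
       unif = inf (principal (L \<times> L)) (INF i\<in>I. filtercomap (\<lambda>(x, y). (x i, y i)) (unif (Y i)))\<rparr>)"

definition group_inverse_system ::
    "'i set \<Rightarrow> 'i rel \<Rightarrow> ('i \<Rightarrow> 'g monoid) \<Rightarrow> ('i \<Rightarrow> 'i \<Rightarrow> 'g \<Rightarrow> 'g) \<Rightarrow> bool" where
  "group_inverse_system I r G h \<longleftrightarrow>
     directed_index I r \<and>
     (\<forall>i\<in>I. group (G i)) \<and>
     (\<forall>(i, j)\<in>r. h i j \<in> hom (G j) (G i)) \<and>
     (\<forall>i\<in>I. \<forall>g\<in>carrier (G i). h i i g = g) \<and>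
     (\<forall>i j k. (i, j) \<in> r \<and> (j, k) \<in> r \<longrightarrow> (\<forall>g\<in>carrier (G k). h i k g = h i j (h j k g)))"

definition inv_limit_group ::
    "'i set \<Rightarrow> 'i rel \<Rightarrow> ('i \<Rightarrow> 'g monoid) \<Rightarrow> ('i \<Rightarrow> 'i \<Rightarrow> 'g \<Rightarrow> 'g) \<Rightarrow> ('i \<Rightarrow> 'g) monoid" where
  "inv_limit_group I r G h =
     \<lparr>carrier = inv_limit_points I r (\<lambda>i. carrier (G i)) h,
      mult = (\<lambda>x y. \<lambda>i\<in>I. x i \<otimes>\<^bsub>G i\<^esub> y i),
      one = (\<lambda>i\<in>I. \<one>\<^bsub>G i\<^esub>)\<rparr>"


section \<open>The uniform fundamental group and the space \<open>X\<close>-tilde\<close>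

abbreviation entourages :: "'a uspace \<Rightarrow> ('a \<times> 'a) set set" where
  "entourages X \<equiv> {E. entourage X E}"

definition finer :: "'a uspace \<Rightarrow> ('a \<times> 'a) set rel" where
  "finer X = {(E, F). entourage X E \<and> entourage X F \<and> F \<subseteq> E}"

definition tilde :: "'a uspace \<Rightarrow> 'a \<Rightarrow> (('a \<times> 'a) set \<Rightarrow> 'a list set) uspace" where
  "tilde X b = inv_limit_uspace (entourages X) (finer X) (XE X b) (\<lambda>E F. bond_XE X E)"

definition tilde_base :: "'a uspace \<Rightarrow> 'a \<Rightarrow> ('a \<times> 'a) set \<Rightarrow> 'a list set" where
  "tilde_base X b = (\<lambda>E\<in>entourages X. chain_class X E [b])"

definition pi_U :: "'a uspace \<Rightarrow> 'a \<Rightarrow> (('a \<times> 'a) set \<Rightarrow> 'a list set) monoid" where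
  "pi_U X b = inv_limit_group (entourages X) (finer X) (pi_E X b) (\<lambda>E F. bond_XE X E)"

definition pi_U_action ::
    "'a uspace \<Rightarrow> 'a \<Rightarrow> (('a \<times> 'a) set \<Rightarrow> 'a list set) \<Rightarrow>
     (('a \<times> 'a) set \<Rightarrow> 'a list set) \<Rightarrow> (('a \<times> 'a) set \<Rightarrow> 'a list set)" where
  "pi_U_action X b g =
     (\<lambda>x\<in>points (tilde X b). \<lambda>E\<in>entourages X. pi_E_action X b E (g E) (x E))"

text \<open>All coordinates of a point of \<open>tilde X b\<close> have the same endpoint.\<close>

definition tilde_proj :: "'a uspace \<Rightarrow> (('a \<times> 'a) set \<Rightarrow> 'a list set) \<Rightarrow> 'a" where
  "tilde_proj X x = (THE z. \<exists>E. entourage X E \<and> z = class_end (x E))"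

definition uniformly_simply_connected :: "'a uspace \<Rightarrow> 'a \<Rightarrow> bool" where
  "uniformly_simply_connected Y b \<longleftrightarrow>
     hausdorff_uniform Y \<and> b \<in> points Y \<and> weakly_chained Y \<and>
     carrier (pi_U Y b) = {\<one>\<^bsub>pi_U Y b\<^esub>}"


section \<open>Discrete covers and generalized regular covering maps\<close>

definition discrete_cover ::
    "'y uspace \<Rightarrow> 'x uspace \<Rightarrow> ('y \<Rightarrow> 'x) \<Rightarrow> 'g monoid \<Rightarrow> ('g \<Rightarrow> 'y \<Rightarrow> 'y) \<Rightarrow> bool" where
  "discrete_cover Y X f G act \<longleftrightarrow>
     hausdorff_uniform Y \<and> hausdorff_uniform X \<and>
     bi_uniformly_cont Y X f \<and> f ` points Y = points X \<and>
     faithful_action G (points Y) act \<and>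
     (\<forall>g\<in>carrier G. uniform_homeo Y Y (act g)) \<and>
     (\<forall>y\<in>points Y. {z \<in> points Y. f z = f y} = orbit G act y) \<and>
     (\<exists>\<B>. uniform_basis Y \<B> \<and>
        (\<forall>E\<in>\<B>. \<forall>g\<in>carrier G. \<forall>(x, y)\<in>E. (act g x, act g y) \<in> E)) \<and>
     (\<exists>E. entourage Y E \<and>
        (\<forall>g\<in>carrier G. (\<exists>y\<in>points Y. (y, act g y) \<in> E) \<longrightarrow> g = \<one>\<^bsub>G\<^esub>))"

text \<open>
  \<open>Y\<close>, \<open>f\<close> and \<open>G\<close> are the inverse limits of the system \<open>(Y\<^sub>i, f\<^sub>i, G\<^sub>i)\<close> via projections \<open>q\<^sub>i\<close> and
  \<open>s\<^sub>i\<close>: jointly these identify \<open>Y\<close> with the limit of the \<open>Y\<^sub>i\<close> as a uniform space and \<open>G\<close> with the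
  limit of the \<open>G\<^sub>i\<close> as a group. Since HOL cannot quantify over types inside a formula, the types of
  the indices, of the points of the \<open>Y\<^sub>i\<close>, and of the elements of the \<open>G\<^sub>i\<close> are parameters.
\<close>

definition generalized_regular_covering ::
    "'i itself \<Rightarrow> 'c itself \<Rightarrow> 'k itself \<Rightarrow>
     'y uspace \<Rightarrow> 'x uspace \<Rightarrow> ('y \<Rightarrow> 'x) \<Rightarrow> 'g monoid \<Rightarrow> ('g \<Rightarrow> 'y \<Rightarrow> 'y) \<Rightarrow> bool" where
  "generalized_regular_covering TI TC TK Y X f G act \<longleftrightarrow>
     hausdorff_uniform Y \<and> hausdorff_uniform X \<and>
     group_action G (points Y) act \<and>
     f ` points Y = points X \<and>
     (\<forall>y\<in>points Y. {z \<in> points Y. f z = f y} = orbit G act y) \<and>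
     (\<exists>(I :: 'i set) r (Yi :: 'i \<Rightarrow> 'c uspace) p fi (Gi :: 'i \<Rightarrow> 'k monoid) h acti q s.
        uniform_inverse_system I r Yi p \<and>
        (\<forall>(i, j)\<in>r. p i j ` points (Yi j) = points (Yi i)) \<and>
        group_inverse_system I r Gi h \<and>
        (\<forall>(i, j)\<in>r. h i j ` carrier (Gi j) = carrier (Gi i)) \<and>
        (\<forall>i\<in>I. discrete_cover (Yi i) X (fi i) (Gi i) (acti i)) \<and>
        (\<forall>(i, j)\<in>r. \<forall>y\<in>points (Yi j). fi i (p i j y) = fi j y) \<and>
        (\<forall>(i, j)\<in>r. \<forall>g\<in>carrier (Gi j). \<forall>y\<in>points (Yi j).
           p i j (acti j g y) = acti i (h i j g) (p i j y)) \<and>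
        uniform_homeo Y (inv_limit_uspace I r Yi p) (\<lambda>y. \<lambda>i\<in>I. q i y) \<and>
        (\<forall>i\<in>I. q i ` points Y = points (Yi i)) \<and>
        (\<forall>i\<in>I. \<forall>y\<in>points Y. f y = fi i (q i y)) \<and>
        (\<lambda>g. \<lambda>i\<in>I. s i g) \<in> iso G (inv_limit_group I r Gi h) \<and>
        (\<forall>i\<in>I. \<forall>g\<in>carrier G. \<forall>y\<in>points Y. q i (act g y) = acti i (s i g) (q i y)))"

definition UU_cover ::
    "'i itself \<Rightarrow> 'c itself \<Rightarrow> 'k itself \<Rightarrow>
     'y uspace \<Rightarrow> 'y \<Rightarrow> 'x uspace \<Rightarrow> ('y \<Rightarrow> 'x) \<Rightarrow> 'g monoid \<Rightarrow> ('g \<Rightarrow> 'y \<Rightarrow> 'y) \<Rightarrow> bool" where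
  "UU_cover TI TC TK Y b X f G act \<longleftrightarrow>
     generalized_regular_covering TI TC TK Y X f G act \<and> uniformly_simply_connected Y b"

end

theory Submission
  imports Defs
begin

text \<open>
  Everything rests on one lifting principle. Let \<open>E\<close> be weakly \<open>F\<close>-chained. Edge by edge, an
  \<open>F\<close>-chain can be replaced by an arbitrarily fine chain in the same \<open>E\<close>-class. Repeating this along
  a sequence of ever smaller weakly chained entourages, which metrizability provides, produces a
  coherent family of classes. Hence the \<open>E\<close>-class of every \<open>F\<close>-chain is the coordinate of a point of
  \<open>X\<close>-tilde (\<open>lift_fine_chain\<close>), and every \<open>F\<close>-small step in \<open>X\<close> lifts to \<open>X\<close>-tilde (\<open>lift_step\<close>).

  \<^emph>\<open>Covering.\<close> The bonding maps between the spaces \<open>X\<^sub>E\<close> need not be surjective: an edge of \<open>E\<close> may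
  lead to a class that contains no fine chain. The stages of the covering are therefore the images
  of \<open>X\<close>-tilde in the \<open>X\<^sub>E\<close> with \<open>E\<close> weakly chained, acted on by the images of the limit group. All
  bonding maps and projections are then surjective, the limit stays the same
  (\<open>inv_limit_cofinal\<close>), and \<open>lift_step\<close> makes each endpoint map a discrete cover
  (\<open>discrete_cover_fine_part\<close>).

  \<^emph>\<open>Simple connectivity.\<close> For this, homotopies have to be lifted. For the same reason as above,
  homotopies through \<open>E\<close>-chains do not lift, but homotopies through \<open>G\<close>-chains with \<open>G \<subseteq> F\<close> do, if
  closeness in \<open>X\<close>-tilde is measured by the relation \<open>G\<^sup>*\<close> on the coordinates in \<open>X\<^sub>E\<close>
  (\<open>lift_homotopy\<close>). The entourages of \<open>X\<close>-tilde obtained in this way from \<open>G = F\<close> form a basis.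
  They are weakly chained: two points that are \<open>F\<^sup>*\<close>-close in \<open>X\<^sub>F\<close> are joined by fine chains of
  \<open>X\<close>-tilde that lie over fine representatives of the two points, the projections of these chains
  are \<open>F\<close>-homotopic to one edge, and this homotopy lifts (\<open>weakly_chained_tilde_star\<close>). Likewise, a
  loop of \<open>X\<close>-tilde closes up in \<open>X\<^sub>F\<close>, so that its projection is \<open>F\<close>-null-homotopic, and the lifted
  null-homotopy shows that \<open>\<pi>\<^sub>U\<close> of \<open>X\<close>-tilde is trivial (\<open>tilde_loop_null_homotopic\<close>).
\<close>


section \<open>Chains and homotopies\<close>

lemma basic_move_sym: "basic_move X E \<alpha> \<beta> \<Longrightarrow> basic_move X E \<beta> \<alpha>"
  by (auto simp: basic_move_def)

lemma chain_homotopic_refl [simp]: "chain_homotopic X E \<alpha> \<alpha>"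
  by (simp add: chain_homotopic_def)

lemma chain_homotopic_sym: "chain_homotopic X E \<alpha> \<beta> \<Longrightarrow> chain_homotopic X E \<beta> \<alpha>"
  unfolding chain_homotopic_def
  by (metis (mono_tags, lifting) basic_move_sym sympD sympI symp_rtranclp)

lemma chain_homotopic_trans [trans]:
  "chain_homotopic X E \<alpha> \<beta> \<Longrightarrow> chain_homotopic X E \<beta> \<gamma> \<Longrightarrow> chain_homotopic X E \<alpha> \<gamma>"
  unfolding chain_homotopic_def by auto

lemma chain_class_eq_iff:
  "chain_class X E \<alpha> = chain_class X E \<beta> \<longleftrightarrow> chain_homotopic X E \<alpha> \<beta>"
  unfolding chain_class_def
  using chain_homotopic_refl chain_homotopic_sym chain_homotopic_trans by blast

lemma in_chain_class_iff: "\<beta> \<in> chain_class X E \<alpha> \<longleftrightarrow> chain_homotopic X E \<alpha> \<beta>"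
  by (simp add: chain_class_def)

lemma chain_homotopic_ends:
  assumes "chain_homotopic X E \<alpha> \<beta>"
  shows "hd \<alpha> = hd \<beta>" "last \<alpha> = last \<beta>" "is_chain X E \<alpha> \<longleftrightarrow> is_chain X E \<beta>"
proof -
  have "hd \<alpha> = hd \<beta> \<and> last \<alpha> = last \<beta> \<and> (is_chain X E \<alpha> \<longleftrightarrow> is_chain X E \<beta>)"
    using assms unfolding chain_homotopic_def
    by (induction rule: rtranclp_induct) (auto simp: basic_move_def)
  then show "hd \<alpha> = hd \<beta>" "last \<alpha> = last \<beta>" "is_chain X E \<alpha> \<longleftrightarrow> is_chain X E \<beta>" by auto
qed

lemma is_chain_mono: "is_chain X E \<alpha> \<Longrightarrow> E \<subseteq> F \<Longrightarrow> is_chain X F \<alpha>"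
  unfolding is_chain_def by (auto elim: successively_mono)

lemma chain_homotopic_mono:
  assumes "chain_homotopic X E \<alpha> \<beta>" "E \<subseteq> F"
  shows "chain_homotopic X F \<alpha> \<beta>"
proof -
  have "basic_move X E \<le> basic_move X F"
    using is_chain_mono[OF _ assms(2)] by (auto simp: basic_move_def)
  then show ?thesis
    using assms(1) unfolding chain_homotopic_def by (metis rtranclp_mono rev_predicate2D)
qed

lemma is_chain_append:
  "\<alpha> \<noteq> [] \<Longrightarrow> \<beta> \<noteq> [] \<Longrightarrow>
    is_chain X E (\<alpha> @ \<beta>) \<longleftrightarrow> is_chain X E \<alpha> \<and> is_chain X E \<beta> \<and> (last \<alpha>, hd \<beta>) \<in> E"
  by (auto simp: is_chain_def successively_append_iff)

lemma is_chain_singleton [simp]: "is_chain X E [x] \<longleftrightarrow> x \<in> points X"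
  by (auto simp: is_chain_def)

lemma is_chain_nonempty: "is_chain X E \<alpha> \<Longrightarrow> \<alpha> \<noteq> []"
  by (auto simp: is_chain_def)

lemma is_chain_Cons:
  "\<beta> \<noteq> [] \<Longrightarrow> is_chain X E (x # \<beta>) \<longleftrightarrow> x \<in> points X \<and> (x, hd \<beta>) \<in> E \<and> is_chain X E \<beta>"
  using is_chain_append[of "[x]" \<beta>] by auto

lemma is_chain_snoc:
  "\<alpha> \<noteq> [] \<Longrightarrow> is_chain X E (\<alpha> @ [x]) \<longleftrightarrow> is_chain X E \<alpha> \<and> x \<in> points X \<and> (last \<alpha>, x) \<in> E"
  using is_chain_append[of \<alpha> "[x]"] by auto

lemma is_chain_ends:
  assumes "is_chain X E \<alpha>" shows "hd \<alpha> \<in> points X" "last \<alpha> \<in> points X"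
  using assms by (auto simp: is_chain_def)

lemma chain_homotopic_context:
  assumes "chain_homotopic X E \<alpha> \<beta>" "is_chain X E (u @ \<alpha> @ v)" "is_chain X E \<alpha>"
  shows "chain_homotopic X E (u @ \<alpha> @ v) (u @ \<beta> @ v)"
  using assms(1) unfolding chain_homotopic_def
proof (induction rule: rtranclp_induct)
  case (step \<beta> \<gamma>)
  have ne: "\<alpha> \<noteq> []" "\<beta> \<noteq> []" "\<gamma> \<noteq> []"
    using step(2) assms(3) is_chain_nonempty by (auto simp: basic_move_def)
  have ch: "is_chain X E \<alpha>" "is_chain X E \<beta>" "is_chain X E \<gamma>" and
    ends: "hd \<beta> = hd \<gamma>" "last \<beta> = last \<gamma>" "hd \<alpha> = hd \<beta>" "last \<alpha> = last \<beta>"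
    using step(1,2) assms(3) chain_homotopic_ends[of X E \<alpha> \<beta>]
    by (auto simp: basic_move_def chain_homotopic_def)
  have A: "is_chain X E (u @ \<delta> @ v)" if \<delta>: "\<delta> \<noteq> []" "hd \<delta> = hd \<alpha>" "last \<delta> = last \<alpha>" "is_chain X E \<delta>" for \<delta>
  proof -
    have "is_chain X E (\<delta> @ v)" if "is_chain X E (\<alpha> @ v)"
      using that \<delta> ne by (cases "v = []") (simp_all add: is_chain_append)
    moreover have "hd (\<delta> @ v) = hd (\<alpha> @ v)" "\<delta> @ v \<noteq> []" "\<alpha> @ v \<noteq> []" using \<delta> ne by auto
    ultimately show ?thesis
      using assms(2) is_chain_append[of u "\<delta> @ v" X E] is_chain_append[of u "\<alpha> @ v" X E]
      by (cases "u = []") auto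
  qed
  have add: "add_point (u @ \<delta> @ v) (u @ \<epsilon> @ v)" if *: "add_point \<delta> \<epsilon>" for \<delta> \<epsilon>
  proof -
    obtain p x q where "\<delta> = p @ q" "\<epsilon> = p @ [x] @ q" using * unfolding add_point_def by blast
    then show ?thesis
      unfolding add_point_def by (intro exI[of _ "u @ p"] exI[of _ x] exI[of _ "q @ v"]) simp
  qed
  have "basic_move X E (u @ \<beta> @ v) (u @ \<gamma> @ v)"
    unfolding basic_move_def
    using A[of \<beta>] A[of \<gamma>] ch ends ne step(2) add[of \<beta> \<gamma>] add[of \<gamma> \<beta>]
    by (auto simp: basic_move_def hd_append last_append)
  with step.IH show ?case by simp
qed simp

lemma chain_homotopic_insert:
  assumes "is_chain X E (u @ v)" "is_chain X E (u @ [x] @ v)" "u \<noteq> []" "v \<noteq> []"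
  shows "chain_homotopic X E (u @ v) (u @ [x] @ v)"
proof -
  have "add_point (u @ v) (u @ [x] @ v)" unfolding add_point_def by blast
  then have "basic_move X E (u @ v) (u @ [x] @ v)" using assms by (simp add: basic_move_def)
  then show ?thesis by (simp add: chain_homotopic_def)
qed

lemma chain_homotopic_shortcut:
  assumes "is_chain X E (u @ [x] @ v)" "u \<noteq> []" "v \<noteq> []" "(last u, hd v) \<in> E"
  shows "chain_homotopic X E (u @ [x] @ v) (u @ v)"
proof -
  have "is_chain X E (u @ v)" using assms by (simp add: is_chain_append is_chain_Cons)
  from chain_homotopic_insert[OF this assms(1-3)] show ?thesis by (rule chain_homotopic_sym)
qed

text \<open>A homotopy may move an endpoint by inserting a copy next to it. Once a copy of either
  endpoint has been attached on the outside, every move becomes an insertion or deletion strictly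
  between two points, so that no special cases at the ends are left.\<close>

lemma chain_homotopic_strict_induct [consumes 2, case_names refl insert delete]:
  assumes hom: "chain_homotopic X E \<alpha> \<beta>" and ch: "is_chain X E \<alpha>"
    and refl: "P (hd \<alpha> # \<alpha> @ [last \<alpha>])"
    and ins: "\<And>u p v. u \<noteq> [] \<Longrightarrow> v \<noteq> [] \<Longrightarrow> is_chain X E (u @ [p] @ v) \<Longrightarrow> P (u @ v) \<Longrightarrow> P (u @ [p] @ v)"
    and del: "\<And>u p v. u \<noteq> [] \<Longrightarrow> v \<noteq> [] \<Longrightarrow> is_chain X E (u @ v) \<Longrightarrow> P (u @ [p] @ v) \<Longrightarrow> P (u @ v)"
    and E: "\<And>x. x \<in> points X \<Longrightarrow> (x, x) \<in> E"
  shows "P (hd \<beta> # \<beta> @ [last \<beta>])"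
  using hom unfolding chain_homotopic_def
proof (induction rule: rtranclp_induct)
  case base then show ?case by (rule refl)
next
  case (step \<gamma> \<delta>)
  have A: "is_chain X E (hd \<epsilon> # \<epsilon> @ [last \<epsilon>])" if "is_chain X E \<epsilon>" for \<epsilon>
    using that is_chain_ends[OF that] is_chain_nonempty[OF that] E
    by (simp add: is_chain_Cons is_chain_snoc)
  have ch: "is_chain X E \<gamma>" "is_chain X E \<delta>" and ends: "hd \<gamma> = hd \<delta>" "last \<gamma> = last \<delta>"
    using step(2) by (auto simp: basic_move_def)
  show ?case
  proof (cases "add_point \<gamma> \<delta>")
    case True
    then obtain u p v where uv: "\<gamma> = u @ v" "\<delta> = u @ [p] @ v" unfolding add_point_def by blast
    have "P ((hd \<gamma> # u) @ [p] @ (v @ [last \<gamma>]))"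
      using ins[of "hd \<gamma> # u" "v @ [last \<gamma>]" p] A[OF ch(2)] step.IH ends by (simp add: uv)
    then show ?thesis using uv(2) ends by simp
  next
    case False
    then obtain u p v where uv: "\<delta> = u @ v" "\<gamma> = u @ [p] @ v"
      using step(2) unfolding add_point_def basic_move_def by blast
    have "P ((hd \<gamma> # u) @ (v @ [last \<gamma>]))"
      using del[of "hd \<gamma> # u" "v @ [last \<gamma>]" p] A[OF ch(2)] step.IH ends by (simp add: uv)
    then show ?thesis using uv(1) ends by simp
  qed
qed

lemma is_chain_rev: "sym E \<Longrightarrow> is_chain X E (rev \<alpha>) \<longleftrightarrow> is_chain X E \<alpha>"
proof -
  assume "sym E"
  then have "(\<lambda>x y. (y, x) \<in> E) = (\<lambda>x y. (x, y) \<in> E)" by (auto simp: sym_def)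
  then have "successively (\<lambda>x y. (y, x) \<in> E) \<alpha> = successively (\<lambda>x y. (x, y) \<in> E) \<alpha>"
    by (rule arg_cong)
  then show ?thesis by (simp add: is_chain_def)
qed

lemma chain_homotopic_rev:
  assumes "chain_homotopic X E \<alpha> \<beta>" "sym E"
  shows "chain_homotopic X E (rev \<alpha>) (rev \<beta>)"
  using assms(1) unfolding chain_homotopic_def
proof (induction rule: rtranclp_induct)
  case (step \<gamma> \<delta>)
  have add: "add_point (rev \<delta>) (rev \<epsilon>)" if *: "add_point \<delta> \<epsilon>" for \<delta> \<epsilon> :: "'a list"
  proof -
    obtain p x q where "\<delta> = p @ q" "\<epsilon> = p @ [x] @ q" using * unfolding add_point_def by blast
    then show ?thesis
      unfolding add_point_def by (intro exI[of _ "rev q"] exI[of _ x] exI[of _ "rev p"]) simp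
  qed
  have "basic_move X E (rev \<gamma>) (rev \<delta>)"
    using step(2) add assms(2)
    by (auto simp: basic_move_def is_chain_rev hd_rev last_rev)
  with step.IH show ?case by simp
qed simp

lemma chain_class_rev: "sym E \<Longrightarrow> rev ` chain_class X E \<alpha> = chain_class X E (rev \<alpha>)"
proof (safe, goal_cases)
  case (1 \<beta> \<gamma>) then show ?case by (simp add: in_chain_class_iff chain_homotopic_rev)
next
  case (2 \<beta>)
  then have "rev \<beta> \<in> chain_class X E \<alpha>"
    using chain_homotopic_rev[of X E "rev \<alpha>" \<beta>] by (simp add: in_chain_class_iff)
  then show ?case by (metis image_eqI rev_rev_ident)
qed


section \<open>Entourages\<close>

locale hausdorff_uspace =
  fixes X :: "'a uspace"
  assumes hausdorff: "hausdorff_uniform X"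
begin

lemmas uniformity = hausdorff[unfolded hausdorff_uniform_def]

lemmas unif_points = uniformity[THEN conjunct1]
  and unif_refl = uniformity[THEN conjunct2, THEN conjunct1, rule_format]
  and unif_sym = uniformity[THEN conjunct2, THEN conjunct2, THEN conjunct1, rule_format]
  and unif_trans = uniformity[THEN conjunct2, THEN conjunct2, THEN conjunct2, THEN conjunct1, rule_format]
  and unif_separates = uniformity[THEN conjunct2, THEN conjunct2, THEN conjunct2, THEN conjunct2, rule_format]

lemma entourage_refl: "entourage X E \<Longrightarrow> x \<in> points X \<Longrightarrow> (x, x) \<in> E"
  using unif_refl[of "\<lambda>p. p \<in> E" x] by (auto simp: entourage_def)

lemma entourage_sym: "entourage X E \<Longrightarrow> (x, y) \<in> E \<Longrightarrow> (y, x) \<in> E"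
  by (auto simp: entourage_def sym_def)

lemma entourage_points: "entourage X E \<Longrightarrow> (x, y) \<in> E \<Longrightarrow> x \<in> points X \<and> y \<in> points X"
  by (auto simp: entourage_def)

lemma entourage_Int: "entourage X E \<Longrightarrow> entourage X F \<Longrightarrow> entourage X (E \<inter> F)"
  unfolding entourage_def by (auto intro: sym_Int eventually_conj)

lemma eventually_unif_iff:
  "(\<forall>\<^sub>F p in unif X. P p) \<longleftrightarrow> (\<exists>E. entourage X E \<and> (\<forall>p\<in>E. P p))"
proof
  assume P: "\<forall>\<^sub>F p in unif X. P p"
  define E where "E = {(x, y). x \<in> points X \<and> y \<in> points X \<and> P (x, y) \<and> P (y, x)}"
  from P unif_sym[OF P] unif_points have "\<forall>\<^sub>F p in unif X. p \<in> E"
    by eventually_elim (auto simp: E_def)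
  moreover have "E \<subseteq> points X \<times> points X" "sym E" by (auto simp: E_def sym_def)
  ultimately have "entourage X E" by (simp add: entourage_def)
  then show "\<exists>E. entourage X E \<and> (\<forall>p\<in>E. P p)" by (intro exI[of _ E]) (auto simp: E_def)
qed (auto simp: entourage_def elim: eventually_mono)

lemma ex_entourage: "\<exists>E. entourage X E"
  using eventually_unif_iff[of "\<lambda>_. True"] by simp

lemma entourage_half:
  assumes "entourage X E"
  obtains F where "entourage X F" "F \<subseteq> E" "\<And>x y z. (x, y) \<in> F \<Longrightarrow> (y, z) \<in> F \<Longrightarrow> (x, z) \<in> E"
proof -
  have "\<forall>\<^sub>F p in unif X. p \<in> E" using assms by (simp add: entourage_def)
  then obtain D where D: "\<forall>\<^sub>F p in unif X. D p" "\<And>x y z. D (x, y) \<Longrightarrow> D (y, z) \<Longrightarrow> (x, z) \<in> E"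
    using unif_trans by (metis (no_types, lifting))
  then obtain F where F: "entourage X F" "\<forall>p\<in>F. D p" by (auto simp: eventually_unif_iff)
  have "(x, y) \<in> E" if "(x, y) \<in> F" for x y
    using D(2)[of x y y] F that entourage_refl[of F y] entourage_points[of F x y] by blast
  moreover have "(x, z) \<in> E" if "(x, y) \<in> F" "(y, z) \<in> F" for x y z
    using F(2) that D(2)[of x y z] by simp
  ultimately show thesis using F(1) by (intro that[of F]) auto
qed

lemma entourage_separates:
  assumes "x \<in> points X" "y \<in> points X" "x \<noteq> y"
  obtains E where "entourage X E" "(x, y) \<notin> E"
proof -
  obtain P where "\<forall>\<^sub>F p in unif X. P p" "\<not> P (x, y)"
    using unif_separates[OF assms] by (elim exE conjE)
  then show thesis using that by (auto simp: eventually_unif_iff)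
qed

end

text \<open>The uniform structures below are all given by a basis of relations; this collects what has to be
  verified for one.\<close>

lemma hausdorff_uniform_basisI:
  assumes ev: "\<And>P. (\<forall>\<^sub>F p in unif Y. P p) \<longleftrightarrow> (\<exists>B\<in>\<B>. \<forall>p\<in>B. P p)"
    and sub: "\<And>B. B \<in> \<B> \<Longrightarrow> B \<subseteq> points Y \<times> points Y"
    and ne: "\<B> \<noteq> {}"
    and refl: "\<And>B x. B \<in> \<B> \<Longrightarrow> x \<in> points Y \<Longrightarrow> (x, x) \<in> B"
    and sym: "\<And>B. B \<in> \<B> \<Longrightarrow> sym B"
    and half: "\<And>B. B \<in> \<B> \<Longrightarrow> \<exists>C\<in>\<B>. \<forall>x y z. (x, y) \<in> C \<longrightarrow> (y, z) \<in> C \<longrightarrow> (x, z) \<in> B"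
    and sep: "\<And>x y. x \<in> points Y \<Longrightarrow> y \<in> points Y \<Longrightarrow> (\<And>B. B \<in> \<B> \<Longrightarrow> (x, y) \<in> B) \<Longrightarrow> x = y"
  shows "hausdorff_uniform Y" "\<And>B. B \<in> \<B> \<Longrightarrow> entourage Y B"
proof -
  show "entourage Y B" if "B \<in> \<B>" for B
    using sub[OF that] sym[OF that] that unfolding entourage_def ev
    by (intro conjI bexI[of _ B]) simp_all
  show "hausdorff_uniform Y"
    unfolding hausdorff_uniform_def
  proof (intro conjI allI impI ballI)
    show "\<forall>\<^sub>F p in unif Y. p \<in> points Y \<times> points Y" unfolding ev using sub ne by blast
  next
    fix P x assume "\<forall>\<^sub>F p in unif Y. P p" "x \<in> points Y"
    then show "P (x, x)" unfolding ev using refl by blast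
  next
    fix P assume "\<forall>\<^sub>F p in unif Y. P p"
    then show "\<forall>\<^sub>F (x, y) in unif Y. P (y, x)" unfolding ev using sym by (auto dest: symD)
  next
    fix P assume "\<forall>\<^sub>F p in unif Y. P p"
    then obtain B where B: "B \<in> \<B>" "\<forall>p\<in>B. P p" unfolding ev by blast
    then obtain C where "C \<in> \<B>" "\<forall>x y z. (x, y) \<in> C \<longrightarrow> (y, z) \<in> C \<longrightarrow> (x, z) \<in> B" using half by blast
    then show "\<exists>D. (\<forall>\<^sub>F p in unif Y. D p) \<and> (\<forall>x y z. D (x, y) \<longrightarrow> D (y, z) \<longrightarrow> P (x, z))"
      unfolding ev using B by (intro exI[of _ "\<lambda>p. p \<in> C"]) blast
  next
    fix x y assume "x \<in> points Y" "y \<in> points Y" "x \<noteq> y"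
    then obtain B where "B \<in> \<B>" "(x, y) \<notin> B" using sep by blast
    then show "\<exists>P. (\<forall>\<^sub>F p in unif Y. P p) \<and> \<not> P (x, y)"
      unfolding ev by (intro exI[of _ "\<lambda>p. p \<in> B"]) blast
  qed
qed

definition subspace :: "'a uspace \<Rightarrow> 'a set \<Rightarrow> 'a uspace" where
  "subspace Y A = \<lparr>points = A, unif = inf (unif Y) (principal (A \<times> A))\<rparr>"

lemma points_subspace [simp]: "points (subspace Y A) = A"
  by (simp add: subspace_def)

lemma eventually_subspace:
  "(\<forall>\<^sub>F p in unif (subspace Y A). P p) \<longleftrightarrow> (\<forall>\<^sub>F p in unif Y. p \<in> A \<times> A \<longrightarrow> P p)"
  by (simp add: subspace_def eventually_inf_principal)

lemma hausdorff_subspace: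
  assumes "hausdorff_uniform Y" "A \<subseteq> points Y"
  shows "hausdorff_uniform (subspace Y A)"
    and "\<And>E. entourage Y E \<Longrightarrow> entourage (subspace Y A) (E \<inter> A \<times> A)"
proof -
  interpret hausdorff_uspace Y using assms(1) by unfold_locales
  let ?B = "(\<lambda>E. E \<inter> A \<times> A) ` {E. entourage Y E}"
  have 1: "(\<forall>\<^sub>F p in unif (subspace Y A). P p) \<longleftrightarrow> (\<exists>B\<in>?B. \<forall>p\<in>B. P p)" for P
    unfolding eventually_subspace eventually_unif_iff by (simp add: Ball_def imp_conjL)
  have 2: "B \<subseteq> points (subspace Y A) \<times> points (subspace Y A)" "sym B" if "B \<in> ?B" for B
    using that by (auto simp: entourage_def sym_def)
  have 3: "?B \<noteq> {}" using ex_entourage by blast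
  have 4: "(x, x) \<in> B" if "B \<in> ?B" "x \<in> points (subspace Y A)" for B x
    using that entourage_refl assms(2) by auto
  have 5: "\<exists>C\<in>?B. \<forall>x y z. (x, y) \<in> C \<longrightarrow> (y, z) \<in> C \<longrightarrow> (x, z) \<in> B" if B: "B \<in> ?B" for B
  proof -
    obtain E where E: "entourage Y E" "B = E \<inter> A \<times> A" using B by blast
    obtain F where F: "entourage Y F" "\<And>x y z. (x, y) \<in> F \<Longrightarrow> (y, z) \<in> F \<Longrightarrow> (x, z) \<in> E"
      using entourage_half[OF E(1)] by metis
    show ?thesis using F E(2) by (intro bexI[of _ "F \<inter> A \<times> A"]) auto
  qed
  have 6: "x = y" if xy: "x \<in> points (subspace Y A)" "y \<in> points (subspace Y A)"
    "\<And>B. B \<in> ?B \<Longrightarrow> (x, y) \<in> B" for x y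
  proof (rule ccontr)
    assume "x \<noteq> y"
    then obtain E where "entourage Y E" "(x, y) \<notin> E"
      using entourage_separates[of x y] xy(1,2) assms(2) by auto
    then show False using xy(3)[of "E \<inter> A \<times> A"] by blast
  qed
  note * = hausdorff_uniform_basisI[of "subspace Y A" ?B, OF 1 2(1) 3 4 2(2) 5 6]
  from *(1) show "hausdorff_uniform (subspace Y A)" by blast
  from *(2) show "\<And>E. entourage Y E \<Longrightarrow> entourage (subspace Y A) (E \<inter> A \<times> A)" by blast
qed


section \<open>Concatenation of chains and the groups of chain classes\<close>

lemma is_chain_concat:
  assumes "is_chain X E \<alpha>" "is_chain X E \<beta>" "last \<alpha> = hd \<beta>"
  shows "is_chain X E (\<alpha> @ tl \<beta>)" "last (\<alpha> @ tl \<beta>) = last \<beta>" "hd (\<alpha> @ tl \<beta>) = hd \<alpha>"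
proof -
  obtain y \<delta> where \<beta>: "\<beta> = y # \<delta>" using assms(2) is_chain_nonempty by (metis neq_Nil_conv)
  have ne: "\<alpha> \<noteq> []" using assms(1) is_chain_nonempty by blast
  show "is_chain X E (\<alpha> @ tl \<beta>)"
    using assms \<beta> ne by (cases "\<delta> = []") (auto simp: is_chain_append is_chain_Cons)
  show "last (\<alpha> @ tl \<beta>) = last \<beta>" "hd (\<alpha> @ tl \<beta>) = hd \<alpha>"
    using assms(3) \<beta> ne by auto
qed

lemma chain_homotopic_concat:
  assumes "chain_homotopic X E \<alpha> \<alpha>'" "chain_homotopic X E \<beta> \<beta>'"
    and ch: "is_chain X E \<alpha>" "is_chain X E \<beta>" "last \<alpha> = hd \<beta>"
  shows "chain_homotopic X E (\<alpha> @ tl \<beta>) (\<alpha>' @ tl \<beta>')"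
proof -
  note ends = chain_homotopic_ends[OF assms(1)] chain_homotopic_ends[OF assms(2)]
  have 1: "chain_homotopic X E (\<alpha> @ tl \<beta>) (\<alpha>' @ tl \<beta>)"
    using chain_homotopic_context[OF assms(1), of "[]" "tl \<beta>"] is_chain_concat[OF ch] ch by simp
  have ch': "is_chain X E \<alpha>'" "is_chain X E \<beta>'" "last \<alpha>' = hd \<beta>" using ends ch by auto
  have eq: "\<alpha>' @ tl \<delta> = butlast \<alpha>' @ \<delta>" if "is_chain X E \<delta>" "hd \<delta> = hd \<beta>" for \<delta>
    using ch'(3) that is_chain_nonempty[OF ch'(1)] is_chain_nonempty[OF that(1)]
    by (metis append.assoc append_Cons append_Nil append_butlast_last_id list.collapse)
  have "chain_homotopic X E (butlast \<alpha>' @ \<beta> @ []) (butlast \<alpha>' @ \<beta>' @ [])"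
    using is_chain_concat(1)[OF ch'(1) ch(2) ch'(3)] eq[OF ch(2)]
    by (intro chain_homotopic_context assms(2) ch(2)) simp
  then have "chain_homotopic X E (\<alpha>' @ tl \<beta>) (\<alpha>' @ tl \<beta>')"
    using eq[OF ch(2)] eq[OF ch'(2)] ends by simp
  with 1 show ?thesis by (rule chain_homotopic_trans)
qed

lemma class_end_chain_class [simp]: "class_end (chain_class X E \<alpha>) = last \<alpha>"
  unfolding class_end_def
proof (rule the_equality)
  show "\<exists>\<beta>\<in>chain_class X E \<alpha>. last \<alpha> = last \<beta>"
    by (rule bexI[of _ \<alpha>]) (simp_all add: in_chain_class_iff)
  show "x = last \<alpha>" if "\<exists>\<beta>\<in>chain_class X E \<alpha>. x = last \<beta>" for x
    using that by (auto simp: in_chain_class_iff dest: chain_homotopic_ends(2)[THEN sym])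
qed

lemma bond_chain_class:
  assumes "F \<subseteq> E"
  shows "bond_XE X E (chain_class X F \<alpha>) = chain_class X E \<alpha>"
proof -
  have "chain_class X E \<beta> = chain_class X E \<alpha>" if "\<beta> \<in> chain_class X F \<alpha>" for \<beta>
    using that chain_homotopic_mono[OF _ assms] chain_homotopic_sym
    by (metis chain_class_eq_iff in_chain_class_iff)
  moreover have "\<alpha> \<in> chain_class X F \<alpha>" by (simp add: in_chain_class_iff)
  ultimately show ?thesis unfolding bond_XE_def by blast
qed

lemma class_concat_chain_class:
  assumes "is_chain X E \<alpha>" "is_chain X E \<beta>" "last \<alpha> = hd \<beta>"
  shows "class_concat X E (chain_class X E \<alpha>) (chain_class X E \<beta>) = chain_class X E (\<alpha> @ tl \<beta>)"
proof -
  have "chain_class X E (\<alpha>' @ tl \<beta>') = chain_class X E (\<alpha> @ tl \<beta>)"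
    if "\<alpha>' \<in> chain_class X E \<alpha>" "\<beta>' \<in> chain_class X E \<beta>" for \<alpha>' \<beta>'
    using chain_homotopic_concat[OF _ _ assms] that
    by (metis chain_class_eq_iff in_chain_class_iff)
  moreover have "\<alpha> \<in> chain_class X E \<alpha>" "\<beta> \<in> chain_class X E \<beta>" by (simp_all add: in_chain_class_iff)
  ultimately show ?thesis unfolding class_concat_def by blast
qed

context hausdorff_uspace
begin

lemma chain_homotopic_dup:
  assumes "entourage X E" "x \<in> points X"
  shows "chain_homotopic X E [x] [x, x]"
proof -
  have "add_point [x] [x, x]" by (auto simp: add_point_def Cons_eq_append_conv)
  then have "basic_move X E [x] [x, x]"
    using assms entourage_refl by (simp add: basic_move_def is_chain_Cons)
  then show ?thesis by (simp add: chain_homotopic_def)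
qed

lemma chain_homotopic_dup_last:
  assumes "entourage X E" "is_chain X E \<alpha>"
  shows "chain_homotopic X E \<alpha> (\<alpha> @ [last \<alpha>])"
proof -
  have "chain_homotopic X E (\<alpha> @ tl [last \<alpha>]) (\<alpha> @ tl [last \<alpha>, last \<alpha>])"
    using assms is_chain_ends[OF assms(2)]
    by (intro chain_homotopic_concat chain_homotopic_dup) simp_all
  then show ?thesis by simp
qed

lemma chain_homotopic_cancel:
  assumes E: "entourage X E" and "is_chain X E \<alpha>"
  shows "chain_homotopic X E (rev \<alpha> @ tl \<alpha>) [last \<alpha>]"
proof -
  have sym: "sym E" using E by (simp add: entourage_def)
  have "\<alpha> \<noteq> []" using assms(2) is_chain_nonempty by blast
  then show ?thesis using assms(2)
  proof (induction \<alpha> rule: rev_nonempty_induct)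
    case (snoc x \<alpha>)
    then have ch: "is_chain X E \<alpha>" "x \<in> points X" "(last \<alpha>, x) \<in> E" by (auto simp: is_chain_snoc)
    have x: "(x, x) \<in> E" "(x, last \<alpha>) \<in> E" using E ch entourage_refl entourage_sym by blast+
    have rc: "is_chain X E (rev \<alpha>)" "last (rev \<alpha>) = hd \<alpha>" "hd (rev \<alpha>) = last \<alpha>"
      using ch sym by (simp_all add: is_chain_rev last_rev hd_rev)
    note cc = is_chain_concat[OF rc(1) ch(1) rc(2)]
    have ne: "rev \<alpha> @ tl \<alpha> \<noteq> []" using snoc(1) by simp
    have "is_chain X E ([x] @ (rev \<alpha> @ tl \<alpha>) @ [x])"
      using cc ne ch x rc(3) snoc(1) is_chain_snoc[OF ne] by (simp add: is_chain_Cons)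
    then have "chain_homotopic X E ([x] @ (rev \<alpha> @ tl \<alpha>) @ [x]) ([x] @ [last \<alpha>] @ [x])"
      using snoc.IH[OF ch(1)] cc(1) by (intro chain_homotopic_context)
    also have "chain_homotopic X E ([x] @ [last \<alpha>] @ [x]) ([x] @ [x])"
      using ch x is_chain_ends[OF ch(1)] by (intro chain_homotopic_shortcut) (simp_all add: is_chain_Cons)
    also have "chain_homotopic X E ([x] @ [x]) [x]"
      using chain_homotopic_dup[OF E ch(2)] chain_homotopic_sym by simp
    finally show ?case using snoc(1) by simp
  qed simp
qed

lemma chain_homotopic_cancel':
  assumes E: "entourage X E" and ch: "is_chain X E \<alpha>"
  shows "chain_homotopic X E (\<alpha> @ tl (rev \<alpha>)) [hd \<alpha>]"
  using chain_homotopic_cancel[OF E, of "rev \<alpha>"] ch E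
  by (simp add: is_chain_rev entourage_def last_rev)

lemma chain_homotopic_pad_ends:
  assumes E: "entourage X E" and ch: "is_chain X E \<alpha>"
  shows "chain_homotopic X E \<alpha> (hd \<alpha> # \<alpha> @ [last \<alpha>])"
proof -
  have ne: "\<alpha> \<noteq> []" using ch is_chain_nonempty by blast
  have "chain_homotopic X E ([hd \<alpha>] @ tl \<alpha>) ([hd \<alpha>, hd \<alpha>] @ tl \<alpha>)"
    using ch is_chain_ends[OF ch] by (intro chain_homotopic_concat chain_homotopic_dup E) simp_all
  then have 1: "chain_homotopic X E \<alpha> (hd \<alpha> # \<alpha>)" using ne by simp
  then have "is_chain X E (hd \<alpha> # \<alpha>)" using ch chain_homotopic_ends(3) by blast
  from chain_homotopic_dup_last[OF E this] ne
  have "chain_homotopic X E (hd \<alpha> # \<alpha>) (hd \<alpha> # \<alpha> @ [last \<alpha>])" by simp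
  with 1 show ?thesis by (rule chain_homotopic_trans)
qed

end

locale pointed_uspace = hausdorff_uspace +
  fixes b :: 'a
  assumes base: "b \<in> points X"
begin

lemma points_XE: "c \<in> points (XE X b E) \<longleftrightarrow> (\<exists>\<alpha>. is_chain X E \<alpha> \<and> hd \<alpha> = b \<and> c = chain_class X E \<alpha>)"
  by (auto simp: XE_def)

lemma points_XE_I: "is_chain X E \<alpha> \<Longrightarrow> hd \<alpha> = b \<Longrightarrow> chain_class X E \<alpha> \<in> points (XE X b E)"
  by (auto simp: points_XE)

lemma carrier_pi_E: "carrier (pi_E X b E) = {c \<in> points (XE X b E). class_end c = b}"
  by (auto simp: pi_E_def points_XE)

lemma mult_pi_E [simp]: "mult (pi_E X b E) = class_concat X E"
  and one_pi_E [simp]: "one (pi_E X b E) = chain_class X E [b]"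
  by (simp_all add: pi_E_def)

lemma class_end_points: "c \<in> points (XE X b E) \<Longrightarrow> class_end c \<in> points X"
  by (auto simp: points_XE is_chain_ends(2))

lemma XE_cases:
  assumes "c \<in> points (XE X b E)"
  obtains \<alpha> where "is_chain X E \<alpha>" "hd \<alpha> = b" "c = chain_class X E \<alpha>"
  using assms[unfolded points_XE] by (elim exE conjE)

lemma pi_E_cases:
  assumes "g \<in> carrier (pi_E X b E)"
  obtains \<alpha> where "is_chain X E \<alpha>" "hd \<alpha> = b" "last \<alpha> = b" "g = chain_class X E \<alpha>"
  using assms unfolding pi_E_def by auto

lemma concat_closed:
  assumes "g \<in> carrier (pi_E X b E)" "c \<in> points (XE X b E)"
  shows "class_concat X E g c \<in> points (XE X b E)" "class_end (class_concat X E g c) = class_end c"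
proof -
  obtain \<alpha> where \<alpha>: "is_chain X E \<alpha>" "hd \<alpha> = b" "last \<alpha> = b" "g = chain_class X E \<alpha>"
    using assms(1) by (rule pi_E_cases)
  obtain \<beta> where \<beta>: "is_chain X E \<beta>" "hd \<beta> = b" "c = chain_class X E \<beta>"
    using assms(2) by (rule XE_cases)
  have l: "last \<alpha> = hd \<beta>" using \<alpha> \<beta> by simp
  note c = is_chain_concat[OF \<alpha>(1) \<beta>(1) l]
  show "class_concat X E g c \<in> points (XE X b E)" "class_end (class_concat X E g c) = class_end c"
    using c \<alpha>(2) \<beta>(3) points_XE_I[of E "\<alpha> @ tl \<beta>"]
    by (simp_all add: \<alpha>(4) class_concat_chain_class[OF \<alpha>(1) \<beta>(1) l])
qed

lemma concat_assoc:
  assumes "g \<in> carrier (pi_E X b E)" "h \<in> carrier (pi_E X b E)" "c \<in> points (XE X b E)"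
  shows "class_concat X E (class_concat X E g h) c = class_concat X E g (class_concat X E h c)"
proof -
  obtain \<alpha> where \<alpha>: "is_chain X E \<alpha>" "hd \<alpha> = b" "last \<alpha> = b" "g = chain_class X E \<alpha>"
    using assms(1) by (rule pi_E_cases)
  obtain \<beta> where \<beta>: "is_chain X E \<beta>" "hd \<beta> = b" "last \<beta> = b" "h = chain_class X E \<beta>"
    using assms(2) by (rule pi_E_cases)
  obtain \<gamma> where \<gamma>: "is_chain X E \<gamma>" "hd \<gamma> = b" "c = chain_class X E \<gamma>"
    using assms(3) by (rule XE_cases)
  have "(\<alpha> @ tl \<beta>) @ tl \<gamma> = \<alpha> @ tl (\<beta> @ tl \<gamma>)" using is_chain_nonempty[OF \<beta>(1)] by simp
  then show ?thesis
    using is_chain_concat[of X E \<alpha> \<beta>] is_chain_concat[of X E \<beta> \<gamma>] \<alpha> \<beta> \<gamma>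
    by (simp add: class_concat_chain_class)
qed

lemma concat_one:
  assumes "c \<in> points (XE X b E)"
  shows "class_concat X E (chain_class X E [b]) c = c"
proof -
  obtain \<alpha> where \<alpha>: "is_chain X E \<alpha>" "hd \<alpha> = b" "c = chain_class X E \<alpha>"
    using assms by (rule XE_cases)
  then have "[b] @ tl \<alpha> = \<alpha>" using is_chain_nonempty by (cases \<alpha>) auto
  then show ?thesis using \<alpha> base by (simp add: class_concat_chain_class)
qed

text \<open>When \<open>c\<close> and \<open>d\<close> have the same endpoint, \<open>d\<close> followed by the reversal of \<open>c\<close> is the group
  element that carries \<open>c\<close> to \<open>d\<close>.\<close>

definition class_diff :: "('a \<times> 'a) set \<Rightarrow> 'a list set \<Rightarrow> 'a list set \<Rightarrow> 'a list set" where
  "class_diff E d c = class_concat X E d (rev ` c)"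

lemma class_diff_chain_class:
  assumes "entourage X E" "is_chain X E \<alpha>" "is_chain X E \<beta>" "last \<alpha> = last \<beta>"
  shows "class_diff E (chain_class X E \<beta>) (chain_class X E \<alpha>) = chain_class X E (\<beta> @ tl (rev \<alpha>))"
  using assms
  by (simp add: class_diff_def chain_class_rev entourage_def class_concat_chain_class is_chain_rev hd_rev)

lemma class_diff:
  assumes E: "entourage X E" and cd: "c \<in> points (XE X b E)" "d \<in> points (XE X b E)" "class_end c = class_end d"
  shows "class_diff E d c \<in> carrier (pi_E X b E)" "class_concat X E (class_diff E d c) c = d"
proof -
  obtain \<alpha> where \<alpha>: "is_chain X E \<alpha>" "hd \<alpha> = b" "c = chain_class X E \<alpha>"
    using cd(1) by (rule XE_cases)
  obtain \<beta> where \<beta>: "is_chain X E \<beta>" "hd \<beta> = b" "d = chain_class X E \<beta>"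
    using cd(2) by (rule XE_cases)
  have last: "last \<alpha> = last \<beta>" using cd(3) \<alpha> \<beta> by simp
  have r: "is_chain X E (rev \<alpha>)" "hd (rev \<alpha>) = last \<beta>" "last (rev \<alpha>) = b"
    using \<alpha> E last by (simp_all add: is_chain_rev entourage_def hd_rev last_rev)
  note c1 = is_chain_concat[OF \<beta>(1) r(1), OF r(2)[symmetric]]
  have diff: "class_diff E d c = chain_class X E (\<beta> @ tl (rev \<alpha>))"
    using class_diff_chain_class E \<alpha> \<beta> last by simp
  show "class_diff E d c \<in> carrier (pi_E X b E)"
    unfolding diff using c1 r(3) \<beta>(2) points_XE_I[of E "\<beta> @ tl (rev \<alpha>)"] by (simp add: carrier_pi_E)
  have "chain_homotopic X E (\<beta> @ tl (rev \<alpha> @ tl \<alpha>)) (\<beta> @ tl [last \<alpha>])"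
    using is_chain_concat[OF r(1) \<alpha>(1)] r \<alpha>(2) last \<beta>
    by (intro chain_homotopic_concat chain_homotopic_cancel[OF E \<alpha>(1)] \<beta>(1)) simp_all
  moreover have "\<beta> @ tl (rev \<alpha> @ tl \<alpha>) = (\<beta> @ tl (rev \<alpha>)) @ tl \<alpha>"
    using is_chain_nonempty[OF \<alpha>(1)] by simp
  ultimately have "chain_class X E ((\<beta> @ tl (rev \<alpha>)) @ tl \<alpha>) = d"
    using \<beta>(3) by (simp add: chain_class_eq_iff)
  then show "class_concat X E (class_diff E d c) c = d"
    unfolding diff using c1 r \<alpha> by (simp add: class_concat_chain_class)
qed

lemma concat_right_cancel:
  assumes "entourage X E" "g \<in> carrier (pi_E X b E)" "c \<in> points (XE X b E)" "class_concat X E g c = c"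
  shows "g = chain_class X E [b]"
proof -
  obtain \<alpha> where \<alpha>: "is_chain X E \<alpha>" "hd \<alpha> = b" "c = chain_class X E \<alpha>"
    using assms(3) by (rule XE_cases)
  obtain \<gamma> where \<gamma>: "is_chain X E \<gamma>" "hd \<gamma> = b" "last \<gamma> = b" "g = chain_class X E \<gamma>"
    using assms(2) by (rule pi_E_cases)
  have r: "is_chain X E (rev \<alpha>)" "hd (rev \<alpha>) = last \<alpha>"
    using \<alpha> assms(1) by (simp_all add: is_chain_rev entourage_def hd_rev)
  have c1: "is_chain X E (\<gamma> @ tl \<alpha>)" "last (\<gamma> @ tl \<alpha>) = last \<alpha>" using is_chain_concat[of X E \<gamma> \<alpha>] \<alpha> \<gamma> by auto
  have c2: "is_chain X E (\<alpha> @ tl (rev \<alpha>))" "hd (\<alpha> @ tl (rev \<alpha>)) = b"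
    using is_chain_concat[of X E \<alpha> "rev \<alpha>"] \<alpha> r by auto
  have "chain_homotopic X E \<gamma> (\<gamma> @ tl (\<alpha> @ tl (rev \<alpha>)))"
    using chain_homotopic_concat[OF chain_homotopic_refl[of X E \<gamma>]
        chain_homotopic_cancel'[OF assms(1) \<alpha>(1)] \<gamma>(1) c2(1)] c2(2) \<gamma>(3) chain_homotopic_sym
    by fastforce
  also have "\<gamma> @ tl (\<alpha> @ tl (rev \<alpha>)) = (\<gamma> @ tl \<alpha>) @ tl (rev \<alpha>)"
    using is_chain_nonempty[OF \<alpha>(1)] by simp
  also have "chain_homotopic X E ((\<gamma> @ tl \<alpha>) @ tl (rev \<alpha>)) (\<alpha> @ tl (rev \<alpha>))"
  proof (rule chain_homotopic_concat[OF _ chain_homotopic_refl c1(1) r(1)])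
    show "chain_homotopic X E (\<gamma> @ tl \<alpha>) \<alpha>"
      using assms(4) \<alpha> \<gamma> by (simp add: class_concat_chain_class chain_class_eq_iff)
    show "last (\<gamma> @ tl \<alpha>) = hd (rev \<alpha>)" using c1 r by simp
  qed
  also have "chain_homotopic X E (\<alpha> @ tl (rev \<alpha>)) [b]"
    using chain_homotopic_cancel'[OF assms(1) \<alpha>(1)] \<alpha>(2) by simp
  finally show ?thesis using \<gamma>(4) by (simp add: chain_class_eq_iff)
qed

lemma one_XE: "chain_class X E [b] \<in> points (XE X b E)"
  using base by (intro points_XE_I) auto

lemma group_pi_E:
  assumes E: "entourage X E"
  shows "group (pi_E X b E)"
proof (rule groupI)
  fix x assume x: "x \<in> carrier (pi_E X b E)"
  show "\<exists>y\<in>carrier (pi_E X b E). y \<otimes>\<^bsub>pi_E X b E\<^esub> x = \<one>\<^bsub>pi_E X b E\<^esub>"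
    using class_diff[OF E, of x "chain_class X E [b]"] x one_XE by (auto simp: carrier_pi_E)
next
  fix x y z
  assume "x \<in> carrier (pi_E X b E)" "y \<in> carrier (pi_E X b E)" "z \<in> carrier (pi_E X b E)"
  then show "x \<otimes>\<^bsub>pi_E X b E\<^esub> y \<otimes>\<^bsub>pi_E X b E\<^esub> z = x \<otimes>\<^bsub>pi_E X b E\<^esub> (y \<otimes>\<^bsub>pi_E X b E\<^esub> z)"
    using concat_assoc[of x E y z] by (simp add: carrier_pi_E)
next
  fix x y assume "x \<in> carrier (pi_E X b E)" "y \<in> carrier (pi_E X b E)"
  then show "x \<otimes>\<^bsub>pi_E X b E\<^esub> y \<in> carrier (pi_E X b E)"
    using concat_closed[of x E y] by (simp add: carrier_pi_E)
qed (auto simp: carrier_pi_E one_XE concat_one)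

lemma bond_XE_closed:
  assumes "F \<subseteq> E" "c \<in> points (XE X b F)"
  shows "bond_XE X E c \<in> points (XE X b E)" "class_end (bond_XE X E c) = class_end c"
proof -
  obtain \<alpha> where "is_chain X F \<alpha>" "hd \<alpha> = b" "c = chain_class X F \<alpha>"
    using assms(2) by (rule XE_cases)
  then show "bond_XE X E c \<in> points (XE X b E)" "class_end (bond_XE X E c) = class_end c"
    using assms(1) is_chain_mono[of X F \<alpha> E] points_XE_I[of E \<alpha>] by (simp_all add: bond_chain_class)
qed

lemma bond_XE_refl: "c \<in> points (XE X b E) \<Longrightarrow> bond_XE X E c = c"
  by (auto elim!: XE_cases simp: bond_chain_class)

lemma bond_XE_trans:
  "F \<subseteq> E \<Longrightarrow> D \<subseteq> F \<Longrightarrow> c \<in> points (XE X b D) \<Longrightarrow> bond_XE X E c = bond_XE X E (bond_XE X F c)"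
  by (auto elim!: XE_cases simp: bond_chain_class)

lemma bond_concat:
  assumes "F \<subseteq> E" "g \<in> carrier (pi_E X b F)" "c \<in> points (XE X b F)"
  shows "bond_XE X E (class_concat X F g c) = class_concat X E (bond_XE X E g) (bond_XE X E c)"
proof -
  obtain \<alpha> where \<alpha>: "is_chain X F \<alpha>" "hd \<alpha> = b" "last \<alpha> = b" "g = chain_class X F \<alpha>"
    using assms(2) by (rule pi_E_cases)
  obtain \<beta> where \<beta>: "is_chain X F \<beta>" "hd \<beta> = b" "c = chain_class X F \<beta>"
    using assms(3) by (rule XE_cases)
  show ?thesis
    using \<alpha> \<beta> assms(1) is_chain_mono[OF _ assms(1)]
    by (simp add: bond_chain_class class_concat_chain_class)
qed

lemma bond_class_diff:
  assumes "F \<subseteq> E" "entourage X E" "entourage X F"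
    and "c \<in> points (XE X b F)" "d \<in> points (XE X b F)" "class_end c = class_end d"
  shows "bond_XE X E (class_diff F d c) = class_diff E (bond_XE X E d) (bond_XE X E c)"
proof -
  obtain \<alpha> where \<alpha>: "is_chain X F \<alpha>" "hd \<alpha> = b" "c = chain_class X F \<alpha>"
    using assms(4) by (rule XE_cases)
  obtain \<beta> where \<beta>: "is_chain X F \<beta>" "hd \<beta> = b" "d = chain_class X F \<beta>"
    using assms(5) by (rule XE_cases)
  show ?thesis
    using \<alpha> \<beta> assms is_chain_mono[OF _ assms(1)]
    by (simp add: bond_chain_class class_diff_chain_class)
qed

lemma bond_hom:
  assumes "F \<subseteq> E" shows "bond_XE X E \<in> hom (pi_E X b F) (pi_E X b E)"
  using assms bond_XE_closed bond_concat by (auto simp: hom_def carrier_pi_E)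


section \<open>The uniform structure of \<open>X\<^sub>E\<close>\<close>

text \<open>Pre-concatenation with \<open>\<alpha>\<close> turns the defining condition of closeness into one without
  reversals.\<close>

lemma chain_homotopic_step_iff:
  assumes E: "entourage X E" and \<alpha>: "is_chain X E \<alpha>" and \<beta>: "is_chain X E \<beta>"
    and hd: "hd \<alpha> = hd \<beta>" and l: "(last \<alpha>, last \<beta>) \<in> E"
  shows "chain_homotopic X E (rev \<alpha> @ tl \<beta>) [last \<alpha>, last \<beta>] \<longleftrightarrow> chain_homotopic X E \<beta> (\<alpha> @ [last \<beta>])"
proof
  have ne: "\<alpha> \<noteq> []" "\<beta> \<noteq> []" using \<alpha> \<beta> is_chain_nonempty by auto
  have r: "is_chain X E (rev \<alpha>)" "last (rev \<alpha>) = hd \<alpha>" "hd (rev \<alpha>) = last \<alpha>"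
    using \<alpha> E by (simp_all add: is_chain_rev entourage_def last_rev hd_rev)
  have e: "is_chain X E [last \<alpha>, last \<beta>]" "is_chain X E (\<alpha> @ [last \<beta>])"
    using l is_chain_ends(2) \<alpha> \<beta> ne by (auto simp: is_chain_Cons is_chain_snoc)
  have c1: "is_chain X E (rev \<alpha> @ tl \<beta>)" "hd (rev \<alpha> @ tl \<beta>) = last \<alpha>"
    using is_chain_concat[of X E "rev \<alpha>" \<beta>] r \<beta> hd by auto
  {
    assume h: "chain_homotopic X E \<beta> (\<alpha> @ [last \<beta>])"
    have "chain_homotopic X E (rev \<alpha> @ tl \<beta>) (rev \<alpha> @ tl (\<alpha> @ [last \<beta>]))"
      using r \<beta> hd by (intro chain_homotopic_concat h) simp_all
    also have "rev \<alpha> @ tl (\<alpha> @ [last \<beta>]) = (rev \<alpha> @ tl \<alpha>) @ tl [last \<alpha>, last \<beta>]" using ne by simp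
    also have "chain_homotopic X E ((rev \<alpha> @ tl \<alpha>) @ tl [last \<alpha>, last \<beta>]) ([last \<alpha>] @ tl [last \<alpha>, last \<beta>])"
      using is_chain_concat[of X E "rev \<alpha>" \<alpha>] r \<alpha> e
      by (intro chain_homotopic_concat chain_homotopic_cancel[OF E]) simp_all
    finally show "chain_homotopic X E (rev \<alpha> @ tl \<beta>) [last \<alpha>, last \<beta>]" by simp
  next
    assume h: "chain_homotopic X E (rev \<alpha> @ tl \<beta>) [last \<alpha>, last \<beta>]"
    have "[hd \<alpha>] @ tl \<beta> = \<beta>" using hd ne by (cases \<beta>) auto
    moreover have "chain_homotopic X E ([hd \<alpha>] @ tl \<beta>) ((\<alpha> @ tl (rev \<alpha>)) @ tl \<beta>)"
      using chain_homotopic_cancel'[OF E \<alpha>] hd \<beta> is_chain_ends(1)[OF \<alpha>]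
      by (intro chain_homotopic_concat) (simp_all add: chain_homotopic_sym)
    ultimately have "chain_homotopic X E \<beta> ((\<alpha> @ tl (rev \<alpha>)) @ tl \<beta>)" by simp
    also have "(\<alpha> @ tl (rev \<alpha>)) @ tl \<beta> = \<alpha> @ tl (rev \<alpha> @ tl \<beta>)" using ne by simp
    also have "chain_homotopic X E (\<alpha> @ tl (rev \<alpha> @ tl \<beta>)) (\<alpha> @ tl [last \<alpha>, last \<beta>])"
      using c1 \<alpha> by (intro chain_homotopic_concat h) simp_all
    finally show "chain_homotopic X E \<beta> (\<alpha> @ [last \<beta>])" by simp
  }
qed

text \<open>Being close in \<open>X\<^sub>E\<close> means that one class arises from the other by one more step. This is the
  form in which closeness is used throughout.\<close>

lemma XE_star_iff:
  assumes E: "entourage X E" and F: "F \<subseteq> E"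
    and \<alpha>: "is_chain X E \<alpha>" "hd \<alpha> = b" and \<beta>: "is_chain X E \<beta>" "hd \<beta> = b"
  shows "(chain_class X E \<alpha>, chain_class X E \<beta>) \<in> XE_star X b E F \<longleftrightarrow>
    (last \<alpha>, last \<beta>) \<in> F \<and> chain_homotopic X E \<beta> (\<alpha> @ [last \<beta>])" (is "?L \<longleftrightarrow> ?R")
proof
  assume R: ?R
  then have "chain_homotopic X E (rev \<alpha> @ tl \<beta>) [last \<alpha>, last \<beta>]"
    using chain_homotopic_step_iff[OF E \<alpha>(1) \<beta>(1)] \<alpha>(2) \<beta>(2) F by auto
  then show ?L using R \<alpha> \<beta> unfolding XE_star_def by blast
next
  assume ?L
  then obtain \<alpha>' \<beta>' where *: "chain_homotopic X E \<alpha> \<alpha>'" "chain_homotopic X E \<beta> \<beta>'"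
    "is_chain X E \<alpha>'" "hd \<alpha>' = b" "is_chain X E \<beta>'" "hd \<beta>' = b" "(last \<alpha>', last \<beta>') \<in> F"
    "chain_homotopic X E (rev \<alpha>' @ tl \<beta>') [last \<alpha>', last \<beta>']"
    unfolding XE_star_def by (auto simp: chain_class_eq_iff)
  note ends = chain_homotopic_ends[OF *(1)] chain_homotopic_ends[OF *(2)]
  have "chain_homotopic X E \<beta>' (\<alpha>' @ [last \<beta>'])"
    using chain_homotopic_step_iff[OF E *(3,5)] * F by auto
  moreover have "chain_homotopic X E (\<alpha>' @ tl [last \<alpha>', last \<beta>']) (\<alpha> @ tl [last \<alpha>', last \<beta>'])"
    using *(1,3,5,7) F is_chain_ends(2)[of X E] ends
    by (intro chain_homotopic_concat) (auto simp: chain_homotopic_sym is_chain_Cons)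
  ultimately have "chain_homotopic X E \<beta> (\<alpha> @ [last \<beta>'])"
    using *(2) chain_homotopic_trans by (metis list.sel(3))
  then show ?R using *(7) ends by simp
qed

lemma XE_star_elim:
  assumes "(c, d) \<in> XE_star X b E F" "entourage X E" "F \<subseteq> E"
  obtains \<alpha> y where "is_chain X E \<alpha>" "hd \<alpha> = b" "is_chain X E (\<alpha> @ [y])" "(last \<alpha>, y) \<in> F"
    "c = chain_class X E \<alpha>" "d = chain_class X E (\<alpha> @ [y])"
proof -
  obtain \<alpha> \<beta> where *: "is_chain X E \<alpha>" "hd \<alpha> = b" "is_chain X E \<beta>" "hd \<beta> = b"
    "c = chain_class X E \<alpha>" "d = chain_class X E \<beta>"
    using assms(1) by (auto simp: XE_star_def)
  then have s: "(last \<alpha>, last \<beta>) \<in> F" "chain_homotopic X E \<beta> (\<alpha> @ [last \<beta>])"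
    using XE_star_iff assms by metis+
  show thesis
    using that[of \<alpha> "last \<beta>"] * s chain_homotopic_ends(3)[OF s(2)] by (simp add: chain_class_eq_iff)
qed

lemma XE_star_intro:
  assumes "entourage X E" "F \<subseteq> E" "is_chain X E \<alpha>" "hd \<alpha> = b" "(last \<alpha>, y) \<in> F"
  shows "(chain_class X E \<alpha>, chain_class X E (\<alpha> @ [y])) \<in> XE_star X b E F" "is_chain X E (\<alpha> @ [y])"
proof -
  have ne: "\<alpha> \<noteq> []" using assms(3) is_chain_nonempty by blast
  have "y \<in> points X" using assms entourage_points by blast
  then show "is_chain X E (\<alpha> @ [y])" using assms ne by (auto simp: is_chain_snoc)
  then show "(chain_class X E \<alpha>, chain_class X E (\<alpha> @ [y])) \<in> XE_star X b E F"
    using assms ne by (subst XE_star_iff) auto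
qed

lemma XE_star_class_end: "(c, d) \<in> XE_star X b E F \<Longrightarrow> (class_end c, class_end d) \<in> F"
  by (auto simp: XE_star_def)

lemma XE_star_mono: "F \<subseteq> G \<Longrightarrow> XE_star X b E F \<subseteq> XE_star X b E G"
  unfolding XE_star_def by blast

lemma XE_star_points: "XE_star X b E F \<subseteq> points (XE X b E) \<times> points (XE X b E)"
  unfolding XE_star_def using points_XE_I by blast

lemma XE_star_same_end:
  assumes "(c, d) \<in> XE_star X b E F" "entourage X E" "F \<subseteq> E" "class_end c = class_end d"
  shows "c = d"
proof -
  obtain \<alpha> y where *: "is_chain X E \<alpha>" "c = chain_class X E \<alpha>" "d = chain_class X E (\<alpha> @ [y])"
    using XE_star_elim[OF assms(1-3)] by metis
  then show ?thesis
    using chain_homotopic_dup_last[OF assms(2) *(1)] assms(4) by (simp add: chain_class_eq_iff)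
qed

lemma XE_star_refl:
  assumes "entourage X E" "entourage X F" "F \<subseteq> E" "c \<in> points (XE X b E)"
  shows "(c, c) \<in> XE_star X b E F"
proof -
  obtain \<alpha> where *: "is_chain X E \<alpha>" "hd \<alpha> = b" "c = chain_class X E \<alpha>"
    using assms(4) by (rule XE_cases)
  then show ?thesis
    using assms chain_homotopic_dup_last[OF assms(1) *(1)] is_chain_ends(2)[OF *(1)] entourage_refl
    by (simp add: XE_star_iff)
qed

lemma XE_star_trans:
  assumes E: "entourage X E" "F \<subseteq> E" "F' \<subseteq> E" "G \<subseteq> E"
    and "(c, d) \<in> XE_star X b E F" "(d, e) \<in> XE_star X b E F'" "(class_end c, class_end e) \<in> G"
  shows "(c, e) \<in> XE_star X b E G"
proof -
  obtain \<alpha> y where \<alpha>: "is_chain X E \<alpha>" "hd \<alpha> = b" "is_chain X E (\<alpha> @ [y])" "(last \<alpha>, y) \<in> F"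
    "c = chain_class X E \<alpha>" "d = chain_class X E (\<alpha> @ [y])"
    using XE_star_elim[OF assms(5) E(1,2)] by metis
  obtain \<beta> where \<beta>: "is_chain X E \<beta>" "hd \<beta> = b" "e = chain_class X E \<beta>"
    using assms(6) XE_star_points by (blast elim: XE_cases)
  have ne: "\<alpha> \<noteq> []" using \<alpha>(1) is_chain_nonempty by blast
  have s: "(y, last \<beta>) \<in> F'" "chain_homotopic X E \<beta> ((\<alpha> @ [y]) @ [last \<beta>])"
    using assms(6) XE_star_iff[OF E(1) E(3) \<alpha>(3) _ \<beta>(1,2)] \<alpha> \<beta> ne by auto
  have l: "(last \<alpha>, last \<beta>) \<in> G" using assms(7) \<alpha> \<beta> by simp
  have "is_chain X E ((\<alpha> @ [y]) @ [last \<beta>])" using chain_homotopic_ends(3)[OF s(2)] \<beta> by simp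
  then have "chain_homotopic X E (\<alpha> @ [y] @ [last \<beta>]) (\<alpha> @ [last \<beta>])"
    using ne l E(4) by (intro chain_homotopic_shortcut) auto
  then have "chain_homotopic X E \<beta> (\<alpha> @ [last \<beta>])"
    using s(2) chain_homotopic_trans by fastforce
  then show ?thesis using XE_star_iff[OF E(1) E(4) \<alpha>(1,2) \<beta>(1,2)] l \<alpha> \<beta> by simp
qed

lemma XE_star_sym:
  assumes "(c, d) \<in> XE_star X b E F" "entourage X E" "F \<subseteq> E" "sym F"
  shows "(d, c) \<in> XE_star X b E F"
proof -
  obtain \<alpha> y where \<alpha>: "is_chain X E \<alpha>" "hd \<alpha> = b" "is_chain X E (\<alpha> @ [y])" "(last \<alpha>, y) \<in> F"
    "c = chain_class X E \<alpha>" "d = chain_class X E (\<alpha> @ [y])"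
    using XE_star_elim[OF assms(1-3)] by metis
  have ne: "\<alpha> \<noteq> []" using \<alpha>(1) is_chain_nonempty by blast
  have l: "(y, last \<alpha>) \<in> F" using \<alpha>(4) assms(4) by (auto dest: symD)
  have p: "last \<alpha> \<in> points X" using is_chain_ends \<alpha>(1) by blast
  have 1: "chain_homotopic X E \<alpha> (\<alpha> @ [last \<alpha>])" using chain_homotopic_dup_last assms(2) \<alpha>(1) by blast
  have "is_chain X E (\<alpha> @ [y] @ [last \<alpha>])"
    using is_chain_snoc[of "\<alpha> @ [y]" X E "last \<alpha>"] \<alpha>(3) l p assms(3) by auto
  then have "chain_homotopic X E (\<alpha> @ [y] @ [last \<alpha>]) (\<alpha> @ [last \<alpha>])"
    using ne entourage_refl[OF assms(2) p] by (intro chain_homotopic_shortcut) auto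
  then have "chain_homotopic X E \<alpha> ((\<alpha> @ [y]) @ [last \<alpha>])"
    using 1 chain_homotopic_sym chain_homotopic_trans by fastforce
  then show ?thesis using XE_star_iff[OF assms(2,3) \<alpha>(3) _ \<alpha>(1,2)] l \<alpha> ne by simp
qed

lemma bond_XE_star:
  assumes "(c, d) \<in> XE_star X b F D" "entourage X E" "entourage X F" "F \<subseteq> E" "D \<subseteq> F"
  shows "(bond_XE X E c, bond_XE X E d) \<in> XE_star X b E D"
proof -
  obtain \<alpha> y where \<alpha>: "is_chain X F \<alpha>" "hd \<alpha> = b" "is_chain X F (\<alpha> @ [y])" "(last \<alpha>, y) \<in> D"
    "c = chain_class X F \<alpha>" "d = chain_class X F (\<alpha> @ [y])"
    using XE_star_elim[OF assms(1,3,5)] by metis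
  then show ?thesis
    using XE_star_intro(1)[of E D \<alpha> y] assms is_chain_mono[of X F \<alpha> E] by (simp add: bond_chain_class)
qed

lemma concat_XE_star:
  assumes "(c, d) \<in> XE_star X b E F" "entourage X E" "F \<subseteq> E" "g \<in> carrier (pi_E X b E)"
  shows "(class_concat X E g c, class_concat X E g d) \<in> XE_star X b E F"
proof -
  obtain \<alpha> y where \<alpha>: "is_chain X E \<alpha>" "hd \<alpha> = b" "is_chain X E (\<alpha> @ [y])" "(last \<alpha>, y) \<in> F"
    "c = chain_class X E \<alpha>" "d = chain_class X E (\<alpha> @ [y])"
    using XE_star_elim[OF assms(1-3)] by metis
  obtain \<gamma> where \<gamma>: "is_chain X E \<gamma>" "hd \<gamma> = b" "last \<gamma> = b" "g = chain_class X E \<gamma>"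
    using assms(4) by (rule pi_E_cases)
  have ne: "\<alpha> \<noteq> []" using \<alpha>(1) is_chain_nonempty by blast
  have "last \<gamma> = hd \<alpha>" using \<alpha>(2) \<gamma>(3) by simp
  note c = is_chain_concat[OF \<gamma>(1) \<alpha>(1) this]
  show ?thesis
    using XE_star_intro(1)[of E F "\<gamma> @ tl \<alpha>" y] assms(2,3) c \<alpha> \<gamma> ne
    by (simp add: class_concat_chain_class)
qed

lemma eventually_XE:
  assumes E: "entourage X E"
  shows "(\<forall>\<^sub>F p in unif (XE X b E). P p) \<longleftrightarrow> (\<exists>F. entourage X F \<and> F \<subseteq> E \<and> (\<forall>p\<in>XE_star X b E F. P p))"
proof -
  have "\<exists>H\<in>{F. entourage X F \<and> F \<subseteq> E}.
      principal (XE_star X b E H) \<le> inf (principal (XE_star X b E F)) (principal (XE_star X b E G))"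
    if "F \<in> {F. entourage X F \<and> F \<subseteq> E}" "G \<in> {F. entourage X F \<and> F \<subseteq> E}" for F G
    using that XE_star_mono[of "F \<inter> G" F E] XE_star_mono[of "F \<inter> G" G E]
    by (intro bexI[of _ "F \<inter> G"]) (auto simp: entourage_Int)
  then show ?thesis
    using E unfolding XE_def by (simp, subst eventually_INF_base) (auto simp: eventually_principal)
qed

lemma hausdorff_XE:
  assumes E: "entourage X E"
  shows "hausdorff_uniform (XE X b E)"
    and "\<And>F. entourage X F \<Longrightarrow> F \<subseteq> E \<Longrightarrow> entourage (XE X b E) (XE_star X b E F)"
proof -
  let ?B = "XE_star X b E ` {F. entourage X F \<and> F \<subseteq> E}"
  have 1: "(\<forall>\<^sub>F p in unif (XE X b E). P p) \<longleftrightarrow> (\<exists>B\<in>?B. \<forall>p\<in>B. P p)" for P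
    unfolding eventually_XE[OF E] by auto
  have 2: "B \<subseteq> points (XE X b E) \<times> points (XE X b E)" if "B \<in> ?B" for B
    using that XE_star_points by auto
  have 3: "?B \<noteq> {}" using E by blast
  have 4: "(x, x) \<in> B" if "B \<in> ?B" "x \<in> points (XE X b E)" for B x
    using that XE_star_refl[OF E] by auto
  have 5: "sym B" if "B \<in> ?B" for B
    using that XE_star_sym E by (auto intro!: symI simp: entourage_def)
  have 6: "\<exists>C\<in>?B. \<forall>x y z. (x, y) \<in> C \<longrightarrow> (y, z) \<in> C \<longrightarrow> (x, z) \<in> B" if B: "B \<in> ?B" for B
  proof -
    obtain F where F: "entourage X F" "F \<subseteq> E" "B = XE_star X b E F" using B by blast
    obtain G where G: "entourage X G" "G \<subseteq> F" "\<And>x y z. (x, y) \<in> G \<Longrightarrow> (y, z) \<in> G \<Longrightarrow> (x, z) \<in> F"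
      using entourage_half[OF F(1)] by metis
    have "(x, z) \<in> B" if "(x, y) \<in> XE_star X b E G" "(y, z) \<in> XE_star X b E G" for x y z
      unfolding F(3) using G F that
      by (intro XE_star_trans[OF E _ _ _ that]) (auto dest!: XE_star_class_end)
    then show ?thesis using G(1,2) F(2) by (intro bexI[of _ "XE_star X b E G"]) auto
  qed
  have 7: "x = y" if xy: "x \<in> points (XE X b E)" "y \<in> points (XE X b E)" "\<And>B. B \<in> ?B \<Longrightarrow> (x, y) \<in> B" for x y
  proof (rule XE_star_same_end)
    show "(x, y) \<in> XE_star X b E E" using xy(3)[of "XE_star X b E E"] E by blast
    show "class_end x = class_end y"
    proof (rule ccontr)
      assume "class_end x \<noteq> class_end y"
      then obtain F where F: "entourage X F" "(class_end x, class_end y) \<notin> F"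
        using entourage_separates class_end_points xy by metis
      have "(x, y) \<in> XE_star X b E (F \<inter> E)" using xy(3)[of "XE_star X b E (F \<inter> E)"] E F entourage_Int by blast
      then show False using F(2) XE_star_class_end by blast
    qed
  qed (use E in auto)
  note * = hausdorff_uniform_basisI[of "XE X b E" ?B, OF 1 2 3 4 5 6 7]
  from *(1) show "hausdorff_uniform (XE X b E)" by blast
  from *(2) show "\<And>F. entourage X F \<Longrightarrow> F \<subseteq> E \<Longrightarrow> entourage (XE X b E) (XE_star X b E F)" by blast
qed

lemma uniformly_cont_bond_XE:
  assumes "entourage X E" "entourage X F" "F \<subseteq> E"
  shows "uniformly_cont (XE X b F) (XE X b E) (bond_XE X E)"
  unfolding uniformly_cont_def filterlim_iff
proof (intro conjI allI impI)
  show "bond_XE X E \<in> points (XE X b F) \<rightarrow> points (XE X b E)" using bond_XE_closed assms by auto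
  fix P assume "\<forall>\<^sub>F p in unif (XE X b E). P p"
  then obtain G where G: "entourage X G" "G \<subseteq> E" "\<forall>p\<in>XE_star X b E G. P p"
    using eventually_XE assms by blast
  have "P (bond_XE X E c, bond_XE X E d)" if "(c, d) \<in> XE_star X b F (G \<inter> F)" for c d
    using bond_XE_star[OF that assms] G(3) XE_star_mono[of "G \<inter> F" G E] by blast
  then show "\<forall>\<^sub>F p in unif (XE X b F). P (case p of (x, y) \<Rightarrow> (bond_XE X E x, bond_XE X E y))"
    unfolding eventually_XE[OF assms(2)] using G assms by (intro exI[of _ "G \<inter> F"]) (auto simp: entourage_Int)
qed

end


section \<open>Inverse limits\<close>

lemma inv_limit_pointsD:
  assumes "x \<in> inv_limit_points I r S p"
  shows "x \<in> extensional I" "i \<in> I \<Longrightarrow> x i \<in> S i" "(i, j) \<in> r \<Longrightarrow> p i j (x j) = x i"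
  using assms by (auto simp: inv_limit_points_def PiE_iff)

lemma directed_index_subset: "directed_index I r \<Longrightarrow> r \<subseteq> I \<times> I"
  by (simp add: directed_index_def order_on_defs)

lemma points_inv_limit_uspace:
  "points (inv_limit_uspace I r Y p) = inv_limit_points I r (\<lambda>i. points (Y i)) p"
  by (simp add: inv_limit_uspace_def Let_def)

locale inverse_system =
  fixes I :: "'i set" and r :: "'i rel" and Y :: "'i \<Rightarrow> 'a uspace" and p :: "'i \<Rightarrow> 'i \<Rightarrow> 'a \<Rightarrow> 'a"
  assumes system: "uniform_inverse_system I r Y p"
begin

abbreviation "L \<equiv> points (inv_limit_uspace I r Y p)"

lemma directed: "directed_index I r"
  using system by (simp add: uniform_inverse_system_def)

lemma index_nonempty: "I \<noteq> {}"
  using directed by (simp add: directed_index_def)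

lemma index_upper:
  assumes "i \<in> I" "j \<in> I" obtains k where "k \<in> I" "(i, k) \<in> r" "(j, k) \<in> r"
  using assms directed unfolding directed_index_def by meson

lemma L_closed: "x \<in> L \<Longrightarrow> i \<in> I \<Longrightarrow> x i \<in> points (Y i)"
  unfolding points_inv_limit_uspace by (rule inv_limit_pointsD)

lemma L_bond: "x \<in> L \<Longrightarrow> (i, j) \<in> r \<Longrightarrow> p i j (x j) = x i"
  unfolding points_inv_limit_uspace by (rule inv_limit_pointsD)

lemma hausdorff_stage: "i \<in> I \<Longrightarrow> hausdorff_uspace (Y i)"
  using system by (simp add: uniform_inverse_system_def hausdorff_uspace_def)

lemma uniformly_cont_bond: "(i, j) \<in> r \<Longrightarrow> uniformly_cont (Y j) (Y i) (p i j)"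
  using system by (auto simp: uniform_inverse_system_def)

text \<open>By directedness, one coordinate suffices to control closeness in the limit.\<close>

lemma eventually_inv_limit:
  "(\<forall>\<^sub>F q in unif (inv_limit_uspace I r Y p). P q) \<longleftrightarrow>
    (\<exists>i\<in>I. \<exists>E. entourage (Y i) E \<and> (\<forall>x\<in>L. \<forall>y\<in>L. (x i, y i) \<in> E \<longrightarrow> P (x, y)))"
proof -
  define F where "F i = inf (principal (L \<times> L)) (filtercomap (\<lambda>(x, y). (x i, y i)) (unif (Y i)))" for i
  have ev: "eventually P (F i) \<longleftrightarrow>
      (\<exists>E. entourage (Y i) E \<and> (\<forall>x\<in>L. \<forall>y\<in>L. (x i, y i) \<in> E \<longrightarrow> P (x, y)))" if i: "i \<in> I" for i P
  proof -
    interpret hausdorff_uspace "Y i" using hausdorff_stage[OF i] .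
    have "eventually P (F i) \<longleftrightarrow>
      (\<exists>Q. eventually Q (unif (Y i)) \<and> (\<forall>x\<in>L. \<forall>y\<in>L. Q (x i, y i) \<longrightarrow> P (x, y)))"
      unfolding F_def inf_commute[of "principal _"] eventually_inf_principal eventually_filtercomap
      by (simp add: split_paired_all) meson
    also have "\<dots> \<longleftrightarrow> (\<exists>E. entourage (Y i) E \<and> (\<forall>x\<in>L. \<forall>y\<in>L. (x i, y i) \<in> E \<longrightarrow> P (x, y)))"
    proof
      assume "\<exists>Q. eventually Q (unif (Y i)) \<and> (\<forall>x\<in>L. \<forall>y\<in>L. Q (x i, y i) \<longrightarrow> P (x, y))"
      then obtain Q where "eventually Q (unif (Y i))" and Q: "\<forall>x\<in>L. \<forall>y\<in>L. Q (x i, y i) \<longrightarrow> P (x, y)"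
        by (elim exE conjE)
      then obtain E where "entourage (Y i) E" "\<forall>p\<in>E. Q p" using eventually_unif_iff by meson
      with Q show "\<exists>E. entourage (Y i) E \<and> (\<forall>x\<in>L. \<forall>y\<in>L. (x i, y i) \<in> E \<longrightarrow> P (x, y))"
        by (intro exI[of _ E]) simp
    next
      assume "\<exists>E. entourage (Y i) E \<and> (\<forall>x\<in>L. \<forall>y\<in>L. (x i, y i) \<in> E \<longrightarrow> P (x, y))"
      then obtain E where "entourage (Y i) E" "\<forall>x\<in>L. \<forall>y\<in>L. (x i, y i) \<in> E \<longrightarrow> P (x, y)"
        by (elim exE conjE)
      then show "\<exists>Q. eventually Q (unif (Y i)) \<and> (\<forall>x\<in>L. \<forall>y\<in>L. Q (x i, y i) \<longrightarrow> P (x, y))"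
        by (intro exI[of _ "\<lambda>q. q \<in> E"]) (simp add: entourage_def)
    qed
    finally show ?thesis .
  qed
  have mono: "F k \<le> F i" if ik: "(i, k) \<in> r" for i k
  proof (rule filter_leI)
    fix P assume P: "eventually P (F i)"
    have I: "i \<in> I" "k \<in> I" using ik directed_index_subset[OF directed] by auto
    interpret k: hausdorff_uspace "Y k" using hausdorff_stage[OF I(2)] .
    obtain E where E: "entourage (Y i) E" "\<forall>x\<in>L. \<forall>y\<in>L. (x i, y i) \<in> E \<longrightarrow> P (x, y)"
      using P[unfolded ev[OF I(1)]] by (elim exE conjE)
    have "\<forall>\<^sub>F q in unif (Y k). (\<lambda>(x, y). (p i k x, p i k y)) q \<in> E"
    proof -
      have 1: "\<forall>\<^sub>F q in unif (Y i). q \<in> E" using E(1) by (simp add: entourage_def)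
      have 2: "filterlim (\<lambda>(x, y). (p i k x, p i k y)) (unif (Y i)) (unif (Y k))"
        using uniformly_cont_bond[OF ik] by (simp add: uniformly_cont_def)
      show ?thesis by (rule eventually_compose_filterlim[OF 1 2])
    qed
    then obtain E' where E': "entourage (Y k) E'" "\<forall>q\<in>E'. (\<lambda>(x, y). (p i k x, p i k y)) q \<in> E"
      unfolding k.eventually_unif_iff by (elim exE conjE)
    have "P (x, y)" if "x \<in> L" "y \<in> L" "(x k, y k) \<in> E'" for x y
      using E(2) bspec[OF E'(2) that(3)] that(1,2) L_bond[OF _ ik] by simp
    then show "eventually P (F k)" unfolding ev[OF I(2)] using E'(1) by (intro exI[of _ E']) simp
  qed
  have "unif (inv_limit_uspace I r Y p) = (INF i\<in>I. F i)"
    using index_nonempty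
    by (simp add: F_def inv_limit_uspace_def Let_def INF_inf_const1 points_inv_limit_uspace)
  moreover have "\<exists>k\<in>I. F k \<le> inf (F i) (F j)" if ij: "i \<in> I" "j \<in> I" for i j
  proof -
    obtain k where "k \<in> I" "(i, k) \<in> r" "(j, k) \<in> r" using index_upper[OF ij] .
    then show ?thesis using mono by (intro bexI[of _ k]) simp_all
  qed
  ultimately have "(\<forall>\<^sub>F q in unif (inv_limit_uspace I r Y p). P q) \<longleftrightarrow> (\<exists>i\<in>I. eventually P (F i))"
    using index_nonempty by (simp add: eventually_INF_base)
  then show ?thesis using ev by simp
qed

definition cylinder :: "'i \<Rightarrow> ('a \<times> 'a) set \<Rightarrow> (('i \<Rightarrow> 'a) \<times> ('i \<Rightarrow> 'a)) set" where
  "cylinder i E = {(x, y) \<in> L \<times> L. (x i, y i) \<in> E}"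

lemma hausdorff_inv_limit:
  shows "hausdorff_uniform (inv_limit_uspace I r Y p)"
    and "\<And>i E. i \<in> I \<Longrightarrow> entourage (Y i) E \<Longrightarrow> entourage (inv_limit_uspace I r Y p) (cylinder i E)"
proof -
  let ?B = "{cylinder i E |i E. i \<in> I \<and> entourage (Y i) E}"
  have 1: "(\<forall>\<^sub>F q in unif (inv_limit_uspace I r Y p). P q) \<longleftrightarrow> (\<exists>B\<in>?B. \<forall>q\<in>B. P q)" for P
    unfolding eventually_inv_limit by (auto simp: cylinder_def)
  have 2: "B \<subseteq> L \<times> L" if "B \<in> ?B" for B using that by (auto simp: cylinder_def)
  have 3: "?B \<noteq> {}"
    using index_nonempty hausdorff_uspace.ex_entourage[OF hausdorff_stage] by auto
  have 4: "(x, x) \<in> B" if "B \<in> ?B" "x \<in> L" for B x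
    using that L_closed hausdorff_uspace.entourage_refl[OF hausdorff_stage] by (auto simp: cylinder_def)
  have 5: "sym B" if "B \<in> ?B" for B
    using that by (auto simp: cylinder_def entourage_def sym_def)
  have 6: "\<exists>C\<in>?B. \<forall>x y z. (x, y) \<in> C \<longrightarrow> (y, z) \<in> C \<longrightarrow> (x, z) \<in> B" if B: "B \<in> ?B" for B
  proof -
    obtain i E where iE: "i \<in> I" "entourage (Y i) E" "B = cylinder i E" using B by auto
    obtain F where F: "entourage (Y i) F" "\<And>x y z. (x, y) \<in> F \<Longrightarrow> (y, z) \<in> F \<Longrightarrow> (x, z) \<in> E"
      using hausdorff_uspace.entourage_half[OF hausdorff_stage[OF iE(1)] iE(2)] by metis
    have "(x, z) \<in> B" if "(x, y) \<in> cylinder i F" "(y, z) \<in> cylinder i F" for x y z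
      using that F(2)[of "x i" "y i" "z i"] by (simp add: iE(3) cylinder_def)
    then show ?thesis using F(1) iE(1) by (intro bexI[of _ "cylinder i F"]) auto
  qed
  have 7: "x = y" if xy: "x \<in> L" "y \<in> L" "\<And>B. B \<in> ?B \<Longrightarrow> (x, y) \<in> B" for x y
  proof (rule ext)
    fix i
    show "x i = y i"
    proof (cases "i \<in> I")
      case True
      interpret hausdorff_uspace "Y i" using hausdorff_stage[OF True] .
      have "(x i, y i) \<in> E" if "entourage (Y i) E" for E
        using xy(3)[of "cylinder i E"] that True by (auto simp: cylinder_def)
      then show ?thesis using entourage_separates L_closed[OF xy(1) True] L_closed[OF xy(2) True] by metis
    next
      case False
      then show ?thesis
        using xy(1,2) by (simp add: points_inv_limit_uspace inv_limit_points_def PiE_iff extensional_def)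
    qed
  qed
  note * = hausdorff_uniform_basisI[of "inv_limit_uspace I r Y p" ?B, OF 1 2 3 4 5 6 7]
  from *(1) show "hausdorff_uniform (inv_limit_uspace I r Y p)" by blast
  show "entourage (inv_limit_uspace I r Y p) (cylinder i E)" if "i \<in> I" "entourage (Y i) E" for i E
    by (rule *(2)) (use that in auto)
qed

end

lemma group_inv_limit:
  assumes sys: "group_inverse_system I r G h"
  shows "group (inv_limit_group I r G h)"
proof -
  have r: "r \<subseteq> I \<times> I" using sys by (simp add: group_inverse_system_def directed_index_subset)
  have grp: "group (G i)" if "i \<in> I" for i using sys that by (simp add: group_inverse_system_def)
  have hom: "h i j \<in> hom (G j) (G i)" if "(i, j) \<in> r" for i j
    using sys that by (auto simp: group_inverse_system_def)
  have gh: "group_hom (G j) (G i) (h i j)" if "(i, j) \<in> r" for i j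
    using hom[OF that] grp r that by (auto simp: group_hom_def group_hom_axioms_def)
  define L where "L = inv_limit_points I r (\<lambda>i. carrier (G i)) h"
  have LI: "x \<in> L" if "x \<in> extensional I" "\<And>i. i \<in> I \<Longrightarrow> x i \<in> carrier (G i)"
    "\<And>i j. (i, j) \<in> r \<Longrightarrow> h i j (x j) = x i" for x
    using that unfolding L_def inv_limit_points_def by (auto simp: PiE_iff)
  have LD: "x \<in> extensional I" "\<And>i. i \<in> I \<Longrightarrow> x i \<in> carrier (G i)"
    "\<And>i j. (i, j) \<in> r \<Longrightarrow> h i j (x j) = x i" if "x \<in> L" for x
    using that unfolding L_def by (auto dest: inv_limit_pointsD)
  have rI: "i \<in> I" "j \<in> I" if "(i, j) \<in> r" for i j using that r by auto
  have simps: "carrier (inv_limit_group I r G h) = L"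
    "x \<otimes>\<^bsub>inv_limit_group I r G h\<^esub> y = (\<lambda>i\<in>I. x i \<otimes>\<^bsub>G i\<^esub> y i)"
    "\<one>\<^bsub>inv_limit_group I r G h\<^esub> = (\<lambda>i\<in>I. \<one>\<^bsub>G i\<^esub>)" for x y
    by (simp_all add: inv_limit_group_def L_def)
  show ?thesis
  proof (rule groupI, unfold simps)
    fix x y assume x: "x \<in> L" and y: "y \<in> L"
    show "(\<lambda>i\<in>I. x i \<otimes>\<^bsub>G i\<^esub> y i) \<in> L"
    proof (rule LI)
      fix i assume "i \<in> I"
      then show "(\<lambda>i\<in>I. x i \<otimes>\<^bsub>G i\<^esub> y i) i \<in> carrier (G i)"
        using LD(2)[OF x] LD(2)[OF y] by (simp add: group.is_monoid grp monoid.m_closed)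
    next
      fix i j assume ij: "(i, j) \<in> r"
      show "h i j ((\<lambda>i\<in>I. x i \<otimes>\<^bsub>G i\<^esub> y i) j) = (\<lambda>i\<in>I. x i \<otimes>\<^bsub>G i\<^esub> y i) i"
        using rI[OF ij] hom_mult[OF hom[OF ij]] LD[OF x] LD[OF y] ij by simp
    qed simp
  next
    show "(\<lambda>i\<in>I. \<one>\<^bsub>G i\<^esub>) \<in> L"
    proof (rule LI)
      fix i assume "i \<in> I"
      then show "(\<lambda>i\<in>I. \<one>\<^bsub>G i\<^esub>) i \<in> carrier (G i)" by (simp add: group.is_monoid grp)
    next
      fix i j assume ij: "(i, j) \<in> r"
      show "h i j ((\<lambda>i\<in>I. \<one>\<^bsub>G i\<^esub>) j) = (\<lambda>i\<in>I. \<one>\<^bsub>G i\<^esub>) i"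
        using rI[OF ij] group_hom.hom_one[OF gh[OF ij]] by simp
    qed simp
  next
    fix x y z assume x: "x \<in> L" and y: "y \<in> L" and z: "z \<in> L"
    show "(\<lambda>i\<in>I. (\<lambda>i\<in>I. x i \<otimes>\<^bsub>G i\<^esub> y i) i \<otimes>\<^bsub>G i\<^esub> z i) = (\<lambda>i\<in>I. x i \<otimes>\<^bsub>G i\<^esub> (\<lambda>i\<in>I. y i \<otimes>\<^bsub>G i\<^esub> z i) i)"
      using LD(2)[OF x] LD(2)[OF y] LD(2)[OF z] grp
      by (intro restrict_ext) (simp add: group.is_monoid monoid.m_assoc)
  next
    fix x assume x: "x \<in> L"
    show "(\<lambda>i\<in>I. (\<lambda>i\<in>I. \<one>\<^bsub>G i\<^esub>) i \<otimes>\<^bsub>G i\<^esub> x i) = x"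
      using LD[OF x] grp by (auto simp: fun_eq_iff extensional_def group.is_monoid monoid.l_one)
    have "(\<lambda>i\<in>I. inv\<^bsub>G i\<^esub> x i) \<in> L"
    proof (rule LI)
      fix i assume "i \<in> I"
      then show "(\<lambda>i\<in>I. inv\<^bsub>G i\<^esub> x i) i \<in> carrier (G i)" using LD(2)[OF x] grp by simp
    next
      fix i j assume ij: "(i, j) \<in> r"
      show "h i j ((\<lambda>i\<in>I. inv\<^bsub>G i\<^esub> x i) j) = (\<lambda>i\<in>I. inv\<^bsub>G i\<^esub> x i) i"
        using rI[OF ij] group_hom.hom_inv[OF gh[OF ij]] LD[OF x] ij by simp
    qed simp
    moreover have "(\<lambda>i\<in>I. (\<lambda>i\<in>I. inv\<^bsub>G i\<^esub> x i) i \<otimes>\<^bsub>G i\<^esub> x i) = (\<lambda>i\<in>I. \<one>\<^bsub>G i\<^esub>)"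
      using LD(2)[OF x] grp by (intro restrict_ext) (simp add: group.l_inv)
    ultimately show "\<exists>y\<in>L. (\<lambda>i\<in>I. y i \<otimes>\<^bsub>G i\<^esub> x i) = (\<lambda>i\<in>I. \<one>\<^bsub>G i\<^esub>)" by blast
  qed
qed

lemma directed_index_cofinal:
  assumes dir: "directed_index J r" and I: "I \<subseteq> J" "\<And>j. j \<in> J \<Longrightarrow> \<exists>i\<in>I. (j, i) \<in> r"
  shows "directed_index I (r \<inter> I \<times> I)"
  unfolding directed_index_def order_on_defs
proof (intro conjI ballI)
  have po: "refl_on J r" "trans r" "antisym r" using dir by (simp_all add: directed_index_def order_on_defs)
  show "refl_on I (r \<inter> I \<times> I)" using po(1) I(1) by (auto simp: refl_on_def)
  show "trans (r \<inter> I \<times> I)" using po(2) unfolding trans_def by blast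
  show "antisym (r \<inter> I \<times> I)" using po(3) unfolding antisym_def by blast
  show "I \<noteq> {}" using dir I(2) unfolding directed_index_def by blast
  fix i j assume ij: "i \<in> I" "j \<in> I"
  then obtain k where k: "k \<in> J" "(i, k) \<in> r" "(j, k) \<in> r"
    using dir I(1) unfolding directed_index_def by (meson subsetD)
  obtain l where l: "l \<in> I" "(k, l) \<in> r" using I(2)[OF k(1)] by blast
  have "(i, l) \<in> r" "(j, l) \<in> r" using transD[OF po(2)] k l by metis+
  then show "\<exists>k\<in>I. (i, k) \<in> r \<inter> I \<times> I \<and> (j, k) \<in> r \<inter> I \<times> I" using ij l(1) by blast
qed auto

text \<open>A point of the limit can be reconstructed from its coordinates in a cofinal set of indices,
  since \<open>p j i (y i)\<close> is the same for all \<open>i\<close> above \<open>j\<close>. Passing from \<open>S i\<close> to the image \<open>T i\<close> of the limit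
  loses no points and makes the bonding maps surjective.\<close>

lemma inv_limit_cofinal:
  assumes dir: "directed_index J r"
    and closed: "\<And>i j y. (i, j) \<in> r \<Longrightarrow> y \<in> S j \<Longrightarrow> p i j y \<in> S i"
    and comp: "\<And>i j k y. (i, j) \<in> r \<Longrightarrow> (j, k) \<in> r \<Longrightarrow> y \<in> S k \<Longrightarrow> p i k y = p i j (p j k y)"
    and id: "\<And>i y. i \<in> J \<Longrightarrow> y \<in> S i \<Longrightarrow> p i i y = y"
    and I: "I \<subseteq> J" "\<And>j. j \<in> J \<Longrightarrow> \<exists>i\<in>I. (j, i) \<in> r"
    and T: "\<And>i. i \<in> I \<Longrightarrow> T i = (\<lambda>x. x i) ` inv_limit_points J r S p"
  shows "bij_betw (\<lambda>x. restrict x I) (inv_limit_points J r S p) (inv_limit_points I (r \<inter> I \<times> I) T p)"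
proof (rule bij_betw_imageI)
  let ?L = "inv_limit_points J r S p"
  have r: "r \<subseteq> J \<times> J" using directed_index_subset[OF dir] .
  have trans: "trans r" using dir by (simp add: directed_index_def order_on_defs)
  show "inj_on (\<lambda>x. restrict x I) ?L"
  proof (rule inj_onI, rule ext)
    fix x y j assume x: "x \<in> ?L" and y: "y \<in> ?L" and eq: "restrict x I = restrict y I"
    show "x j = y j"
    proof (cases "j \<in> J")
      case True
      then obtain i where i: "i \<in> I" "(j, i) \<in> r" using I(2) by blast
      have "x i = y i" using fun_cong[OF eq, of i] i(1) by simp
      then show ?thesis using inv_limit_pointsD(3)[OF x i(2)] inv_limit_pointsD(3)[OF y i(2)] by simp
    qed (use inv_limit_pointsD(1)[OF x] inv_limit_pointsD(1)[OF y] in \<open>simp add: extensional_def\<close>)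
  qed
  show "(\<lambda>x. restrict x I) ` ?L = inv_limit_points I (r \<inter> I \<times> I) T p"
  proof (intro equalityI subsetI)
    fix y assume "y \<in> (\<lambda>x. restrict x I) ` ?L"
    then obtain x where x: "x \<in> ?L" "y = restrict x I" by blast
    have "x i \<in> T i" if "i \<in> I" for i using T[OF that] x(1) by blast
    then show "y \<in> inv_limit_points I (r \<inter> I \<times> I) T p"
      using x inv_limit_pointsD(3)[OF x(1)] by (auto simp: inv_limit_points_def)
  next
    fix y assume y: "y \<in> inv_limit_points I (r \<inter> I \<times> I) T p"
    have yS: "y i \<in> S i" if i: "i \<in> I" for i
    proof -
      obtain x where "x \<in> ?L" "y i = x i" using inv_limit_pointsD(2)[OF y i] T[OF i] by auto
      then show ?thesis using inv_limit_pointsD(2)[of x J r S p i] i I(1) by auto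
    qed
    have indep: "p j i (y i) = p j i' (y i')"
      if ii': "i \<in> I" "i' \<in> I" and j: "(j, i) \<in> r" "(j, i') \<in> r" for i i' j
    proof -
      obtain k where k: "k \<in> J" "(i, k) \<in> r" "(i', k) \<in> r"
        using dir ii' I(1) unfolding directed_index_def by (meson subsetD)
      obtain l where l: "l \<in> I" "(k, l) \<in> r" using I(2)[OF k(1)] by blast
      have il: "(i, l) \<in> r" "(i', l) \<in> r" using transD[OF trans] k l by metis+
      have "p j i (y i) = p j l (y l)"
        using inv_limit_pointsD(3)[OF y, of i l] il(1) ii' l(1) comp[OF j(1) il(1) yS[OF l(1)]] by simp
      also have "\<dots> = p j i' (y i')"
        using inv_limit_pointsD(3)[OF y, of i' l] il(2) ii' l(1) comp[OF j(2) il(2) yS[OF l(1)]] by simp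
      finally show ?thesis .
    qed
    define c where "c j = (SOME i. i \<in> I \<and> (j, i) \<in> r)" for j
    have c: "c j \<in> I" "(j, c j) \<in> r" if "j \<in> J" for j
      using someI_ex[of "\<lambda>i. i \<in> I \<and> (j, i) \<in> r"] I(2)[OF that] unfolding c_def by blast+
    define x where "x = (\<lambda>j\<in>J. p j (c j) (y (c j)))"
    have x: "x j = p j i (y i)" if "i \<in> I" "(j, i) \<in> r" for i j
    proof -
      have j: "j \<in> J" using r that(2) by auto
      show ?thesis using indep[OF c(1)[OF j] that(1) c(2)[OF j] that(2)] j by (simp add: x_def)
    qed
    have "x \<in> ?L"
      unfolding inv_limit_points_def
    proof (intro CollectI conjI PiE_I ballI)
      fix j assume j: "j \<in> J"
      then show "x j \<in> S j" using closed[OF c(2)[OF j] yS[OF c(1)[OF j]]] by (simp add: x_def)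
    next
      fix q assume q: "q \<in> r"
      obtain i j where ij: "q = (i, j)" by (cases q)
      have j: "j \<in> J" "(i, j) \<in> r" using q r ij by auto
      have "(i, c j) \<in> r" using transD[OF trans j(2) c(2)[OF j(1)]] .
      then have "x i = p i (c j) (y (c j))" using x[OF c(1)[OF j(1)]] by simp
      also have "\<dots> = p i j (x j)"
        using comp[OF j(2) c(2)[OF j(1)] yS[OF c(1)[OF j(1)]]] j(1) by (simp add: x_def)
      finally show "case q of (i, j) \<Rightarrow> p i j (x j) = x i" using ij by simp
    qed (simp add: x_def)
    moreover have "restrict x I = y"
    proof
      fix i
      have "(i, i) \<in> r" if "i \<in> I"
        using dir I(1) that by (auto simp: directed_index_def order_on_defs refl_on_def)
      then show "restrict x I i = y i"
        using x[of i i] id[of i "y i"] yS[of i] I(1) inv_limit_pointsD(1)[OF y]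
        by (cases "i \<in> I") (auto simp: extensional_def)
    qed
    ultimately show "y \<in> (\<lambda>x. restrict x I) ` ?L" by blast
  qed
qed

lemma group_actionI:
  assumes G: "group G"
    and ext: "\<And>g. g \<in> carrier G \<Longrightarrow> act g \<in> extensional A"
    and closed: "\<And>g x. g \<in> carrier G \<Longrightarrow> x \<in> A \<Longrightarrow> act g x \<in> A"
    and one: "\<And>x. x \<in> A \<Longrightarrow> act \<one>\<^bsub>G\<^esub> x = x"
    and mult: "\<And>g h x. g \<in> carrier G \<Longrightarrow> h \<in> carrier G \<Longrightarrow> x \<in> A \<Longrightarrow> act (g \<otimes>\<^bsub>G\<^esub> h) x = act g (act h x)"
  shows "group_action G A act"
proof -
  interpret group G by (rule G)
  have bij: "act g \<in> Bij A" if g: "g \<in> carrier G" for g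
  proof -
    have "bij_betw (act g) A A"
    proof (rule bij_betwI[of _ _ _ "act (inv\<^bsub>G\<^esub> g)"])
      show "act (inv\<^bsub>G\<^esub> g) (act g x) = x" if "x \<in> A" for x
        using mult[of "inv\<^bsub>G\<^esub> g" g x] one[OF that] g that by simp
      show "act g (act (inv\<^bsub>G\<^esub> g) x) = x" if "x \<in> A" for x
        using mult[of g "inv\<^bsub>G\<^esub> g" x] one[OF that] g that by simp
    qed (use closed g in auto)
    then show ?thesis using ext[OF g] by (simp add: Bij_def)
  qed
  have "act (g \<otimes>\<^bsub>G\<^esub> h) = compose A (act g) (act h)" if "g \<in> carrier G" "h \<in> carrier G" for g h
    using that mult[OF that] ext[of "g \<otimes>\<^bsub>G\<^esub> h"] by (auto simp: compose_def fun_eq_iff extensional_def)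
  then have "act \<in> hom G (BijGroup A)"
    using bij by (auto simp: hom_def BijGroup_def)
  then show ?thesis
    by (simp add: group_action_def group_hom_def group_hom_axioms_def G group_BijGroup)
qed


section \<open>The inverse limit of the spaces \<open>X\<^sub>E\<close> and its deck group\<close>

context pointed_uspace
begin

abbreviation T :: "(('a \<times> 'a) set \<Rightarrow> 'a list set) uspace" where "T \<equiv> tilde X b"

abbreviation proj :: "(('a \<times> 'a) set \<Rightarrow> 'a list set) \<Rightarrow> 'a" where "proj \<equiv> tilde_proj X"

lemma finer_iff: "(E, F) \<in> finer X \<longleftrightarrow> entourage X E \<and> entourage X F \<and> F \<subseteq> E"
  by (simp add: finer_def)

lemma directed_finer: "directed_index (entourages X) (finer X)"
  unfolding directed_index_def order_on_defs
proof (intro conjI ballI)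
  fix E F assume "E \<in> entourages X" "F \<in> entourages X"
  then show "\<exists>G\<in>entourages X. (E, G) \<in> finer X \<and> (F, G) \<in> finer X"
    using entourage_Int by (intro bexI[of _ "E \<inter> F"]) (auto simp: finer_iff)
next
  show "trans (finer X)" unfolding trans_def finer_iff by (meson subset_trans)
qed (use ex_entourage in \<open>auto simp: finer_iff refl_on_def antisym_def\<close>)

lemma inverse_system_XE:
  "uniform_inverse_system (entourages X) (finer X) (XE X b) (\<lambda>E F. bond_XE X E)"
  unfolding uniform_inverse_system_def
proof (intro conjI allI impI ballI)
  fix E F D c assume "(E, F) \<in> finer X \<and> (F, D) \<in> finer X" "c \<in> points (XE X b D)"
  then show "bond_XE X E c = bond_XE X E (bond_XE X F c)"
    using bond_XE_trans[of F E D c] by (simp add: finer_iff)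
next
  fix q assume "q \<in> finer X"
  then show "case q of (E, F) \<Rightarrow> uniformly_cont (XE X b F) (XE X b E) (bond_XE X E)"
    using uniformly_cont_bond_XE by (cases q) (simp add: finer_iff)
qed (use directed_finer hausdorff_XE(1) bond_XE_refl in auto)

sublocale stages: inverse_system "entourages X" "finer X" "XE X b" "\<lambda>E F. bond_XE X E"
  by unfold_locales (rule inverse_system_XE)

lemma stages_tilde: "inv_limit_uspace (entourages X) (finer X) (XE X b) (\<lambda>E F. bond_XE X E) = T"
  by (simp add: tilde_def)

lemmas hausdorff_tilde = stages.hausdorff_inv_limit(1)[unfolded stages_tilde]

lemma points_tilde:
  "points T = inv_limit_points (entourages X) (finer X) (\<lambda>E. points (XE X b E)) (\<lambda>E F. bond_XE X E)"
  by (simp add: tilde_def points_inv_limit_uspace)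

lemma tilde_closed: "x \<in> points T \<Longrightarrow> entourage X E \<Longrightarrow> x E \<in> points (XE X b E)"
  using stages.L_closed[unfolded stages_tilde] by simp

lemma tilde_bond:
  "x \<in> points T \<Longrightarrow> entourage X E \<Longrightarrow> entourage X F \<Longrightarrow> F \<subseteq> E \<Longrightarrow> bond_XE X E (x F) = x E"
  using stages.L_bond[unfolded stages_tilde] by (simp add: finer_iff)

lemma tilde_extensional: "x \<in> points T \<Longrightarrow> x \<in> extensional (entourages X)"
  unfolding points_tilde by (rule inv_limit_pointsD)

lemma tilde_eqI:
  assumes "x \<in> points T" "y \<in> points T" "\<And>E. entourage X E \<Longrightarrow> x E = y E"
  shows "x = y"
  using tilde_extensional[OF assms(1)] tilde_extensional[OF assms(2)] assms(3)
  by (intro extensionalityI[of x "entourages X"]) auto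

lemma tildeI:
  assumes "x \<in> extensional (entourages X)" "\<And>E. entourage X E \<Longrightarrow> x E \<in> points (XE X b E)"
    and "\<And>E F. entourage X E \<Longrightarrow> entourage X F \<Longrightarrow> F \<subseteq> E \<Longrightarrow> bond_XE X E (x F) = x E"
  shows "x \<in> points T"
  using assms unfolding points_tilde inv_limit_points_def by (auto simp: PiE_iff finer_iff)

lemma class_end_tilde:
  assumes "x \<in> points T" "entourage X E" "entourage X F"
  shows "class_end (x E) = class_end (x F)"
proof -
  have "class_end (x G) = class_end (x (E \<inter> F))" if "entourage X G" "E \<inter> F \<subseteq> G" for G
    using bond_XE_closed(2)[OF that(2) tilde_closed[OF assms(1) entourage_Int[OF assms(2,3)]]]
      tilde_bond[OF assms(1) that(1) entourage_Int[OF assms(2,3)] that(2)] by simp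
  then show ?thesis using assms by simp
qed

lemma tilde_proj: "x \<in> points T \<Longrightarrow> entourage X E \<Longrightarrow> proj x = class_end (x E)"
  unfolding tilde_proj_def by (rule the_equality) (metis class_end_tilde)+

lemma tilde_proj_points: "x \<in> points T \<Longrightarrow> proj x \<in> points X"
  using ex_entourage tilde_proj tilde_closed class_end_points by metis

lemma tilde_cases:
  assumes "x \<in> points T" "entourage X E"
  obtains \<alpha> where "is_chain X E \<alpha>" "hd \<alpha> = b" "x E = chain_class X E \<alpha>" "last \<alpha> = proj x"
  using tilde_closed[OF assms] tilde_proj[OF assms] by (auto elim: XE_cases)

lemma tilde_chain_class_mono:
  assumes "x \<in> points T" "entourage X E" "entourage X F" "F \<subseteq> E" "x F = chain_class X F \<alpha>"
  shows "x E = chain_class X E \<alpha>"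
  using tilde_bond[OF assms(1-4)] assms(4,5) by (simp add: bond_chain_class)

lemma tilde_base_points: "tilde_base X b \<in> points T" "proj (tilde_base X b) = b"
proof -
  show *: "tilde_base X b \<in> points T"
    using one_XE by (intro tildeI) (auto simp: tilde_base_def bond_chain_class)
  obtain E where "entourage X E" using ex_entourage by blast
  then show "proj (tilde_base X b) = b" using tilde_proj[OF *] by (simp add: tilde_base_def)
qed

text \<open>The entourage \<open>E\<close> fixes the stage and thereby the homotopies that are available, the entourage
  \<open>G\<close> bounds the size of a step. Lifting homotopies requires \<open>G\<close> to be smaller than \<open>E\<close>.\<close>

definition tilde_star where
  "tilde_star E G = {(x, y) \<in> points T \<times> points T. (x E, y E) \<in> XE_star X b E G}"

lemma tilde_star_eq_cylinder: "tilde_star E G = stages.cylinder E (XE_star X b E G)"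
  unfolding tilde_star_def stages.cylinder_def stages_tilde ..

lemma entourage_tilde_star:
  assumes "entourage X E" "entourage X G" "G \<subseteq> E" shows "entourage T (tilde_star E G)"
  using stages.hausdorff_inv_limit(2)[unfolded stages_tilde, of E "XE_star X b E G"]
    hausdorff_XE(2)[OF assms] assms by (simp add: tilde_star_eq_cylinder)

lemma tilde_star_bond:
  assumes "entourage X E" "entourage X F" "F \<subseteq> E" "D \<subseteq> F"
  shows "tilde_star F D \<subseteq> tilde_star E D"
proof -
  have "(x E, y E) \<in> XE_star X b E D" if "x \<in> points T" "y \<in> points T" "(x F, y F) \<in> XE_star X b F D" for x y
    using bond_XE_star[OF that(3) assms] tilde_bond[OF that(1) assms(1-3)] tilde_bond[OF that(2) assms(1-3)]
    by simp
  then show ?thesis by (auto simp: tilde_star_def)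
qed

lemma tilde_star_mono: "F \<subseteq> G \<Longrightarrow> tilde_star E F \<subseteq> tilde_star E G"
  using XE_star_mono unfolding tilde_star_def by blast

text \<open>One parameter suffices to describe the uniform structure, because the bonding maps send \<open>F\<^sup>*\<close> in
  stage \<open>F\<close> into \<open>F\<^sup>*\<close> in every coarser stage.\<close>

lemma eventually_tilde:
  "(\<forall>\<^sub>F q in unif T. P q) \<longleftrightarrow> (\<exists>E. entourage X E \<and> (\<forall>q\<in>tilde_star E E. P q))"
proof
  assume "\<forall>\<^sub>F q in unif T. P q"
  then obtain E D where E: "entourage X E" and D: "entourage (XE X b E) D"
    and P: "\<forall>x\<in>points T. \<forall>y\<in>points T. (x E, y E) \<in> D \<longrightarrow> P (x, y)"
    unfolding stages.eventually_inv_limit[unfolded stages_tilde] by auto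
  have "\<forall>\<^sub>F q in unif (XE X b E). q \<in> D" using D by (simp add: entourage_def)
  then obtain F where F: "entourage X F" "F \<subseteq> E" "\<forall>q\<in>XE_star X b E F. q \<in> D"
    unfolding eventually_XE[OF E] by (elim exE conjE)
  have "tilde_star F F \<subseteq> tilde_star E F" using tilde_star_bond E F by simp
  then have "\<forall>q\<in>tilde_star F F. P q" using P F(3) by (fastforce simp: tilde_star_def)
  with F(1) show "\<exists>E. entourage X E \<and> (\<forall>q\<in>tilde_star E E. P q)" by (intro exI[of _ F] conjI)
next
  assume "\<exists>E. entourage X E \<and> (\<forall>q\<in>tilde_star E E. P q)"
  then obtain E where E: "entourage X E" "\<forall>q\<in>tilde_star E E. P q" by (elim exE conjE)
  have "\<forall>\<^sub>F q in unif T. q \<in> tilde_star E E" using entourage_tilde_star[OF E(1) E(1)] by (simp add: entourage_def)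
  then show "\<forall>\<^sub>F q in unif T. P q" by (rule eventually_mono) (use E(2) in auto)
qed

lemma tilde_star_basis:
  assumes "entourage T D" obtains E where "entourage X E" "tilde_star E E \<subseteq> D"
  using assms eventually_tilde[of "\<lambda>q. q \<in> D"] unfolding entourage_def by auto

lemma tilde_star_points: "(x, y) \<in> tilde_star E G \<Longrightarrow> x \<in> points T \<and> y \<in> points T"
  by (simp add: tilde_star_def)

lemma tilde_star_proj: "(x, y) \<in> tilde_star E G \<Longrightarrow> entourage X E \<Longrightarrow> (proj x, proj y) \<in> G"
  using XE_star_class_end tilde_proj by (fastforce simp: tilde_star_def)

lemma tilde_star_step:
  assumes xy: "(x, y) \<in> tilde_star E G" and E: "entourage X E" "G \<subseteq> E"
    and \<alpha>: "is_chain X E \<alpha>" "hd \<alpha> = b" "x E = chain_class X E \<alpha>"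
  shows "y E = chain_class X E (\<alpha> @ [proj y])" "is_chain X E (\<alpha> @ [proj y])"
proof -
  have "y \<in> points T" using xy tilde_star_points by blast
  then obtain \<beta> where \<beta>: "is_chain X E \<beta>" "hd \<beta> = b" "y E = chain_class X E \<beta>" "last \<beta> = proj y"
    using E(1) by (rule tilde_cases)
  have "chain_homotopic X E \<beta> (\<alpha> @ [proj y])"
    using xy XE_star_iff[OF E \<alpha>(1,2) \<beta>(1,2)] \<alpha>(3) \<beta>(3,4) by (simp add: tilde_star_def)
  then show "y E = chain_class X E (\<alpha> @ [proj y])" "is_chain X E (\<alpha> @ [proj y])"
    using \<beta>(1,3) chain_homotopic_ends(3)[of X E \<beta> "\<alpha> @ [proj y]"] by (simp_all add: chain_class_eq_iff)
qed

lemma tilde_starI: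
  assumes "x \<in> points T" "y \<in> points T" "entourage X E" "G \<subseteq> E" "(proj x, proj y) \<in> G"
    and "is_chain X E \<alpha>" "hd \<alpha> = b" "x E = chain_class X E \<alpha>" "y E = chain_class X E (\<alpha> @ [proj y])"
  shows "(x, y) \<in> tilde_star E G"
proof -
  have "last \<alpha> = proj x" using tilde_proj[OF assms(1,3)] assms(8) by simp
  then show ?thesis using XE_star_intro(1)[of E G \<alpha> "proj y"] assms by (simp add: tilde_star_def)
qed

lemma group_inverse_system_pi_E:
  "group_inverse_system (entourages X) (finer X) (pi_E X b) (\<lambda>E F. bond_XE X E)"
  unfolding group_inverse_system_def
proof (intro conjI allI impI ballI)
  fix E F D g assume "(E, F) \<in> finer X \<and> (F, D) \<in> finer X" "g \<in> carrier (pi_E X b D)"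
  then show "bond_XE X E g = bond_XE X E (bond_XE X F g)"
    using bond_XE_trans[of F E D g] by (simp add: finer_iff carrier_pi_E)
next
  fix q assume "q \<in> finer X"
  then show "case q of (E, F) \<Rightarrow> bond_XE X E \<in> hom (pi_E X b F) (pi_E X b E)"
    using bond_hom by (cases q) (simp add: finer_iff)
qed (use directed_finer group_pi_E bond_XE_refl in \<open>auto simp: carrier_pi_E\<close>)

lemma group_pi_U: "group (pi_U X b)"
  unfolding pi_U_def by (rule group_inv_limit) (rule group_inverse_system_pi_E)

text \<open>Elements of the limit group are themselves points of the limit of the spaces \<open>X\<^sub>E\<close>, so that
  facts about coordinates and endpoints apply to them as well.\<close>

lemma carrier_pi_U: "carrier (pi_U X b) = {g \<in> points T. proj g = b}"
proof -
  have "g \<in> carrier (pi_U X b) \<longleftrightarrow> g \<in> points T \<and> (\<forall>E. entourage X E \<longrightarrow> class_end (g E) = b)" for g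
    by (auto simp: pi_U_def inv_limit_group_def points_tilde inv_limit_points_def PiE_iff carrier_pi_E)
  moreover have "(\<forall>E. entourage X E \<longrightarrow> class_end (g E) = b) \<longleftrightarrow> proj g = b" if "g \<in> points T" for g
    using tilde_proj[OF that] ex_entourage by metis
  ultimately show ?thesis by auto
qed

lemma pi_U_coord: "g \<in> carrier (pi_U X b) \<Longrightarrow> entourage X E \<Longrightarrow> g E \<in> carrier (pi_E X b E)"
  using tilde_closed tilde_proj[symmetric] by (simp add: carrier_pi_U carrier_pi_E)

lemma one_pi_U: "\<one>\<^bsub>pi_U X b\<^esub> = tilde_base X b"
  by (simp add: pi_U_def inv_limit_group_def tilde_base_def)

lemma mult_pi_U: "g \<otimes>\<^bsub>pi_U X b\<^esub> h = (\<lambda>E\<in>entourages X. class_concat X E (g E) (h E))"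
  by (simp add: pi_U_def inv_limit_group_def)

lemma pi_U_action_eq:
  assumes "x \<in> points T"
  shows "pi_U_action X b g x = (\<lambda>E\<in>entourages X. class_concat X E (g E) (x E))"
  using assms tilde_closed by (auto simp: pi_U_action_def pi_E_action_def intro!: restrict_ext)

lemma pi_U_action_closed:
  assumes g: "g \<in> carrier (pi_U X b)" and x: "x \<in> points T"
  shows "pi_U_action X b g x \<in> points T" "proj (pi_U_action X b g x) = proj x"
proof -
  note c = concat_closed[OF pi_U_coord[OF g] tilde_closed[OF x]]
  show *: "pi_U_action X b g x \<in> points T"
    unfolding pi_U_action_eq[OF x]
  proof (rule tildeI)
    fix E F assume EF: "entourage X E" "entourage X F" "F \<subseteq> E"
    then show "bond_XE X E ((\<lambda>E\<in>entourages X. class_concat X E (g E) (x E)) F) =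
      (\<lambda>E\<in>entourages X. class_concat X E (g E) (x E)) E"
      using bond_concat[OF EF(3) pi_U_coord[OF g EF(2)] tilde_closed[OF x EF(2)]]
        tilde_bond[OF x EF] tilde_bond[OF _ EF, of g] g by (simp add: carrier_pi_U)
  qed (use c in simp_all)
  obtain E where E: "entourage X E" using ex_entourage by blast
  show "proj (pi_U_action X b g x) = proj x"
    using c(2)[OF E E] tilde_proj[OF * E] tilde_proj[OF x E] pi_U_action_eq[OF x] E by simp
qed

lemma group_action_pi_U: "group_action (pi_U X b) (points T) (pi_U_action X b)"
proof (rule group_actionI[OF group_pi_U])
  fix x assume x: "x \<in> points T"
  show "pi_U_action X b \<one>\<^bsub>pi_U X b\<^esub> x = x"
  proof (rule tilde_eqI)
    show "pi_U_action X b \<one>\<^bsub>pi_U X b\<^esub> x \<in> points T"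
      by (rule pi_U_action_closed) (use x group_pi_U in \<open>auto simp: group.is_monoid\<close>)
    fix E assume "entourage X E"
    then show "pi_U_action X b \<one>\<^bsub>pi_U X b\<^esub> x E = x E"
      using concat_one[OF tilde_closed[OF x]] pi_U_action_eq[OF x] by (simp add: one_pi_U tilde_base_def)
  qed (rule x)
next
  fix g h x assume g: "g \<in> carrier (pi_U X b)" and h: "h \<in> carrier (pi_U X b)" and x: "x \<in> points T"
  show "pi_U_action X b (g \<otimes>\<^bsub>pi_U X b\<^esub> h) x = pi_U_action X b g (pi_U_action X b h x)"
  proof (rule tilde_eqI)
    show "pi_U_action X b (g \<otimes>\<^bsub>pi_U X b\<^esub> h) x \<in> points T"
      by (rule pi_U_action_closed) (use g h x group_pi_U in \<open>auto simp: group.is_monoid monoid.m_closed\<close>)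
    show "pi_U_action X b g (pi_U_action X b h x) \<in> points T"
      by (intro pi_U_action_closed g h x)
    fix E assume E: "entourage X E"
    then show "pi_U_action X b (g \<otimes>\<^bsub>pi_U X b\<^esub> h) x E = pi_U_action X b g (pi_U_action X b h x) E"
      using concat_assoc[OF pi_U_coord[OF g E] pi_U_coord[OF h E] tilde_closed[OF x E]]
        pi_U_action_eq[OF x] pi_U_action_eq[OF pi_U_action_closed(1)[OF h x]] by (simp add: mult_pi_U)
  qed
next
  fix g show "pi_U_action X b g \<in> extensional (points T)" by (simp add: pi_U_action_def)
qed (rule pi_U_action_closed)

text \<open>Two points over the same point of \<open>X\<close> differ by the coordinatewise difference, because taking
  differences is compatible with the bonding maps.\<close>

lemma pi_U_transitive_on_fibre:
  assumes x: "x \<in> points T" and y: "y \<in> points T" and eq: "proj x = proj y"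
  obtains g where "g \<in> carrier (pi_U X b)" "pi_U_action X b g x = y"
proof -
  define g where "g = (\<lambda>E\<in>entourages X. class_diff E (y E) (x E))"
  have end_eq: "class_end (x E) = class_end (y E)" if "entourage X E" for E
    using eq tilde_proj[OF x that] tilde_proj[OF y that] by simp
  note d = class_diff[OF _ tilde_closed[OF x] tilde_closed[OF y] end_eq]
  have gT: "g \<in> points T"
  proof (rule tildeI)
    fix E F assume EF: "entourage X E" "entourage X F" "F \<subseteq> E"
    show "bond_XE X E (g F) = g E"
      using bond_class_diff[OF EF(3,1,2) tilde_closed[OF x EF(2)] tilde_closed[OF y EF(2)] end_eq[OF EF(2)]]
        tilde_bond[OF x EF] tilde_bond[OF y EF] EF by (simp add: g_def)
  qed (use d(1) in \<open>auto simp: g_def carrier_pi_E\<close>)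
  obtain E where E: "entourage X E" using ex_entourage by blast
  have "proj g = b" using d(1)[OF E E E E] tilde_proj[OF gT E] E by (simp add: g_def carrier_pi_E)
  then have g: "g \<in> carrier (pi_U X b)" using gT by (simp add: carrier_pi_U)
  have "pi_U_action X b g x = y"
    by (rule tilde_eqI[OF pi_U_action_closed(1)[OF g x] y])
      (use pi_U_action_eq[OF x] d(2) in \<open>simp add: g_def\<close>)
  with g show thesis by (rule that)
qed

lemma fibre_eq_orbit:
  assumes x: "x \<in> points T"
  shows "{z \<in> points T. proj z = proj x} = orbit (pi_U X b) (pi_U_action X b) x"
  using pi_U_action_closed[OF _ x] pi_U_transitive_on_fibre[OF x]
  unfolding orbit_def by (auto, metis)

end


section \<open>Lifting along fine chains\<close>

lemma weakly_F_chainedD: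
  assumes "weakly_F_chained X F E" shows "entourage X E" "entourage X F" "F \<subseteq> E"
  using assms by (simp_all add: weakly_F_chained_def)

text \<open>Step by step, every edge of a chain is replaced by a finer chain.\<close>

lemma weakly_F_chained_refine:
  assumes F: "weakly_F_chained X F E" and D: "entourage X D" "D \<subseteq> E" and \<alpha>: "is_chain X F \<alpha>"
  shows "\<exists>\<beta>. is_chain X D \<beta> \<and> hd \<beta> = hd \<alpha> \<and> last \<beta> = last \<alpha> \<and> chain_homotopic X E \<alpha> \<beta>"
  using is_chain_nonempty[OF \<alpha>] \<alpha>
proof (induction \<alpha> rule: rev_nonempty_induct)
  case (single x)
  then show ?case by (intro exI[of _ "[x]"]) simp
next
  case (snoc x \<alpha>)
  then have ch: "is_chain X F \<alpha>" "x \<in> points X" "(last \<alpha>, x) \<in> F" by (auto simp: is_chain_snoc)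
  obtain \<beta> where \<beta>: "is_chain X D \<beta>" "hd \<beta> = hd \<alpha>" "last \<beta> = last \<alpha>" "chain_homotopic X E \<alpha> \<beta>"
    using snoc.IH[OF ch(1)] by blast
  obtain \<gamma> where \<gamma>: "is_chain X D \<gamma>" "hd \<gamma> = last \<alpha>" "last \<gamma> = x"
    "chain_class X E \<gamma> = chain_class X E [last \<alpha>, x]"
    using F ch(3) D unfolding weakly_F_chained_def by blast
  have FE: "F \<subseteq> E" using F by (simp add: weakly_F_chained_def)
  have "last \<beta> = hd \<gamma>" using \<beta> \<gamma> by simp
  note c = is_chain_concat[OF \<beta>(1) \<gamma>(1) this]
  have "is_chain X E [last \<alpha>, x]" using ch FE is_chain_ends(2)[OF ch(1)] by (auto simp: is_chain_Cons)
  then have "chain_homotopic X E (\<alpha> @ tl [last \<alpha>, x]) (\<beta> @ tl \<gamma>)"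
    using \<gamma>(4) \<beta>(4) is_chain_mono[OF ch(1) FE]
    by (intro chain_homotopic_concat) (auto simp: chain_class_eq_iff chain_homotopic_sym)
  then show ?case
    using c \<beta> \<gamma> snoc(1) by (intro exI[of _ "\<beta> @ tl \<gamma>"]) simp
qed

locale weakly_chained_metrizable = pointed_uspace +
  assumes weakly_chained: "weakly_chained X" and metrizable: "metrizable_uniform X"
begin

lemma weakly_chained_basis:
  assumes "entourage X D" obtains E F where "weakly_F_chained X F E" "E \<subseteq> D"
proof -
  obtain \<B> where \<B>: "uniform_basis X \<B>" "\<forall>E\<in>\<B>. weakly_chained_entourage X E"
    using weakly_chained unfolding weakly_chained_def by blast
  obtain E where "E \<in> \<B>" "E \<subseteq> D" using \<B>(1) assms unfolding uniform_basis_def by blast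
  then show thesis using \<B>(2) that unfolding weakly_chained_entourage_def by blast
qed

lemma countable_entourage_basis:
  obtains D :: "nat \<Rightarrow> ('a \<times> 'a) set"
  where "\<And>n. entourage X (D n)" "\<And>E. entourage X E \<Longrightarrow> \<exists>n. D n \<subseteq> E"
proof -
  obtain d where d: "Metric_space (points X) d"
    and U: "unif X = (INF e\<in>{0<..}. principal {(x, y) \<in> points X \<times> points X. d x y < e})"
    using metrizable unfolding metrizable_uniform_def by (elim exE conjE)
  define B where "B e = {(x, y) \<in> points X \<times> points X. d x y < e}" for e
  have ev: "(\<forall>\<^sub>F q in unif X. P q) \<longleftrightarrow> (\<exists>e>0. \<forall>q\<in>B e. P q)" for P
  proof -
    have "\<exists>x\<in>{0<..}. principal (B x) \<le> inf (principal (B e)) (principal (B e'))"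
      if "e \<in> {0<..}" "e' \<in> {0<..}" for e e'
      using that by (intro bexI[of _ "min e e'"]) (auto simp: B_def)
    then show ?thesis
      unfolding U B_def[symmetric] by (subst eventually_INF_base) (auto simp: eventually_principal)
  qed
  show thesis
  proof (rule that[of "\<lambda>n. B (inverse (real (Suc n)))"])
    fix n
    show "entourage X (B (inverse (real (Suc n))))"
      unfolding entourage_def ev
      using Metric_space.commute[OF d]
      by (intro conjI exI[of _ "inverse (real (Suc n))"]) (auto simp: B_def sym_def)
  next
    fix E assume "entourage X E"
    then obtain e where e: "e > 0" "\<forall>q\<in>B e. q \<in> E" unfolding entourage_def ev by (elim exE conjE)
    obtain n where "inverse (real (Suc n)) < e" using reals_Archimedean[OF e(1)] by blast
    then have "B (inverse (real (Suc n))) \<subseteq> B e" by (auto simp: B_def)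
    then show "\<exists>n. B (inverse (real (Suc n))) \<subseteq> E" using e(2) by blast
  qed
qed

text \<open>This is where metrizability enters: along a sequence of ever finer weakly chained entourages
  the given chain is refined again and again, and since each refinement preserves the class at the
  previous level, the chains obtained define a point of the limit.\<close>

lemma lift_fine_chain:
  assumes wf: "weakly_F_chained X F E" and \<alpha>: "is_chain X F \<alpha>" "hd \<alpha> = b"
  obtains x where "x \<in> points T" "x E = chain_class X E \<alpha>"
proof -
  obtain D where D: "\<And>n. entourage X (D n)" "\<And>E. entourage X E \<Longrightarrow> \<exists>n::nat. D n \<subseteq> E"
    using countable_entourage_basis by metis
  (* Stage n is a triple: an entourage E', an entourage F' for which E' is weakly F'-chained, and an
     F'-chain. Placing the next entourage inside F' allows the chain to be refined again. *)
  define P where "P n t \<longleftrightarrow> (case t of (E', F', \<alpha>') \<Rightarrow>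
    weakly_F_chained X F' E' \<and> is_chain X F' \<alpha>' \<and> hd \<alpha>' = b \<and> (n = 0 \<longrightarrow> t = (E, F, \<alpha>)))"
    for n :: nat and t :: "('a \<times> 'a) set \<times> ('a \<times> 'a) set \<times> 'a list"
  define Q where "Q n t t' \<longleftrightarrow> (case t of (E', F', \<alpha>') \<Rightarrow> case t' of (E'', F'', \<alpha>'') \<Rightarrow>
    E'' \<subseteq> F' \<and> E'' \<subseteq> D n \<and> chain_homotopic X E' \<alpha>' \<alpha>'')"
    for n and t t' :: "('a \<times> 'a) set \<times> ('a \<times> 'a) set \<times> 'a list"
  have "\<exists>f. \<forall>n. P n (f n) \<and> Q n (f n) (f (Suc n))"
  proof (rule dependent_nat_choice)
    show "\<exists>t. P 0 t" using wf \<alpha> by (intro exI[of _ "(E, F, \<alpha>)"]) (simp add: P_def)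
  next
    fix t n assume t: "P n t"
    obtain E' F' \<alpha>' where t': "t = (E', F', \<alpha>')" by (cases t)
    have w: "weakly_F_chained X F' E'" "is_chain X F' \<alpha>'" "hd \<alpha>' = b" using t t' by (auto simp: P_def)
    obtain E'' F'' where w': "weakly_F_chained X F'' E''" "E'' \<subseteq> F' \<inter> D n"
      using weakly_chained_basis entourage_Int[OF weakly_F_chainedD(2)[OF w(1)] D(1)] by metis
    have "F'' \<subseteq> E'" using weakly_F_chainedD(3)[OF w(1)] weakly_F_chainedD(3)[OF w'(1)] w'(2) by blast
    then obtain \<alpha>'' where "is_chain X F'' \<alpha>''" "hd \<alpha>'' = hd \<alpha>'" "chain_homotopic X E' \<alpha>' \<alpha>''"
      using weakly_F_chained_refine[OF w(1) weakly_F_chainedD(2)[OF w'(1)] _ w(2)] by blast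
    then show "\<exists>t'. P (Suc n) t' \<and> Q n t t'"
      using w' w t' by (intro exI[of _ "(E'', F'', \<alpha>'')"]) (auto simp: P_def Q_def)
  qed
  then obtain f where f: "\<And>n. P n (f n)" "\<And>n. Q n (f n) (f (Suc n))" by blast
  define e g c where "e n = fst (f n)" and "g n = fst (snd (f n))" and "c n = snd (snd (f n))" for n
  have feq: "f n = (e n, g n, c n)" for n by (simp add: e_def g_def c_def)
  have w: "weakly_F_chained X (g n) (e n)" "is_chain X (g n) (c n)" "hd (c n) = b" for n
    using f(1)[of n] by (simp_all add: P_def feq)
  have z: "e 0 = E" "c 0 = \<alpha>" using f(1)[of 0] by (simp_all add: P_def feq)
  have s: "e (Suc n) \<subseteq> g n" "e (Suc n) \<subseteq> D n" "chain_homotopic X (e n) (c n) (c (Suc n))" for n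
    using f(2)[of n] by (simp_all add: Q_def feq)
  have mono: "e m \<subseteq> e n" if "n \<le> m" for m n
    using that
  proof (induction m rule: dec_induct)
    case (step k) then show ?case using s(1)[of k] weakly_F_chainedD(3)[OF w(1)[of k]] by blast
  qed simp
  have cof: "\<exists>n. e n \<subseteq> G" if "entourage X G" for G
    using D(2)[OF that] s(2) by (meson subset_trans)
  have stable: "chain_class X G (c m) = chain_class X G (c n)" if "e n \<subseteq> G" "n \<le> m" for G n m
    using that(2)
  proof (induction m rule: dec_induct)
    case (step k)
    have "e k \<subseteq> G" using mono[OF step(1)] that(1) by blast
    then have "chain_homotopic X G (c k) (c (Suc k))" using chain_homotopic_mono[OF s(3)] by blast
    then show ?case using step.IH chain_class_eq_iff by metis
  qed simp
  define N where "N G = (LEAST n. e n \<subseteq> G)" for G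
  have N: "e (N G) \<subseteq> G" if "entourage X G" for G
    unfolding N_def using cof[OF that] by (rule LeastI_ex)
  define x where "x = (\<lambda>G\<in>entourages X. chain_class X G (c (N G)))"
  have x: "x G = chain_class X G (c n)" if "entourage X G" "e n \<subseteq> G" for G n
    using stable[OF that(2), of "max n (N G)"] stable[OF N[OF that(1)], of "max n (N G)"] that(1)
    by (simp add: x_def)
  have cG: "is_chain X G (c n)" if "e n \<subseteq> G" for G n
    using is_chain_mono[OF w(2)[of n]] weakly_F_chainedD(3)[OF w(1)[of n]] that by blast
  show thesis
  proof (rule that)
    show "x \<in> points T"
    proof (rule tildeI)
      fix G assume G: "entourage X G"
      show "x G \<in> points (XE X b G)"
        using x[OF G N[OF G]] points_XE_I[OF cG[OF N[OF G]] w(3)] by simp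
    next
      fix G H assume G: "entourage X G" "entourage X H" "H \<subseteq> G"
      have "e (N H) \<subseteq> G" using N[OF G(2)] G(3) by blast
      then show "bond_XE X G (x H) = x G"
        using x[OF G(2) N[OF G(2)]] x[OF G(1)] bond_chain_class[OF G(3)] by simp
    qed (simp add: x_def)
    show "x E = chain_class X E \<alpha>" using x[of E 0] z weakly_F_chainedD(1)[OF wf] by simp
  qed
qed

lemma lift_step:
  assumes wf: "weakly_F_chained X F E" and x: "x \<in> points T" and z: "(proj x, z) \<in> F" "(proj x, z) \<in> G"
    and G: "G \<subseteq> E"
  obtains w where "w \<in> points T" "proj w = z" "(x, w) \<in> tilde_star E G"
proof -
  note w = weakly_F_chainedD[OF wf]
  obtain \<alpha> where \<alpha>: "is_chain X F \<alpha>" "hd \<alpha> = b" "x F = chain_class X F \<alpha>" "last \<alpha> = proj x"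
    using tilde_cases[OF x w(2)] .
  have ne: "\<alpha> \<noteq> []" using \<alpha>(1) is_chain_nonempty by blast
  have "is_chain X F (\<alpha> @ [z])" using \<alpha> ne z(1) entourage_points[OF w(2) z(1)] by (simp add: is_chain_snoc)
  moreover have "hd (\<alpha> @ [z]) = b" using \<alpha>(2) ne by simp
  ultimately obtain y where y: "y \<in> points T" "y E = chain_class X E (\<alpha> @ [z])"
    by (rule lift_fine_chain[OF wf])
  have p: "proj y = z" using tilde_proj[OF y(1) w(1)] y(2) by simp
  have "(x, y) \<in> tilde_star E G"
    using tilde_chain_class_mono[OF x w(1,2,3) \<alpha>(3)] y p z(2) is_chain_mono[OF \<alpha>(1) w(3)] \<alpha>(2)
    by (intro tilde_starI[OF x y(1) w(1) G, of \<alpha>]) simp_all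
  with y(1) p show thesis by (rule that)
qed

lemma proj_surj: "proj ` points T = points X"
proof (intro equalityI subsetI)
  fix z assume z: "z \<in> points X"
  obtain D where "entourage X D" using ex_entourage by blast
  then obtain E F where wf: "weakly_F_chained X F E" by (rule weakly_chained_basis)
  obtain \<alpha> where \<alpha>: "is_chain X F \<alpha>" "hd \<alpha> = b" "last \<alpha> = z"
    using weakly_chained z base weakly_F_chainedD(2)[OF wf]
    unfolding weakly_chained_def chain_connected_def by blast
  obtain x where x: "x \<in> points T" "x E = chain_class X E \<alpha>" using lift_fine_chain[OF wf \<alpha>(1,2)] .
  then have "proj x = z" using tilde_proj[OF x(1) weakly_F_chainedD(1)[OF wf]] \<alpha>(3) by simp
  then show "z \<in> proj ` points T" using x(1) by blast
qed (use tilde_proj_points in auto)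

end


section \<open>The limit is uniformly simply connected\<close>

context pointed_uspace
begin

sublocale limit: hausdorff_uspace T
  by unfold_locales (rule hausdorff_tilde)

lemma tilde_star_trans:
  assumes "(x, y) \<in> tilde_star E G" "(y, z) \<in> tilde_star E G" "(proj x, proj z) \<in> G"
    and E: "entourage X E" "G \<subseteq> E"
  shows "(x, z) \<in> tilde_star E G"
proof -
  have p: "x \<in> points T" "z \<in> points T" using assms(1,2) tilde_star_points by blast+
  have 1: "(x E, y E) \<in> XE_star X b E G" "(y E, z E) \<in> XE_star X b E G"
    using assms(1,2) by (simp_all add: tilde_star_def)
  have 2: "(class_end (x E), class_end (z E)) \<in> G"
    using assms(3) tilde_proj[OF p(1) E(1)] tilde_proj[OF p(2) E(1)] by simp
  have "(x E, z E) \<in> XE_star X b E G" by (rule XE_star_trans[OF E(1) E(2) E(2) E(2) 1 2])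
  with p show ?thesis by (simp add: tilde_star_def)
qed

lemma tilde_star_same_coord:
  assumes "z \<in> points T" "w \<in> points T" "z E = w E" "entourage X E" "entourage X G" "G \<subseteq> E"
  shows "(z, w) \<in> tilde_star E G"
    and "(v, z) \<in> tilde_star E G \<Longrightarrow> (v, w) \<in> tilde_star E G"
    and "(z, v) \<in> tilde_star E G \<Longrightarrow> (w, v) \<in> tilde_star E G"
  using assms XE_star_refl[OF assms(4-6) tilde_closed[OF assms(2,4)]] by (auto simp: tilde_star_def)

lemma is_chain_proj:
  assumes "is_chain T (tilde_star E G) zs" "entourage X E"
  shows "is_chain X G (map proj zs)"
  using assms tilde_proj_points tilde_star_proj
  unfolding is_chain_def by (auto simp: successively_map elim!: successively_mono)

text \<open>A class that is close to a given one in stage \<open>E\<close> is determined by its endpoint. Hence the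
  coordinates along a chain of the limit depend only on the first of them and on the projection.\<close>

lemma tilde_chain_coord:
  assumes zs: "is_chain T (tilde_star E G) zs" and E: "entourage X E" "G \<subseteq> E"
    and \<alpha>: "is_chain X E \<alpha>" "hd \<alpha> = b" "hd zs E = chain_class X E \<alpha>"
  shows "last zs E = chain_class X E (\<alpha> @ map proj (tl zs)) \<and> is_chain X E (\<alpha> @ map proj (tl zs))"
  using is_chain_nonempty[OF zs] zs \<alpha>(3)
proof (induction zs rule: rev_nonempty_induct)
  case (single z) then show ?case using \<alpha> by simp
next
  case (snoc z zs)
  have ne: "\<alpha> \<noteq> []" using \<alpha>(1) is_chain_nonempty by blast
  have ch: "is_chain T (tilde_star E G) zs" "(last zs, z) \<in> tilde_star E G"
    using snoc(1,3) by (auto simp: is_chain_snoc)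
  have IH: "last zs E = chain_class X E (\<alpha> @ map proj (tl zs))" "is_chain X E (\<alpha> @ map proj (tl zs))"
    using snoc.IH ch(1) snoc(1,4) by auto
  show ?case
    using tilde_star_step[OF ch(2) E IH(2) _ IH(1)] \<alpha>(2) ne snoc(1) by simp
qed

lemma tilde_chain_coords_unique:
  assumes "is_chain T (tilde_star E G) zs" "is_chain T (tilde_star E G) zs'"
    and E: "entourage X E" "G \<subseteq> E" and "map proj zs = map proj zs'" "hd zs E = hd zs' E"
  shows "list_all2 (\<lambda>z w. z \<in> points T \<and> w \<in> points T \<and> z E = w E) zs zs'"
  using assms(1,2,5,6)
proof (induction zs arbitrary: zs')
  case Nil then show ?case by (simp add: is_chain_def)
next
  case (Cons z zs)
  then obtain w ws where zs': "zs' = w # ws" by (cases zs') auto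
  have zw: "z \<in> points T" "w \<in> points T" "z E = w E"
    using Cons.prems is_chain_ends(1) zs' by force+
  have "list_all2 (\<lambda>z w. z \<in> points T \<and> w \<in> points T \<and> z E = w E) zs ws"
  proof (cases "zs = []")
    case True then show ?thesis using Cons.prems(3) zs' by simp
  next
    case False
    then have ne: "ws \<noteq> []" using Cons.prems(3) zs' by auto
    have ch: "is_chain T (tilde_star E G) zs" "(z, hd zs) \<in> tilde_star E G"
      "is_chain T (tilde_star E G) ws" "(w, hd ws) \<in> tilde_star E G"
      using Cons.prems(1,2) zs' False ne by (auto simp: is_chain_Cons)
    obtain \<alpha> where \<alpha>: "is_chain X E \<alpha>" "hd \<alpha> = b" "z E = chain_class X E \<alpha>" "last \<alpha> = proj z"
      using tilde_cases[OF zw(1) E(1)] .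
    have "proj (hd zs) = proj (hd ws)"
      using Cons.prems(3) zs' False ne by (cases zs; cases ws) auto
    then have "hd zs E = hd ws E"
      using tilde_star_step(1)[OF ch(2) E \<alpha>(1-3)] tilde_star_step(1)[OF ch(4) E \<alpha>(1,2)] zw(3) \<alpha>(3) by simp
    then show ?thesis using Cons.IH[OF ch(1,3)] Cons.prems(3) zs' by simp
  qed
  with zw show ?case by (simp add: zs')
qed

text \<open>Points with the same coordinate in stage \<open>E\<close> have the same neighbours, so that they can be
  exchanged for each other one at a time.\<close>

lemma chain_homotopic_exchange:
  assumes E: "entourage X E" "entourage X G" "G \<subseteq> E"
    and "list_all2 (\<lambda>z w. z \<in> points T \<and> w \<in> points T \<and> z E = w E) zs zs'"
    and "u \<noteq> []" "v \<noteq> []" "is_chain T (tilde_star E G) (u @ zs @ v)"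
  shows "chain_homotopic T (tilde_star E G) (u @ zs @ v) (u @ zs' @ v)"
  using assms(4,5,7)
proof (induction arbitrary: u rule: list_all2_induct)
  case Nil then show ?case by simp
next
  case (Cons z zs w zs')
  let ?M = "tilde_star E G"
  have zw: "z \<in> points T" "w \<in> points T" "z E = w E" using Cons.hyps by auto
  note sc = tilde_star_same_coord[OF zw E]
  let ?q = "zs @ v"
  have q: "?q \<noteq> []" using assms(6) by simp
  have ch: "is_chain T ?M (u @ [z] @ ?q)" using Cons.prems(2) by simp
  then have parts: "is_chain T ?M u" "(last u, z) \<in> ?M" "is_chain T ?M ?q" "(z, hd ?q) \<in> ?M"
    using Cons.prems(1) q by (simp_all add: is_chain_append is_chain_Cons)
  have ch2: "is_chain T ?M ((u @ [z]) @ [w] @ ?q)" "is_chain T ?M (u @ [w] @ ?q)"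
    using parts Cons.prems(1) q zw sc by (simp_all add: is_chain_append is_chain_Cons)
  have "chain_homotopic T ?M (u @ [z] @ ?q) (u @ [z] @ [w] @ ?q)"
    using ch ch2 q chain_homotopic_insert[of T ?M "u @ [z]" ?q w] by simp
  also have "chain_homotopic T ?M (u @ [z] @ [w] @ ?q) (u @ [w] @ ?q)"
    using ch2 Cons.prems(1) chain_homotopic_sym[OF chain_homotopic_insert[of T ?M u "[w] @ ?q" z]] by simp
  finally have "chain_homotopic T ?M (u @ [z] @ ?q) (u @ [w] @ ?q)" .
  moreover have "chain_homotopic T ?M ((u @ [w]) @ zs @ v) ((u @ [w]) @ zs' @ v)"
    using ch2(2) by (intro Cons.IH) simp_all
  ultimately show ?case
    using chain_homotopic_trans[of T ?M "u @ [z] @ ?q" "u @ [w] @ ?q"] by simp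
qed

end

context weakly_chained_metrizable
begin

lemma lift_chain:
  assumes wf: "weakly_F_chained X F E" and x: "x \<in> points T" and \<gamma>: "is_chain X F \<gamma>" "hd \<gamma> = proj x"
  shows "\<exists>zs. is_chain T (tilde_star E F) zs \<and> hd zs = x \<and> map proj zs = \<gamma>"
  using is_chain_nonempty[OF \<gamma>(1)] \<gamma>
proof (induction \<gamma> rule: rev_nonempty_induct)
  case (single z) then show ?case using x by (intro exI[of _ "[x]"]) simp
next
  case (snoc z \<gamma>)
  then have ch: "is_chain X F \<gamma>" "(last \<gamma>, z) \<in> F" "hd \<gamma> = proj x" by (auto simp: is_chain_snoc)
  obtain zs where zs: "is_chain T (tilde_star E F) zs" "hd zs = x" "map proj zs = \<gamma>"
    using snoc.IH ch by blast
  have ne: "zs \<noteq> []" using zs(1) is_chain_nonempty by blast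
  have l: "last zs \<in> points T" "(proj (last zs), z) \<in> F"
    using is_chain_ends(2)[OF zs(1)] ch(2) zs(3) ne by (auto simp: last_map)
  obtain w where "w \<in> points T" "proj w = z" "(last zs, w) \<in> tilde_star E F"
    using lift_step[OF wf l(1) l(2) l(2) weakly_F_chainedD(3)[OF wf]] .
  then show ?case using zs ne by (intro exI[of _ "zs @ [w]"]) (simp add: is_chain_snoc)
qed

text \<open>Moves lift: an inserted point \<open>p\<close> is lifted along the edge from its predecessor, which is
  possible since \<open>G \<subseteq> F\<close>, and the lift is close to the successor because the triangle is \<open>E\<close>-small.\<close>

lemma lift_insert:
  assumes wf: "weakly_F_chained X F E" and G: "entourage X G" "G \<subseteq> F"
    and zs: "is_chain T (tilde_star E G) (zu @ zv)" "zu \<noteq> []" "zv \<noteq> []"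
    and p: "is_chain X G (map proj zu @ [p] @ map proj zv)"
  obtains w where "is_chain T (tilde_star E G) (zu @ [w] @ zv)" "proj w = p"
proof -
  note w = weakly_F_chainedD[OF wf]
  have GE: "G \<subseteq> E" using G(2) w(3) by blast
  have ch: "is_chain T (tilde_star E G) zu" "is_chain T (tilde_star E G) zv" "(last zu, hd zv) \<in> tilde_star E G"
    using zs by (simp_all add: is_chain_append)
  have pe: "(proj (last zu), p) \<in> G" "(p, proj (hd zv)) \<in> G"
    using p zs(2,3) by (simp_all add: is_chain_append is_chain_Cons last_map hd_map)
  have pF: "(proj (last zu), p) \<in> F" using pe(1) G(2) by blast
  obtain w where w: "w \<in> points T" "proj w = p" "(last zu, w) \<in> tilde_star E G"
    using lift_step[OF wf is_chain_ends(2)[OF ch(1)] pF pe(1) GE] .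
  have "(w, last zu) \<in> tilde_star E G"
    using limit.entourage_sym[OF entourage_tilde_star[OF weakly_F_chainedD(1)[OF wf] G(1) GE] w(3)] .
  then have "(w, hd zv) \<in> tilde_star E G"
    using tilde_star_trans ch(3) pe(2) w(2) weakly_F_chainedD(1)[OF wf] GE by blast
  then have "is_chain T (tilde_star E G) (zu @ [w] @ zv)"
    using ch zs(2,3) w by (simp add: is_chain_append is_chain_Cons)
  then show thesis using w(2) by (rule that)
qed

text \<open>A homotopy of \<open>G\<close>-chains lifts only if its edges lift, and an edge of \<open>E\<close> need not lift: its
  end may leave the image of the limit in \<open>X\<^sub>E\<close>. This is why closeness in the limit is measured
  in stage \<open>E\<close> by a smaller entourage \<open>G \<subseteq> F\<close>.\<close>

theorem lift_homotopy:
  assumes wf: "weakly_F_chained X F E" and G: "entourage X G" "G \<subseteq> F"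
    and zs: "is_chain T (tilde_star E G) zs" and zs': "is_chain T (tilde_star E G) zs'"
    and ends: "hd zs = hd zs'" "last zs = last zs'"
    and hom: "chain_homotopic X G (map proj zs) (map proj zs')"
  shows "chain_homotopic T (tilde_star E G) zs zs'"
proof -
  note w = weakly_F_chainedD[OF wf]
  have GE: "G \<subseteq> E" using G(2) w(3) by blast
  let ?M = "tilde_star E G"
  have M: "entourage T ?M" using entourage_tilde_star[OF w(1) G(1) GE] .
  have ne: "zs \<noteq> []" "zs' \<noteq> []" using zs zs' is_chain_nonempty by auto
  define x y where "x = hd zs" and "y = last zs"
  note pad = limit.chain_homotopic_pad_ends[OF M zs, folded x_def y_def]
    limit.chain_homotopic_pad_ends[OF M zs', folded ends x_def y_def]
  have padc: "is_chain T ?M (x # zs @ [y])" "is_chain T ?M (x # zs' @ [y])"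
    using chain_homotopic_ends(3)[OF pad(1)] chain_homotopic_ends(3)[OF pad(2)] zs zs' by auto
  (* P asks for some lift of the chain reached so far, with the ends of zs, homotopic to
     zs with repeated ends. *)
  define P where "P \<delta> \<longleftrightarrow> (\<exists>ys. is_chain T ?M ys \<and> map proj ys = \<delta> \<and> hd ys = x \<and> last ys = y \<and>
    chain_homotopic T ?M (x # zs @ [y]) ys)" for \<delta>
  have "P (hd (map proj zs') # map proj zs' @ [last (map proj zs')])"
    using hom is_chain_proj[OF zs w(1)]
  proof (induction rule: chain_homotopic_strict_induct)
    case refl
    show ?case unfolding P_def
      using padc(1) ne by (intro exI[of _ "x # zs @ [y]"]) (simp add: x_def y_def hd_map last_map)
  next
    case (insert u p v)
    then obtain ys where ys: "is_chain T ?M ys" "map proj ys = u @ v" "hd ys = x" "last ys = y"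
      "chain_homotopic T ?M (x # zs @ [y]) ys" unfolding P_def by blast
    obtain zu zv where z: "ys = zu @ zv" "map proj zu = u" "map proj zv = v"
      using ys(2) by (auto simp: map_eq_append_conv)
    have zne: "zu \<noteq> []" "zv \<noteq> []" using insert(1,2) z by auto
    obtain q where q: "is_chain T ?M (zu @ [q] @ zv)" "proj q = p"
      using lift_insert[OF wf G ys(1)[unfolded z(1)] zne] insert(3) z by metis
    have "chain_homotopic T ?M (zu @ zv) (zu @ [q] @ zv)"
      using ys(1) q(1) zne z(1) by (intro chain_homotopic_insert) simp_all
    from chain_homotopic_trans[OF ys(5)[unfolded z(1)] this]
    have "chain_homotopic T ?M (x # zs @ [y]) (zu @ [q] @ zv)" .
    moreover have "hd (zu @ [q] @ zv) = x" "last (zu @ [q] @ zv) = y" using ys(3,4) z(1) zne by auto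
    ultimately show ?case unfolding P_def using q z by (intro exI[of _ "zu @ [q] @ zv"]) simp
  next
    case (delete u p v)
    then obtain ys where ys: "is_chain T ?M ys" "map proj ys = u @ [p] @ v" "hd ys = x" "last ys = y"
      "chain_homotopic T ?M (x # zs @ [y]) ys" unfolding P_def by blast
    obtain zu q zv where z: "ys = zu @ [q] @ zv" "map proj zu = u" "map proj zv = v"
      using ys(2) by (auto simp: map_eq_append_conv map_eq_Cons_conv)
    have zne: "zu \<noteq> []" "zv \<noteq> []" using delete(1,2) z by auto
    have ch: "is_chain T ?M zu" "(last zu, q) \<in> ?M" "(q, hd zv) \<in> ?M" "is_chain T ?M zv"
      using ys(1) zne by (simp_all add: z(1) is_chain_append is_chain_Cons)
    have "(proj (last zu), proj (hd zv)) \<in> G"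
      using delete(3) zne by (simp add: z(2,3)[symmetric] is_chain_append last_map hd_map)
    then have short: "(last zu, hd zv) \<in> ?M" using tilde_star_trans ch w(1) GE by blast
    have "chain_homotopic T ?M (zu @ [q] @ zv) (zu @ zv)"
      using ys(1) zne short by (intro chain_homotopic_shortcut) (simp_all add: z(1))
    from chain_homotopic_trans[OF ys(5)[unfolded z(1)] this]
    have "chain_homotopic T ?M (x # zs @ [y]) (zu @ zv)" .
    moreover have "hd (zu @ zv) = x" "last (zu @ zv) = y" using ys(3,4) z(1) zne by auto
    moreover have "is_chain T ?M (zu @ zv)" using ch short zne by (simp add: is_chain_append)
    ultimately show ?case unfolding P_def using z by (intro exI[of _ "zu @ zv"]) simp
  next
    fix z assume "z \<in> points X" then show "(z, z) \<in> G" using entourage_refl[OF G(1)] by blast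
  qed
  then obtain ys where ys: "is_chain T ?M ys" "map proj ys = map proj (x # zs' @ [y])" "hd ys = x" "last ys = y"
    "chain_homotopic T ?M (x # zs @ [y]) ys"
    unfolding P_def using ne ends by (auto simp: x_def y_def hd_map last_map)
  have "length ys = length zs' + 2" using arg_cong[OF ys(2), of length] by simp
  then obtain ms where ms: "ys = x # ms @ [y]"
    using ys(3,4) by (cases ys; cases "tl ys" rule: rev_cases) auto
  (* The lift ys and the given lift zs' need not agree, but they agree in stage E. *)
  have "list_all2 (\<lambda>z w. z \<in> points T \<and> w \<in> points T \<and> z E = w E) ys (x # zs' @ [y])"
    using ys padc(2) by (intro tilde_chain_coords_unique[OF _ _ w(1) GE]) simp_all
  then have "list_all2 (\<lambda>z w. z \<in> points T \<and> w \<in> points T \<and> z E = w E) ms zs'"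
    using ys(2) by (auto simp: ms list_all2_append dest: arg_cong[of _ _ length])
  then have exch: "chain_homotopic T ?M ([x] @ ms @ [y]) ([x] @ zs' @ [y])"
    using ys(1) ms by (intro chain_homotopic_exchange[OF w(1) G(1) GE]) simp_all
  note pad(1)
  also note ys(5)
  also have "chain_homotopic T ?M ys (x # zs' @ [y])" using exch ms by simp
  also have "chain_homotopic T ?M (x # zs' @ [y]) zs'" by (rule chain_homotopic_sym[OF pad(2)])
  finally show ?thesis .
qed

text \<open>Running back along \<open>\<alpha>\<close> and then along \<open>\<beta>\<close> leads from the coordinate of \<open>x\<close> to that of \<open>y\<close>. Since
  \<open>\<alpha>\<close> and \<open>\<beta>\<close> are \<open>F\<close>-chains, this walk lifts to the limit.\<close>

lemma fine_chain_between:
  assumes wf: "weakly_F_chained X F D" and x: "x \<in> points T" and y: "y \<in> points T"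
    and \<alpha>: "is_chain X F \<alpha>" "hd \<alpha> = b" "x F = chain_class X F \<alpha>"
    and \<beta>: "is_chain X F \<beta>" "hd \<beta> = b" "y F = chain_class X F \<beta>"
  shows "\<exists>zs. is_chain T (tilde_star D D) zs \<and> hd zs = x \<and> last zs = y \<and>
    map proj zs = (rev \<alpha> @ tl \<beta>) @ [proj y]"
proof -
  note w = weakly_F_chainedD[OF wf]
  have ends: "last \<alpha> = proj x" "last \<beta> = proj y" using tilde_proj[OF x w(2)] tilde_proj[OF y w(2)] \<alpha> \<beta> by auto
  have ne: "\<alpha> \<noteq> []" "\<beta> \<noteq> []" using \<alpha>(1) \<beta>(1) is_chain_nonempty by auto
  have r: "is_chain X F (rev \<alpha>)" "hd (rev \<alpha>) = proj x" "last (rev \<alpha>) = hd \<beta>"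
    using \<alpha> \<beta> w(2) ends by (simp_all add: is_chain_rev entourage_def hd_rev last_rev)
  note c = is_chain_concat[OF r(1) \<beta>(1) r(3)]
  obtain zs where zs: "is_chain T (tilde_star D F) zs" "hd zs = x" "map proj zs = rev \<alpha> @ tl \<beta>"
    using lift_chain[OF wf x c(1)] c(3) r(2) by auto
  have zne: "zs \<noteq> []" using zs(1) is_chain_nonempty by blast
  have D\<alpha>: "is_chain X D \<alpha>" "is_chain X D \<beta>" using is_chain_mono \<alpha>(1) \<beta>(1) w(3) by blast+
  have "last zs D = chain_class X D (\<alpha> @ map proj (tl zs))"
    using tilde_chain_coord[OF zs(1) w(1,3) D\<alpha>(1) \<alpha>(2)] zs(2) tilde_chain_class_mono[OF x w \<alpha>(3)] by simp
  also have "\<alpha> @ map proj (tl zs) = (\<alpha> @ tl (rev \<alpha>)) @ tl \<beta>"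
    using zs(3) ne by (simp add: map_tl)
  also have "chain_class X D ((\<alpha> @ tl (rev \<alpha>)) @ tl \<beta>) = chain_class X D ([b] @ tl \<beta>)"
    unfolding chain_class_eq_iff
  proof (rule chain_homotopic_concat[OF _ chain_homotopic_refl _ D\<alpha>(2)])
    show "chain_homotopic X D (\<alpha> @ tl (rev \<alpha>)) [b]" using chain_homotopic_cancel'[OF w(1) D\<alpha>(1)] \<alpha>(2) by simp
    then show "is_chain X D (\<alpha> @ tl (rev \<alpha>))" "last (\<alpha> @ tl (rev \<alpha>)) = hd \<beta>"
      using chain_homotopic_ends(2,3) base \<beta>(2) by fastforce+
  qed
  also have "[b] @ tl \<beta> = \<beta>" using \<beta>(2) ne by (cases \<beta>) auto
  also have "chain_class X D \<beta> = y D" using tilde_chain_class_mono[OF y w \<beta>(3)] by simp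
  (* The lift need not end at y, only at a point with the same coordinate in stage D, which is as
     close to y as desired; hence y is appended to the chain. *)
  finally have "(last zs, y) \<in> tilde_star D D"
    using tilde_star_same_coord(1)[OF is_chain_ends(2)[OF zs(1)] y _ w(1) w(1)] by simp
  moreover have "is_chain T (tilde_star D D) zs"
    using is_chain_mono[OF zs(1) tilde_star_mono[OF w(3)]] .
  ultimately have "is_chain T (tilde_star D D) (zs @ [y])" using zne y by (simp add: is_chain_snoc)
  then show ?thesis using zs zne by (intro exI[of _ "zs @ [y]"]) simp
qed

lemma weakly_chained_basis_tilde:
  assumes "entourage T M" "entourage X G"
  obtains D F where "weakly_F_chained X F D" "D \<subseteq> G" "tilde_star D D \<subseteq> M"
proof -
  obtain E where E: "entourage X E" "tilde_star E E \<subseteq> M" using tilde_star_basis[OF assms(1)] .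
  obtain D F where DF: "weakly_F_chained X F D" "D \<subseteq> E \<inter> G"
    using weakly_chained_basis[OF entourage_Int[OF E(1) assms(2)]] .
  have "tilde_star D D \<subseteq> tilde_star E D"
    using tilde_star_bond[OF E(1) weakly_F_chainedD(1)[OF DF(1)]] DF(2) by blast
  also have "\<dots> \<subseteq> tilde_star E E" using DF(2) by (intro tilde_star_mono) blast
  finally show thesis using E(2) DF by (intro that[of F D]) auto
qed

lemma chain_connected_tilde: "chain_connected T"
  unfolding chain_connected_def
proof (intro allI impI ballI)
  fix M x y assume M: "entourage T M" and x: "x \<in> points T" and y: "y \<in> points T"
  obtain E where "entourage X E" using ex_entourage by blast
  then obtain D F where DF: "weakly_F_chained X F D" "tilde_star D D \<subseteq> M"
    using weakly_chained_basis_tilde[OF M] by metis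
  obtain \<alpha> where \<alpha>: "is_chain X F \<alpha>" "hd \<alpha> = b" "x F = chain_class X F \<alpha>" "last \<alpha> = proj x"
    using tilde_cases[OF x weakly_F_chainedD(2)[OF DF(1)]] .
  obtain \<beta> where \<beta>: "is_chain X F \<beta>" "hd \<beta> = b" "y F = chain_class X F \<beta>" "last \<beta> = proj y"
    using tilde_cases[OF y weakly_F_chainedD(2)[OF DF(1)]] .
  obtain zs where "is_chain T (tilde_star D D) zs" "hd zs = x" "last zs = y"
    using fine_chain_between[OF DF(1) x y \<alpha>(1-3) \<beta>(1-3)] by blast
  then show "\<exists>zs. is_chain T M zs \<and> hd zs = x \<and> last zs = y"
    using is_chain_mono[OF _ DF(2)] by blast
qed

text \<open>The fine chain between \<open>x\<close> and \<open>y\<close> projects to a chain that is \<open>F\<close>-homotopic to the edge between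
  their endpoints, because \<open>x\<close> and \<open>y\<close> are close in stage \<open>F\<close>. Both the chain and the edge are lifts
  with the same ends, so the homotopy lifts.\<close>

lemma weakly_chained_tilde_star:
  assumes wf: "weakly_F_chained X F E"
  shows "weakly_F_chained T (tilde_star F F) (tilde_star E F)"
  unfolding weakly_F_chained_def
proof (intro conjI allI impI)
  note w = weakly_F_chainedD[OF wf]
  show "entourage T (tilde_star E F)" "entourage T (tilde_star F F)"
    using entourage_tilde_star w by auto
  show sub: "tilde_star F F \<subseteq> tilde_star E F" using tilde_star_bond w by simp
  fix x y M assume "(x, y) \<in> tilde_star F F \<and> entourage T M \<and> M \<subseteq> tilde_star E F"
  then have xy: "(x, y) \<in> tilde_star F F" and M: "entourage T M" by auto
  have p: "x \<in> points T" "y \<in> points T" using tilde_star_points[OF xy] by auto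
  obtain D F' where DF: "weakly_F_chained X F' D" "D \<subseteq> F" "tilde_star D D \<subseteq> M"
    using weakly_chained_basis_tilde[OF M w(2)] .
  note w' = weakly_F_chainedD[OF DF(1)]
  have F'F: "F' \<subseteq> F" using w'(3) DF(2) by blast
  obtain \<alpha> where \<alpha>: "is_chain X F' \<alpha>" "hd \<alpha> = b" "x F' = chain_class X F' \<alpha>" "last \<alpha> = proj x"
    using tilde_cases[OF p(1) w'(2)] .
  obtain \<beta> where \<beta>: "is_chain X F' \<beta>" "hd \<beta> = b" "y F' = chain_class X F' \<beta>" "last \<beta> = proj y"
    using tilde_cases[OF p(2) w'(2)] .
  obtain zs where zs: "is_chain T (tilde_star D D) zs" "hd zs = x" "last zs = y"
    "map proj zs = (rev \<alpha> @ tl \<beta>) @ [proj y]"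
    using fine_chain_between[OF DF(1) p \<alpha>(1-3) \<beta>(1-3)] by blast
  have F\<alpha>: "is_chain X F \<alpha>" "is_chain X F \<beta>" using is_chain_mono \<alpha>(1) \<beta>(1) F'F by blast+
  have l: "(last \<alpha>, last \<beta>) \<in> F" using tilde_star_proj[OF xy w(2)] \<alpha>(4) \<beta>(4) by simp
  have "(chain_class X F \<alpha>, chain_class X F \<beta>) \<in> XE_star X b F F"
    using xy tilde_chain_class_mono[OF p(1) w(2) w'(2) F'F \<alpha>(3)] tilde_chain_class_mono[OF p(2) w(2) w'(2) F'F \<beta>(3)]
    by (simp add: tilde_star_def)
  then have "chain_homotopic X F (rev \<alpha> @ tl \<beta>) [proj x, proj y]"
    using chain_homotopic_step_iff[OF w(2) F\<alpha> _ l] XE_star_iff[OF w(2) subset_refl F\<alpha>(1) \<alpha>(2) F\<alpha>(2) \<beta>(2)]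
      \<alpha> \<beta> by simp
  moreover have "chain_homotopic X F (rev \<alpha> @ tl \<beta>) ((rev \<alpha> @ tl \<beta>) @ [proj y])"
  proof -
    have "sym F" using w(2) by (simp add: entourage_def)
    then have "is_chain X F (rev \<alpha>)" "last (rev \<alpha>) = hd \<beta>" using F\<alpha>(1) \<alpha>(2) \<beta>(2) by (simp_all add: is_chain_rev last_rev)
    note c = is_chain_concat[OF this(1) F\<alpha>(2) this(2)]
    show ?thesis using chain_homotopic_dup_last[OF w(2) c(1)] c(2) \<beta>(4) by simp
  qed
  ultimately have hom: "chain_homotopic X F (map proj zs) (map proj [x, y])"
    using zs(4) chain_homotopic_sym chain_homotopic_trans by (metis list.simps(8,9))
  have "tilde_star D D \<subseteq> tilde_star E D"
    using tilde_star_bond[OF w(1) w'(1)] DF(2) w(3) by blast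
  also have "\<dots> \<subseteq> tilde_star E F" using tilde_star_mono[OF DF(2)] .
  finally have zsE: "is_chain T (tilde_star E F) zs" using is_chain_mono[OF zs(1)] by blast
  have xyE: "is_chain T (tilde_star E F) [x, y]" using p xy sub by (auto simp: is_chain_Cons)
  have "chain_homotopic T (tilde_star E F) zs [x, y]"
    by (rule lift_homotopy[OF wf w(2) subset_refl zsE xyE _ _ hom]) (use zs in auto)
  then show "\<exists>zs. is_chain T M zs \<and> hd zs = x \<and> last zs = y \<and>
      chain_class T (tilde_star E F) zs = chain_class T (tilde_star E F) [x, y]"
    using zs(2,3) is_chain_mono[OF zs(1) DF(3)] chain_class_eq_iff by blast
qed

lemma tilde_star_weakly_chained_basis:
  assumes "entourage T M"
  obtains E F where "weakly_F_chained X F E" "tilde_star E F \<subseteq> M"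
proof -
  obtain E where "entourage X E" using ex_entourage by blast
  then obtain D F where DF: "weakly_F_chained X F D" "tilde_star D D \<subseteq> M"
    using weakly_chained_basis_tilde[OF assms] by metis
  then show thesis using that[OF DF(1)] tilde_star_mono[OF weakly_F_chainedD(3)[OF DF(1)], of D] by blast
qed

lemma weakly_chained_tilde: "weakly_chained T"
  unfolding weakly_chained_def
proof (intro conjI exI)
  let ?B = "{tilde_star E F |E F. weakly_F_chained X F E}"
  show "chain_connected T" by (rule chain_connected_tilde)
  show "uniform_basis T ?B"
    unfolding uniform_basis_def
  proof (intro conjI ballI allI impI)
    fix M assume "M \<in> ?B"
    then show "entourage T M" using entourage_tilde_star weakly_F_chainedD by blast
  next
    fix M assume "entourage T M"
    then obtain E F where "weakly_F_chained X F E" "tilde_star E F \<subseteq> M"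
      by (rule tilde_star_weakly_chained_basis)
    then show "\<exists>E\<in>?B. E \<subseteq> M" by blast
  qed
  show "\<forall>E\<in>?B. weakly_chained_entourage T E"
    using weakly_chained_tilde_star unfolding weakly_chained_entourage_def by blast
qed

text \<open>A loop of the limit projects to a loop of \<open>X\<close>. That the loop closes up in a stage says that
  its projection is null-homotopic there, and this null-homotopy lifts.\<close>

lemma tilde_loop_null_homotopic:
  assumes wf: "weakly_F_chained X F E"
    and zs: "is_chain T (tilde_star F F) zs" "hd zs = tilde_base X b" "last zs = tilde_base X b"
  shows "chain_homotopic T (tilde_star E F) zs [tilde_base X b]"
proof -
  note w = weakly_F_chainedD[OF wf]
  have bF: "tilde_base X b F = chain_class X F [b]" using w(2) by (simp add: tilde_base_def)
  have "last zs F = chain_class X F ([b] @ map proj (tl zs))"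
    using tilde_chain_coord[OF zs(1) w(2) subset_refl, of "[b]"] zs(2) base bF by simp
  moreover have "[b] @ map proj (tl zs) = map proj zs"
    using zs(2) is_chain_nonempty[OF zs(1)] tilde_base_points(2) by (cases zs) auto
  ultimately have "chain_homotopic X F (map proj zs) [b]"
    using zs(3) bF by (simp add: chain_class_eq_iff[symmetric])
  moreover have "tilde_star F F \<subseteq> tilde_star E F" using tilde_star_bond w by simp
  ultimately show ?thesis
    using zs is_chain_mono[OF zs(1)] tilde_base_points
    by (intro lift_homotopy[OF wf w(2) subset_refl]) simp_all
qed

lemma pi_U_tilde_trivial: "carrier (pi_U T (tilde_base X b)) = {\<one>\<^bsub>pi_U T (tilde_base X b)\<^esub>}"
proof -
  interpret Y: pointed_uspace T "tilde_base X b"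
    by unfold_locales (rule tilde_base_points)
  have "g = \<one>\<^bsub>pi_U T (tilde_base X b)\<^esub>" if g: "g \<in> carrier (pi_U T (tilde_base X b))" for g
    unfolding Y.one_pi_U
  proof (rule Y.tilde_eqI)
    show gT: "g \<in> points Y.T" using g by (simp add: Y.carrier_pi_U)
    fix M assume M: "entourage T M"
    obtain E F where EF: "weakly_F_chained X F E" "tilde_star E F \<subseteq> M"
      using tilde_star_weakly_chained_basis[OF M] .
    note w = weakly_F_chainedD[OF EF(1)]
    have ent: "entourage T (tilde_star F F)" using entourage_tilde_star[OF w(2) w(2)] by simp
    have sub: "tilde_star F F \<subseteq> M" using tilde_star_bond[OF w(1,2,3)] EF(2) by blast
    obtain zs where zs: "is_chain T (tilde_star F F) zs" "hd zs = tilde_base X b" "last zs = tilde_base X b"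
      "g (tilde_star F F) = chain_class T (tilde_star F F) zs"
      using Y.pi_E_cases[OF Y.pi_U_coord[OF g ent]] .
    have "g M = chain_class T M zs" using Y.tilde_chain_class_mono[OF gT M ent sub zs(4)] .
    also have "\<dots> = chain_class T M [tilde_base X b]"
      using tilde_loop_null_homotopic[OF EF(1) zs(1-3)] chain_homotopic_mono[OF _ EF(2)]
      by (simp add: chain_class_eq_iff)
    finally show "g M = tilde_base T (tilde_base X b) M" using M by (simp add: tilde_base_def)
  qed (rule Y.tilde_base_points)
  then show ?thesis using group.is_monoid[OF Y.group_pi_U] monoid.one_closed by blast
qed

theorem uniformly_simply_connected_tilde: "uniformly_simply_connected T (tilde_base X b)"
  unfolding uniformly_simply_connected_def
  using hausdorff_tilde tilde_base_points(1) weakly_chained_tilde pi_U_tilde_trivial by blast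

end


section \<open>The limit is a generalized regular cover\<close>

context pointed_uspace
begin

text \<open>The bonding maps between the spaces \<open>X\<^sub>E\<close> need not be surjective. The stages of the covering are
  therefore cut down to the images of the limit.\<close>

definition fine_part :: "('a \<times> 'a) set \<Rightarrow> 'a list set uspace" where
  "fine_part E = subspace (XE X b E) ((\<lambda>x. x E) ` points T)"

definition fine_group :: "('a \<times> 'a) set \<Rightarrow> 'a list set monoid" where
  "fine_group E = (pi_E X b E)\<lparr>carrier := (\<lambda>g. g E) ` carrier (pi_U X b)\<rparr>"

definition fine_action :: "('a \<times> 'a) set \<Rightarrow> 'a list set \<Rightarrow> 'a list set \<Rightarrow> 'a list set" where
  "fine_action E g = (\<lambda>c\<in>points (fine_part E). class_concat X E g c)"

lemma points_fine_part: "points (fine_part E) = (\<lambda>x. x E) ` points T"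
  by (simp add: fine_part_def)

lemma fine_part_subset: "entourage X E \<Longrightarrow> points (fine_part E) \<subseteq> points (XE X b E)"
  using tilde_closed by (auto simp: points_fine_part)

lemma fine_group_simps:
  "carrier (fine_group E) = (\<lambda>g. g E) ` carrier (pi_U X b)"
  "mult (fine_group E) = class_concat X E" "one (fine_group E) = chain_class X E [b]"
  by (simp_all add: fine_group_def)

lemma fine_group_subset: "entourage X E \<Longrightarrow> carrier (fine_group E) \<subseteq> carrier (pi_E X b E)"
  using pi_U_coord by (auto simp: fine_group_simps)

lemma hausdorff_fine_part: "entourage X E \<Longrightarrow> hausdorff_uniform (fine_part E)"
  unfolding fine_part_def
  using hausdorff_subspace(1)[OF hausdorff_XE(1)] fine_part_subset points_fine_part by simp

definition fine_star :: "('a \<times> 'a) set \<Rightarrow> ('a \<times> 'a) set \<Rightarrow> ('a list set \<times> 'a list set) set" where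
  "fine_star E F = XE_star X b E F \<inter> points (fine_part E) \<times> points (fine_part E)"

lemma entourage_fine_star:
  assumes "entourage X E" "entourage X F" "F \<subseteq> E"
  shows "entourage (fine_part E) (fine_star E F)"
  using hausdorff_subspace(2)[OF hausdorff_XE(1)[OF assms(1)] _ hausdorff_XE(2)[OF assms]]
    fine_part_subset[OF assms(1)] by (simp add: fine_part_def fine_star_def)

lemma eventually_fine_part:
  assumes "entourage X E"
  shows "(\<forall>\<^sub>F p in unif (fine_part E). P p) \<longleftrightarrow> (\<exists>F. entourage X F \<and> F \<subseteq> E \<and> (\<forall>p\<in>fine_star E F. P p))"
  unfolding fine_part_def eventually_subspace eventually_XE[OF assms] fine_star_def
  by (simp add: fine_part_def Ball_def imp_conjL)

lemma fine_star_tilde: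
  "x \<in> points T \<Longrightarrow> y \<in> points T \<Longrightarrow> (x E, y E) \<in> fine_star E F \<longleftrightarrow> (x, y) \<in> tilde_star E F"
  by (auto simp: fine_star_def tilde_star_def points_fine_part)

lemma fine_part_cases:
  assumes "c \<in> points (fine_part E)" obtains x where "x \<in> points T" "c = x E"
  using assms by (auto simp: points_fine_part)

lemma bond_fine_part:
  assumes "entourage X E" "entourage X F" "F \<subseteq> E"
  shows "bond_XE X E ` points (fine_part F) = points (fine_part E)"
  unfolding points_fine_part image_image by (rule image_cong) (simp_all add: tilde_bond assms)

lemma bond_fine_group:
  assumes "entourage X E" "entourage X F" "F \<subseteq> E"
  shows "bond_XE X E ` carrier (fine_group F) = carrier (fine_group E)"
  unfolding fine_group_simps image_image
  by (rule image_cong) (simp_all add: tilde_bond assms carrier_pi_U)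

lemma uniformly_cont_bond_fine_part:
  assumes "entourage X E" "entourage X F" "F \<subseteq> E"
  shows "uniformly_cont (fine_part F) (fine_part E) (bond_XE X E)"
  unfolding uniformly_cont_def filterlim_iff
proof (intro conjI allI impI)
  show "bond_XE X E \<in> points (fine_part F) \<rightarrow> points (fine_part E)" using bond_fine_part[OF assms] by blast
  fix P assume "\<forall>\<^sub>F p in unif (fine_part E). P p"
  then obtain G where G: "entourage X G" "G \<subseteq> E" "\<forall>p\<in>fine_star E G. P p"
    unfolding eventually_fine_part[OF assms(1)] by (elim exE conjE)
  have "P (bond_XE X E c, bond_XE X E d)" if cd: "(c, d) \<in> fine_star F (G \<inter> F)" for c d
  proof -
    have "(bond_XE X E c, bond_XE X E d) \<in> XE_star X b E G"
      using bond_XE_star[of c d F "G \<inter> F" E] assms cd XE_star_mono[of "G \<inter> F" G E] by (auto simp: fine_star_def)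
    then show ?thesis using G(3) cd bond_fine_part[OF assms] by (auto simp: fine_star_def)
  qed
  then show "\<forall>\<^sub>F p in unif (fine_part F). P (case p of (x, y) \<Rightarrow> (bond_XE X E x, bond_XE X E y))"
    unfolding eventually_fine_part[OF assms(2)] using G assms
    by (intro exI[of _ "G \<inter> F"]) (auto simp: entourage_Int)
qed

lemma group_hom_coord:
  assumes E: "entourage X E" shows "group_hom (pi_U X b) (pi_E X b E) (\<lambda>g. g E)"
  using group_pi_U group_pi_E[OF E] pi_U_coord E
  by (simp add: group_hom_def group_hom_axioms_def hom_def mult_pi_U)

lemma group_fine_group:
  assumes E: "entourage X E" shows "group (fine_group E)"
  unfolding fine_group_def
  by (rule subgroup.subgroup_is_group[OF group_hom.img_is_subgroup[OF group_hom_coord[OF E]] group_pi_E[OF E]])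

lemma bond_hom_fine_group:
  assumes "entourage X E" "entourage X F" "F \<subseteq> E"
  shows "bond_XE X E \<in> hom (fine_group F) (fine_group E)"
proof (rule homI)
  show "bond_XE X E g \<in> carrier (fine_group E)" if "g \<in> carrier (fine_group F)" for g
    using bond_fine_group[OF assms] that by blast
  fix g h assume gh: "g \<in> carrier (fine_group F)" "h \<in> carrier (fine_group F)"
  then have "g \<in> carrier (pi_E X b F)" "h \<in> points (XE X b F)"
    using fine_group_subset[OF assms(2)] by (auto simp: carrier_pi_E)
  then show "bond_XE X E (g \<otimes>\<^bsub>fine_group F\<^esub> h) = bond_XE X E g \<otimes>\<^bsub>fine_group E\<^esub> bond_XE X E h"
    using bond_concat[OF assms(3)] by (simp add: fine_group_simps)
qed

lemma fine_concat_closed: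
  assumes E: "entourage X E" and g: "g \<in> carrier (fine_group E)" and c: "c \<in> points (fine_part E)"
  shows "class_concat X E g c \<in> points (fine_part E)"
proof -
  obtain h where h: "h \<in> carrier (pi_U X b)" "g = h E" using g by (auto simp: fine_group_simps)
  obtain x where x: "x \<in> points T" "c = x E" using c by (rule fine_part_cases)
  have "class_concat X E g c = pi_U_action X b h x E" using pi_U_action_eq[OF x(1)] E h(2) x(2) by simp
  then show ?thesis using pi_U_action_closed(1)[OF h(1) x(1)] by (simp add: points_fine_part)
qed

lemma concat_fine_star:
  assumes "entourage X E" "F \<subseteq> E" "g \<in> carrier (fine_group E)" "(c, d) \<in> fine_star E F"
  shows "(class_concat X E g c, class_concat X E g d) \<in> fine_star E F"
  using assms concat_XE_star[of c d E F g] fine_concat_closed[OF assms(1,3)] fine_group_subset[OF assms(1)]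
  by (auto simp: fine_star_def)

lemma faithful_fine_action:
  assumes E: "entourage X E"
  shows "faithful_action (fine_group E) (points (fine_part E)) (fine_action E)"
proof -
  have one: "chain_class X E [b] \<in> points (fine_part E)"
    using tilde_base_points(1) E unfolding points_fine_part
    by (intro image_eqI[of _ _ "tilde_base X b"]) (simp_all add: tilde_base_def)
  have act: "group_action (fine_group E) (points (fine_part E)) (fine_action E)"
  proof (rule group_actionI[OF group_fine_group[OF E]])
    fix g h c assume g: "g \<in> carrier (fine_group E)" and h: "h \<in> carrier (fine_group E)"
      and c: "c \<in> points (fine_part E)"
    have "g \<in> carrier (pi_E X b E)" "h \<in> carrier (pi_E X b E)" "c \<in> points (XE X b E)"
      using g h c fine_group_subset[OF E] fine_part_subset[OF E] by auto
    then show "fine_action E (g \<otimes>\<^bsub>fine_group E\<^esub> h) c = fine_action E g (fine_action E h c)"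
      using concat_assoc fine_concat_closed[OF E h c] c by (simp add: fine_action_def fine_group_simps)
  next
    fix c assume c: "c \<in> points (fine_part E)"
    then have "c \<in> points (XE X b E)" using fine_part_subset[OF E] by auto
    then show "fine_action E \<one>\<^bsub>fine_group E\<^esub> c = c"
      using concat_one c by (simp add: fine_action_def fine_group_simps)
  qed (use fine_concat_closed[OF E] in \<open>auto simp: fine_action_def\<close>)
  have "fine_action E g (chain_class X E [b]) = g" if "g \<in> carrier (fine_group E)" for g
    using monoid.r_one[OF group.is_monoid[OF group_pi_E[OF E]], of g] one that fine_group_subset[OF E]
    by (auto simp: fine_action_def)
  then have "inj_on (fine_action E) (carrier (fine_group E))" by (metis inj_onI)
  with act show ?thesis by (simp add: faithful_action_def faithful_action_axioms_def)
qed

lemma uniform_homeo_fine_action: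
  assumes E: "entourage X E" and g: "g \<in> carrier (fine_group E)"
  shows "uniform_homeo (fine_part E) (fine_part E) (fine_action E g)"
proof -
  interpret faithful_action "fine_group E" "points (fine_part E)" "fine_action E"
    by (rule faithful_fine_action[OF E])
  interpret group "fine_group E" by (rule group_fine_group[OF E])
  let ?K = "fine_part E"
  have cont: "uniformly_cont ?K ?K f"
    if h: "h \<in> carrier (fine_group E)" and f: "\<And>c. c \<in> points ?K \<Longrightarrow> f c = class_concat X E h c" for f h
    unfolding uniformly_cont_def filterlim_iff
  proof (intro conjI allI impI)
    show "f \<in> points ?K \<rightarrow> points ?K" using f fine_concat_closed[OF E h] by simp
    fix P assume "\<forall>\<^sub>F p in unif ?K. P p"
    then obtain F where F: "entourage X F" "F \<subseteq> E" "\<forall>p\<in>fine_star E F. P p"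
      unfolding eventually_fine_part[OF E] by (elim exE conjE)
    have "P (f c, f d)" if cd: "(c, d) \<in> fine_star E F" for c d
      using concat_fine_star[OF E F(2) h cd] F(3) cd by (simp add: fine_star_def f)
    then show "\<forall>\<^sub>F p in unif ?K. P (case p of (x, y) \<Rightarrow> (f x, f y))"
      unfolding eventually_fine_part[OF E] using F by (intro exI[of _ F]) auto
  qed
  have bij: "bij_betw (fine_action E g) (points ?K) (points ?K)"
    using bij_prop0[OF g] by (simp add: Bij_def)
  have inv: "inv\<^bsub>fine_group E\<^esub> g \<in> carrier (fine_group E)" using g by simp
  have "inv_into (points ?K) (fine_action E g) c = class_concat X E (inv\<^bsub>fine_group E\<^esub> g) c"
    if c: "c \<in> points ?K" for c
  proof (rule inv_into_f_eq)
    show "inj_on (fine_action E g) (points ?K)" using bij by (rule bij_betw_imp_inj_on)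
    show cl: "class_concat X E (inv\<^bsub>fine_group E\<^esub> g) c \<in> points ?K" by (rule fine_concat_closed[OF E inv c])
    have "fine_action E (inv\<^bsub>fine_group E\<^esub> g) c = class_concat X E (inv\<^bsub>fine_group E\<^esub> g) c"
      using c by (simp add: fine_action_def)
    then show "fine_action E g (class_concat X E (inv\<^bsub>fine_group E\<^esub> g) c) = c"
      using orbit_sym_aux[OF inv c] g by simp
  qed
  then show ?thesis
    unfolding uniform_homeo_def using bij cont[OF g] cont[OF inv] by (simp add: fine_action_def)
qed

end

context weakly_chained_metrizable
begin

lemma ex_fine_lift:
  assumes wf: "weakly_F_chained X F E" and z: "(y, z) \<in> F" "(y, z) \<in> G" and G: "G \<subseteq> E"
  obtains c d where "(c, d) \<in> fine_star E G" "class_end c = y" "class_end d = z"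
proof -
  note w = weakly_F_chainedD[OF wf]
  have "y \<in> points X" using entourage_points[OF w(2) z(1)] by blast
  then obtain x where x: "x \<in> points T" "y = proj x" using proj_surj by blast
  obtain x' where x': "x' \<in> points T" "proj x' = z" "(x, x') \<in> tilde_star E G"
    using lift_step[OF wf x(1) z[unfolded x(2)] G] .
  show thesis
    using that[of "x E" "x' E"] fine_star_tilde[OF x(1) x'(1)] x' x(2) tilde_proj[OF x(1) w(1)] tilde_proj[OF x'(1) w(1)]
    by simp
qed

text \<open>Images of entourages are entourages, because \<open>F\<close>-small pairs lift to pairs that are as close as
  they are themselves.\<close>

lemma bi_uniformly_cont_class_end:
  assumes wf: "weakly_F_chained X F E"
  shows "bi_uniformly_cont (fine_part E) X class_end"
  unfolding bi_uniformly_cont_def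
proof (intro conjI allI impI)
  note w = weakly_F_chainedD[OF wf]
  show "uniformly_cont (fine_part E) X class_end"
    unfolding uniformly_cont_def filterlim_iff
  proof (intro conjI allI impI)
    show "class_end \<in> points (fine_part E) \<rightarrow> points X"
      using class_end_points fine_part_subset[OF w(1)] by blast
    fix P assume "\<forall>\<^sub>F p in unif X. P p"
    then obtain G where G: "entourage X G" "\<forall>p\<in>G. P p" unfolding eventually_unif_iff by (elim exE conjE)
    have "P (class_end c, class_end d)" if "(c, d) \<in> fine_star E (G \<inter> E)" for c d
      using that XE_star_class_end[of c d E "G \<inter> E"] G(2) by (auto simp: fine_star_def)
    then show "\<forall>\<^sub>F p in unif (fine_part E). P (case p of (x, y) \<Rightarrow> (class_end x, class_end y))"
      unfolding eventually_fine_part[OF w(1)] using G w(1)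
      by (intro exI[of _ "G \<inter> E"]) (auto simp: entourage_Int)
  qed
  fix D assume D: "entourage (fine_part E) D"
  then have "\<forall>\<^sub>F p in unif (fine_part E). p \<in> D" by (simp add: entourage_def)
  then obtain G where G: "entourage X G" "G \<subseteq> E" "\<forall>p\<in>fine_star E G. p \<in> D"
    unfolding eventually_fine_part[OF w(1)] by (elim exE conjE)
  let ?D = "(\<lambda>(c, d). (class_end c, class_end d)) ` D"
  have "G \<inter> F \<subseteq> ?D"
  proof
    fix p assume p: "p \<in> G \<inter> F"
    obtain y z where yz: "p = (y, z)" by (cases p)
    obtain c d where "(c, d) \<in> fine_star E G" "class_end c = y" "class_end d = z"
      using ex_fine_lift[OF wf, of y z G] p yz G(2) by auto
    then show "p \<in> ?D" using G(3) yz by force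
  qed
  then have "\<forall>\<^sub>F p in unif X. p \<in> ?D"
    using entourage_Int[OF G(1) w(2)] unfolding eventually_unif_iff by blast
  moreover have "?D \<subseteq> points X \<times> points X"
    using D class_end_points fine_part_subset[OF w(1)] by (fastforce simp: entourage_def)
  moreover have "sym ?D"
    using D by (force simp: entourage_def sym_def)
  ultimately show "entourage X ?D" by (simp add: entourage_def)
qed

text \<open>Most properties descend from the limit. That the action is uniformly free comes from the fact
  that close points of a stage with the same endpoint coincide.\<close>

lemma discrete_cover_fine_part:
  assumes wf: "weakly_F_chained X F E"
  shows "discrete_cover (fine_part E) X class_end (fine_group E) (fine_action E)"
  unfolding discrete_cover_def
proof (intro conjI ballI)
  note w = weakly_F_chainedD[OF wf]
  show "hausdorff_uniform (fine_part E)" "hausdorff_uniform X"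
    using hausdorff_fine_part[OF w(1)] hausdorff by auto
  show "bi_uniformly_cont (fine_part E) X class_end" by (rule bi_uniformly_cont_class_end[OF wf])
  show "class_end ` points (fine_part E) = points X"
    unfolding points_fine_part image_image proj_surj[symmetric]
    by (rule image_cong) (simp_all add: tilde_proj[OF _ w(1)])
  show "faithful_action (fine_group E) (points (fine_part E)) (fine_action E)"
    by (rule faithful_fine_action[OF w(1)])
  show "uniform_homeo (fine_part E) (fine_part E) (fine_action E g)" if "g \<in> carrier (fine_group E)" for g
    by (rule uniform_homeo_fine_action[OF w(1) that])
  show "{z \<in> points (fine_part E). class_end z = class_end c} = orbit (fine_group E) (fine_action E) c"
    if c: "c \<in> points (fine_part E)" for c
  proof (intro equalityI subsetI)
    obtain x where x: "x \<in> points T" "c = x E" using c by (rule fine_part_cases)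
    fix d assume d: "d \<in> {z \<in> points (fine_part E). class_end z = class_end c}"
    then obtain y where y: "y \<in> points T" "d = y E" using fine_part_cases by blast
    have "proj x = proj y" using d x y tilde_proj w(1) by simp
    then obtain g where g: "g \<in> carrier (pi_U X b)" "pi_U_action X b g x = y"
      using pi_U_transitive_on_fibre[OF x(1) y(1)] by metis
    have "fine_action E (g E) c = d"
      using fun_cong[OF pi_U_action_eq[OF x(1)], of g E] g(2) c w(1) x(2) y(2) by (simp add: fine_action_def)
    then show "d \<in> orbit (fine_group E) (fine_action E) c"
      using g(1) unfolding orbit_def fine_group_simps by blast
  next
    fix d assume "d \<in> orbit (fine_group E) (fine_action E) c"
    then obtain g where g: "g \<in> carrier (fine_group E)" "d = fine_action E g c"
      unfolding orbit_def by blast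
    then have d: "d = class_concat X E g c" using c by (simp add: fine_action_def)
    have "g \<in> carrier (pi_E X b E)" "c \<in> points (XE X b E)"
      using g(1) c fine_group_subset[OF w(1)] fine_part_subset[OF w(1)] by auto
    then show "d \<in> {z \<in> points (fine_part E). class_end z = class_end c}"
      using concat_closed(2) fine_concat_closed[OF w(1) g(1) c] d by simp
  qed
  show "\<exists>\<B>. uniform_basis (fine_part E) \<B> \<and>
      (\<forall>D\<in>\<B>. \<forall>g\<in>carrier (fine_group E). \<forall>(x, y)\<in>D. (fine_action E g x, fine_action E g y) \<in> D)"
  proof (intro exI conjI ballI)
    let ?B = "fine_star E ` {F. entourage X F \<and> F \<subseteq> E}"
    show "uniform_basis (fine_part E) ?B"
      unfolding uniform_basis_def
    proof (intro conjI ballI allI impI)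
      show "entourage (fine_part E) D" if "D \<in> ?B" for D
        using that entourage_fine_star[OF w(1)] by auto
      fix D assume "entourage (fine_part E) D"
      then have "\<forall>\<^sub>F p in unif (fine_part E). p \<in> D" by (simp add: entourage_def)
      then obtain G where "entourage X G" "G \<subseteq> E" "\<forall>p\<in>fine_star E G. p \<in> D"
        unfolding eventually_fine_part[OF w(1)] by (elim exE conjE)
      then show "\<exists>B\<in>?B. B \<subseteq> D" by blast
    qed
    fix D g p assume D: "D \<in> ?B" and g: "g \<in> carrier (fine_group E)" and p: "p \<in> D"
    obtain F where F: "F \<subseteq> E" "D = fine_star E F" using D by blast
    obtain c d where cd: "p = (c, d)" by (cases p)
    have "(fine_action E g c, fine_action E g d) \<in> D"
      using concat_fine_star[OF w(1) F(1) g, of c d] p F(2) cd by (simp add: fine_action_def fine_star_def)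
    then show "case p of (x, y) \<Rightarrow> (fine_action E g x, fine_action E g y) \<in> D" using cd by simp
  qed
  show "\<exists>D. entourage (fine_part E) D \<and> (\<forall>g\<in>carrier (fine_group E).
      (\<exists>y\<in>points (fine_part E). (y, fine_action E g y) \<in> D) \<longrightarrow> g = \<one>\<^bsub>fine_group E\<^esub>)"
  proof (intro exI[of _ "fine_star E E"] conjI ballI impI)
    show "entourage (fine_part E) (fine_star E E)" using entourage_fine_star w(1) by simp
    fix g assume g: "g \<in> carrier (fine_group E)"
      and "\<exists>y\<in>points (fine_part E). (y, fine_action E g y) \<in> fine_star E E"
    then obtain c where c: "c \<in> points (fine_part E)" "(c, class_concat X E g c) \<in> XE_star X b E E"
      by (auto simp: fine_star_def fine_action_def)
    have p: "g \<in> carrier (pi_E X b E)" "c \<in> points (XE X b E)"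
      using g c(1) fine_group_subset[OF w(1)] fine_part_subset[OF w(1)] by auto
    have "c = class_concat X E g c"
      using concat_closed(2)[OF p] by (intro XE_star_same_end[OF c(2) w(1)]) simp_all
    then show "g = \<one>\<^bsub>fine_group E\<^esub>"
      using concat_right_cancel[OF w(1) p] by (simp add: fine_group_simps)
  qed
qed

definition fine_index :: "('a \<times> 'a) set set" where
  "fine_index = {E. weakly_chained_entourage X E}"

definition fine_finer :: "('a \<times> 'a) set rel" where
  "fine_finer = finer X \<inter> fine_index \<times> fine_index"

lemma fine_index_cases:
  assumes "E \<in> fine_index" obtains F where "weakly_F_chained X F E"
  using assms by (auto simp: fine_index_def weakly_chained_entourage_def)

lemma fine_index_entourage: "E \<in> fine_index \<Longrightarrow> entourage X E"
  using fine_index_cases weakly_F_chainedD(1) by metis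

lemma fine_index_cofinal:
  assumes "entourage X D" shows "\<exists>E\<in>fine_index. (D, E) \<in> finer X"
proof -
  obtain E F where "weakly_F_chained X F E" "E \<subseteq> D" using weakly_chained_basis[OF assms] .
  then show ?thesis
    using assms weakly_F_chainedD(1)
    by (intro bexI[of _ E]) (auto simp: finer_iff fine_index_def weakly_chained_entourage_def)
qed

lemma directed_fine_finer: "directed_index fine_index fine_finer"
  unfolding fine_finer_def
  by (rule directed_index_cofinal[OF directed_finer]) (use fine_index_entourage fine_index_cofinal in auto)

lemma fine_finerD: "(E, F) \<in> fine_finer \<Longrightarrow> entourage X E \<and> entourage X F \<and> F \<subseteq> E"
  by (simp add: fine_finer_def finer_iff)

lemma inverse_system_fine_part:
  "uniform_inverse_system fine_index fine_finer fine_part (\<lambda>E F. bond_XE X E)"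
  unfolding uniform_inverse_system_def
proof (intro conjI allI impI ballI)
  fix E c assume "E \<in> fine_index" "c \<in> points (fine_part E)"
  then show "bond_XE X E c = c" using bond_XE_refl fine_part_subset fine_index_entourage by blast
next
  fix E F D c assume EFD: "(E, F) \<in> fine_finer \<and> (F, D) \<in> fine_finer" and c: "c \<in> points (fine_part D)"
  then have "c \<in> points (XE X b D)" using fine_part_subset fine_finerD by blast
  then show "bond_XE X E c = bond_XE X E (bond_XE X F c)"
    using bond_XE_trans[of F E D c] EFD fine_finerD by blast
next
  fix q assume "q \<in> fine_finer"
  then show "case q of (E, F) \<Rightarrow> uniformly_cont (fine_part F) (fine_part E) (bond_XE X E)"
    using uniformly_cont_bond_fine_part fine_finerD by (cases q) auto
qed (use directed_fine_finer hausdorff_fine_part fine_index_entourage in auto)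

lemma group_inverse_system_fine_group:
  "group_inverse_system fine_index fine_finer fine_group (\<lambda>E F. bond_XE X E)"
  unfolding group_inverse_system_def
proof (intro conjI allI impI ballI)
  have sub: "g \<in> points (XE X b E)" if "entourage X E" "g \<in> carrier (fine_group E)" for E g
    using that fine_group_subset by (auto simp: carrier_pi_E)
  {
    fix E g assume "E \<in> fine_index" "g \<in> carrier (fine_group E)"
    then show "bond_XE X E g = g" using bond_XE_refl sub fine_index_entourage by blast
  next
    fix E F D g assume EFD: "(E, F) \<in> fine_finer \<and> (F, D) \<in> fine_finer" and g: "g \<in> carrier (fine_group D)"
    then have "g \<in> points (XE X b D)" using sub fine_finerD by blast
    then show "bond_XE X E g = bond_XE X E (bond_XE X F g)"
      using bond_XE_trans[of F E D g] EFD fine_finerD by blast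
  next
    fix q assume "q \<in> fine_finer"
    then show "case q of (E, F) \<Rightarrow> bond_XE X E \<in> hom (fine_group F) (fine_group E)"
      using bond_hom_fine_group fine_finerD by (cases q) auto
  }
qed (use directed_fine_finer group_fine_group fine_index_entourage in auto)

abbreviation fine_limit :: "(('a \<times> 'a) set \<Rightarrow> 'a list set) uspace" where
  "fine_limit \<equiv> inv_limit_uspace fine_index fine_finer fine_part (\<lambda>E F. bond_XE X E)"

lemma bij_betw_fine_limit:
  "bij_betw (\<lambda>x. restrict x fine_index) (points T) (points fine_limit)"
  unfolding points_inv_limit_uspace points_tilde fine_finer_def
proof (rule inv_limit_cofinal[OF directed_finer])
  show "bond_XE X E c \<in> points (XE X b E)" if "(E, F) \<in> finer X" "c \<in> points (XE X b F)" for E F c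
    using that bond_XE_closed(1)[of F E c] by (simp add: finer_iff)
  show "bond_XE X E c = bond_XE X E (bond_XE X F c)"
    if "(E, F) \<in> finer X" "(F, D) \<in> finer X" "c \<in> points (XE X b D)" for E F D c
    using that bond_XE_trans[of F E D c] by (simp add: finer_iff)
  show "points (fine_part E) = (\<lambda>x. x E) ` inv_limit_points (entourages X) (finer X) (\<lambda>E. points (XE X b E))
      (\<lambda>E F. bond_XE X E)" for E
    by (simp add: points_fine_part points_tilde)
qed (use bond_XE_refl fine_index_entourage fine_index_cofinal in auto)

lemma iso_fine_limit:
  "(\<lambda>g. restrict g fine_index) \<in> iso (pi_U X b) (inv_limit_group fine_index fine_finer fine_group (\<lambda>E F. bond_XE X E))"
proof -
  have U: "carrier (pi_U X b) = inv_limit_points (entourages X) (finer X) (\<lambda>E. carrier (pi_E X b E)) (\<lambda>E F. bond_XE X E)"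
    by (simp add: pi_U_def inv_limit_group_def)
  have "bij_betw (\<lambda>g. restrict g fine_index) (carrier (pi_U X b))
      (inv_limit_points fine_index fine_finer (\<lambda>E. carrier (fine_group E)) (\<lambda>E F. bond_XE X E))"
    unfolding U fine_finer_def
  proof (rule inv_limit_cofinal[OF directed_finer])
    show "bond_XE X E g \<in> carrier (pi_E X b E)" if "(E, F) \<in> finer X" "g \<in> carrier (pi_E X b F)" for E F g
      using that bond_XE_closed[of F E g] by (simp add: finer_iff carrier_pi_E)
    show "bond_XE X E g = bond_XE X E (bond_XE X F g)"
      if "(E, F) \<in> finer X" "(F, D) \<in> finer X" "g \<in> carrier (pi_E X b D)" for E F D g
      using that bond_XE_trans[of F E D g] by (simp add: finer_iff carrier_pi_E)
    show "carrier (fine_group E) = (\<lambda>x. x E) ` inv_limit_points (entourages X) (finer X) (\<lambda>E. carrier (pi_E X b E))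
        (\<lambda>E F. bond_XE X E)" for E
      by (simp add: fine_group_simps U)
  qed (use bond_XE_refl fine_index_entourage fine_index_cofinal in \<open>auto simp: carrier_pi_E\<close>)
  then have bij: "bij_betw (\<lambda>g. restrict g fine_index) (carrier (pi_U X b))
      (carrier (inv_limit_group fine_index fine_finer fine_group (\<lambda>E F. bond_XE X E)))"
    by (simp add: inv_limit_group_def)
  show ?thesis
  proof (rule isoI[OF homI bij])
    show "restrict g fine_index \<in> carrier (inv_limit_group fine_index fine_finer fine_group (\<lambda>E F. bond_XE X E))"
      if "g \<in> carrier (pi_U X b)" for g
      using bij_betw_apply[OF bij that] .
    show "restrict (g \<otimes>\<^bsub>pi_U X b\<^esub> h) fine_index =
        restrict g fine_index \<otimes>\<^bsub>inv_limit_group fine_index fine_finer fine_group (\<lambda>E F. bond_XE X E)\<^esub> restrict h fine_index"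
      for g h
      using fine_index_entourage by (auto simp: mult_pi_U inv_limit_group_def fine_group_simps fun_eq_iff)
  qed
qed

lemma uniform_homeo_fine_limit: "uniform_homeo T fine_limit (\<lambda>x. restrict x fine_index)"
  unfolding uniform_homeo_def
proof (intro conjI)
  interpret sys: inverse_system fine_index fine_finer fine_part "\<lambda>E F. bond_XE X E"
    by unfold_locales (rule inverse_system_fine_part)
  let ?f = "\<lambda>x. restrict x fine_index"
  let ?g = "inv_into (points T) ?f"
  show bij: "bij_betw ?f (points T) (points fine_limit)" by (rule bij_betw_fine_limit)
  show "uniformly_cont T fine_limit ?f"
    unfolding uniformly_cont_def filterlim_iff
  proof (intro conjI allI impI)
    show "?f \<in> points T \<rightarrow> points fine_limit" by (intro Pi_I bij_betw_apply[OF bij])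
    fix P assume "\<forall>\<^sub>F p in unif fine_limit. P p"
    then obtain E D where E: "E \<in> fine_index" "entourage (fine_part E) D"
      and P: "\<forall>x\<in>points fine_limit. \<forall>y\<in>points fine_limit. (x E, y E) \<in> D \<longrightarrow> P (x, y)"
      unfolding sys.eventually_inv_limit by (elim bexE exE conjE)
    note E' = fine_index_entourage[OF E(1)]
    have "\<forall>\<^sub>F p in unif (fine_part E). p \<in> D" using E(2) by (simp add: entourage_def)
    then obtain F where F: "entourage X F" "F \<subseteq> E" "\<forall>p\<in>fine_star E F. p \<in> D"
      unfolding eventually_fine_part[OF E'] by (elim exE conjE)
    have "P (?f x, ?f y)" if xy: "(x, y) \<in> tilde_star F F" for x y
    proof -
      have p: "x \<in> points T" "y \<in> points T" using tilde_star_points[OF xy] by auto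
      have "(x, y) \<in> tilde_star E F" using tilde_star_bond[OF E' F(1,2)] xy by blast
      then have "(x E, y E) \<in> D" using fine_star_tilde[OF p] F(3) by blast
      then show ?thesis
        using P bij_betw_apply[OF bij p(1)] bij_betw_apply[OF bij p(2)] E(1) by simp
    qed
    then show "\<forall>\<^sub>F p in unif T. P (case p of (x, y) \<Rightarrow> (?f x, ?f y))"
      unfolding eventually_tilde using F(1) by (intro exI[of _ F]) auto
  qed
  show "uniformly_cont fine_limit T ?g"
    unfolding uniformly_cont_def filterlim_iff
  proof (intro conjI allI impI)
    note bij' = bij_betw_inv_into[OF bij]
    show "?g \<in> points fine_limit \<rightarrow> points T" by (intro Pi_I bij_betw_apply[OF bij'])
    fix P assume "\<forall>\<^sub>F p in unif T. P p"
    then obtain E where E: "entourage X E" "\<forall>p\<in>tilde_star E E. P p"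
      unfolding eventually_tilde by (elim exE conjE)
    obtain F where F: "F \<in> fine_index" "F \<subseteq> E" using fine_index_cofinal[OF E(1)] by (auto simp: finer_iff)
    note F' = fine_index_entourage[OF F(1)]
    have sub: "tilde_star F F \<subseteq> tilde_star E E"
      using tilde_star_bond[OF E(1) F' F(2) subset_refl] tilde_star_mono[OF F(2)] by blast
    have "P (?g x, ?g y)"
      if xy: "x \<in> points fine_limit" "y \<in> points fine_limit" "(x F, y F) \<in> fine_star F F" for x y
    proof -
      have g: "?g z \<in> points T" "?g z F = z F" if "z \<in> points fine_limit" for z
        using bij_betw_apply[OF bij' that] fun_cong[OF bij_betw_inv_into_right[OF bij that], of F] F(1) by simp_all
      have "(?g x, ?g y) \<in> tilde_star F F"
        using fine_star_tilde[OF g(1)[OF xy(1)] g(1)[OF xy(2)], of F F] g(2)[OF xy(1)] g(2)[OF xy(2)] xy(3) by simp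
      then show ?thesis using sub E(2) by blast
    qed
    then show "\<forall>\<^sub>F p in unif fine_limit. P (case p of (x, y) \<Rightarrow> (?g x, ?g y))"
      unfolding sys.eventually_inv_limit
      using F(1) entourage_fine_star[OF F' F' subset_refl] by (intro bexI[of _ F] exI[of _ "fine_star F F"]) auto
  qed
qed

theorem generalized_regular_covering_tilde:
  "generalized_regular_covering TYPE(('a \<times> 'a) set) TYPE('a list set) TYPE('a list set)
     T X proj (pi_U X b) (pi_U_action X b)"
  unfolding generalized_regular_covering_def
proof (intro conjI ballI)
  show "\<exists>(I :: ('a \<times> 'a) set set) r (Yi :: _ \<Rightarrow> 'a list set uspace) p fi (Gi :: _ \<Rightarrow> 'a list set monoid) h acti q s.
      uniform_inverse_system I r Yi p \<and>
      (\<forall>(i, j)\<in>r. p i j ` points (Yi j) = points (Yi i)) \<and>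
      group_inverse_system I r Gi h \<and>
      (\<forall>(i, j)\<in>r. h i j ` carrier (Gi j) = carrier (Gi i)) \<and>
      (\<forall>i\<in>I. discrete_cover (Yi i) X (fi i) (Gi i) (acti i)) \<and>
      (\<forall>(i, j)\<in>r. \<forall>y\<in>points (Yi j). fi i (p i j y) = fi j y) \<and>
      (\<forall>(i, j)\<in>r. \<forall>g\<in>carrier (Gi j). \<forall>y\<in>points (Yi j). p i j (acti j g y) = acti i (h i j g) (p i j y)) \<and>
      uniform_homeo T (inv_limit_uspace I r Yi p) (\<lambda>y. \<lambda>i\<in>I. q i y) \<and>
      (\<forall>i\<in>I. q i ` points T = points (Yi i)) \<and>
      (\<forall>i\<in>I. \<forall>y\<in>points T. proj y = fi i (q i y)) \<and>
      (\<lambda>g. \<lambda>i\<in>I. s i g) \<in> iso (pi_U X b) (inv_limit_group I r Gi h) \<and>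
      (\<forall>i\<in>I. \<forall>g\<in>carrier (pi_U X b). \<forall>y\<in>points T. q i (pi_U_action X b g y) = acti i (s i g) (q i y))"
  proof (rule exI[of _ fine_index], rule exI[of _ fine_finer], rule exI[of _ fine_part],
      rule exI[of _ "\<lambda>E F. bond_XE X E"], rule exI[of _ "\<lambda>E. class_end"], rule exI[of _ fine_group],
      rule exI[of _ "\<lambda>E F. bond_XE X E"], rule exI[of _ fine_action],
      rule exI[of _ "\<lambda>E x. x E"], rule exI[of _ "\<lambda>E g. g E"], intro conjI)
    show "uniform_inverse_system fine_index fine_finer fine_part (\<lambda>E F. bond_XE X E)"
      by (rule inverse_system_fine_part)
    show "\<forall>(E, F)\<in>fine_finer. bond_XE X E ` points (fine_part F) = points (fine_part E)"
      using bond_fine_part fine_finerD by blast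
    show "group_inverse_system fine_index fine_finer fine_group (\<lambda>E F. bond_XE X E)"
      by (rule group_inverse_system_fine_group)
    show "\<forall>(E, F)\<in>fine_finer. bond_XE X E ` carrier (fine_group F) = carrier (fine_group E)"
      using bond_fine_group fine_finerD by blast
    show "\<forall>E\<in>fine_index. discrete_cover (fine_part E) X class_end (fine_group E) (fine_action E)"
      using discrete_cover_fine_part fine_index_cases by metis
    show "\<forall>(E, F)\<in>fine_finer. \<forall>c\<in>points (fine_part F). class_end (bond_XE X E c) = class_end c"
    proof (intro ballI, clarify)
      fix E F c assume EF: "(E, F) \<in> fine_finer" and c: "c \<in> points (fine_part F)"
      have e: "entourage X F" "F \<subseteq> E" using fine_finerD[OF EF] by auto
      show "class_end (bond_XE X E c) = class_end c"
        using bond_XE_closed(2)[OF e(2)] fine_part_subset[OF e(1)] c by auto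
    qed
    show "\<forall>(E, F)\<in>fine_finer. \<forall>g\<in>carrier (fine_group F). \<forall>c\<in>points (fine_part F).
        bond_XE X E (fine_action F g c) = fine_action E (bond_XE X E g) (bond_XE X E c)"
    proof (intro ballI, clarify)
      fix E F g c assume EF: "(E, F) \<in> fine_finer" and g: "g \<in> carrier (fine_group F)" and c: "c \<in> points (fine_part F)"
      have e: "entourage X E" "entourage X F" "F \<subseteq> E" using fine_finerD[OF EF] by auto
      have "g \<in> carrier (pi_E X b F)" "c \<in> points (XE X b F)"
        using g c fine_group_subset[OF e(2)] fine_part_subset[OF e(2)] by auto
      moreover have "bond_XE X E c \<in> points (fine_part E)" using bond_fine_part[OF e] c by blast
      ultimately show "bond_XE X E (fine_action F g c) = fine_action E (bond_XE X E g) (bond_XE X E c)"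
        using bond_concat[OF e(3)] c by (simp add: fine_action_def)
    qed
    show "uniform_homeo T fine_limit (\<lambda>y. \<lambda>i\<in>fine_index. y i)" by (rule uniform_homeo_fine_limit)
    show "\<forall>E\<in>fine_index. (\<lambda>x. x E) ` points T = points (fine_part E)" by (simp add: points_fine_part)
    show "\<forall>E\<in>fine_index. \<forall>x\<in>points T. proj x = class_end (x E)"
      using tilde_proj fine_index_entourage by blast
    show "(\<lambda>g. \<lambda>i\<in>fine_index. g i) \<in> iso (pi_U X b) (inv_limit_group fine_index fine_finer fine_group (\<lambda>E F. bond_XE X E))"
      by (rule iso_fine_limit)
    show "\<forall>E\<in>fine_index. \<forall>g\<in>carrier (pi_U X b). \<forall>x\<in>points T. pi_U_action X b g x E = fine_action E (g E) (x E)"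
      using pi_U_action_eq fine_index_entourage by (simp add: fine_action_def points_fine_part)
  qed
qed (use hausdorff_tilde hausdorff group_action_pi_U proj_surj fibre_eq_orbit in blast)+

end

theorem theorem5:
  fixes X :: "'a uspace" and b :: 'a
  assumes "hausdorff_uniform X" and "b \<in> points X"
    and "weakly_chained X"
    and "metrizable_uniform X"
  shows "UU_cover TYPE(('a \<times> 'a) set) TYPE('a list set) TYPE('a list set)
           (tilde X b) (tilde_base X b) X (tilde_proj X) (pi_U X b) (pi_U_action X b)"
proof -
  interpret weakly_chained_metrizable X b
    using assms by unfold_locales
  show ?thesis
    unfolding UU_cover_def
    using generalized_regular_covering_tilde uniformly_simply_connected_tilde by blast
qed

end
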